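(* Let $\mathcal{E}$ be a Frobenius category with triangulated quotient $\mathcal{T}$, and let $\mathcal{R}$ be a class of objects in $\mathcal{E}$ such that: (i) $\mathcal{R}$ is a precovering class in $\mathcal{E}$, and every $\mathcal{R}$-precover in $\mathcal{E}$ has a kernel in $\mathcal{E}$; (ii) $\mathcal{R}$ is closed under shifts in $\mathcal{T}$; (iii) for all $R$ in $\mathcal{R}$ the injective hull $I(R)$ is in $\mathcal{R}$. Suppose that every object in $\mathcal{T}$ has finite $\mathcal{R}$-dimension. Let $\mathcal{S}$ be the smallest full localizing subcategory of $\mathcal{T}$ that contains $\mathcal{R}$. If the quotient $j:\mathcal{T}\to\mathcal{T}/\mathcal{S}$ exists, then $j$ has a right adjoint $j_!$.
   Context: A Frobenius category is an exact category $\mathcal{E}$ with enough projectives and enough injectives in which the projective and injective objects coincide; $\mathcal{P}$ denotes the class of these objects and $\mathcal{T}=\mathcal{E}/\mathcal{P}$ the (stable) quotient category, which has the same objects as $\mathcal{E}$ and is triangulated. Each object $R$ comes with a conflation $R\to I(R)\to R[1]$ with $I(R)$ injective (the "injective hull"), and this gives the shift $R[1]$ in $\mathcal{T}$. Precovers: a class $\mathcal{R}$ of objects of $\mathcal{E}$ is precovering (contravariantly finite) if for each object $X$ of $\mathcal{E}$ there is a (not necessarily unique) morphism $R_X\to X$ in $\mathcal{E}$ with $R_X\in\mathcal{R}$, called a precover, such that every morphism in $\mathcal{E}$ from an object of $\mathcal{R}$ to $X$ factors in $\mathcal{E}$ through $R_X\to X$. Resolutions and dimension: an $\mathcal{R}$-resolution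 of $X$ is obtained by setting $K_0=X$ and, inductively, choosing a precover $R_i\to K_i$ with kernel $K_{i+1}\to R_i$ in $\mathcal{E}$ (the sequences $K_{i+1}\to R_i\to K_i$ are not required to be conflations). If $K_d\in\mathcal{R}$ for some $d$, then $X$ has finite $\mathcal{R}$-dimension. A localizing subcategory is a triangulated subcategory closed under direct sums (arbitrary coproducts). $j:\mathcal{T}\to\mathcal{T}/\mathcal{S}$ denotes the (Verdier) quotient functor of triangulated categories. *)

theory Defs
  imports "HOL-Algebra.Group"
begin

section \<open>Categories and functors\<close>

text \<open>
  Objects form a set, and every arrow carries its domain and codomain. Nothing is required of the
  operations outside the arrows and composable pairs; \<open>g \<cdot>\<^bsub>C\<^esub> f\<close> means \<open>g\<close> after \<open>f\<close>.
\<close>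

record ('o, 'a) cat =
  Ob :: "'o set"
  Arr :: "'a set"
  Dom :: "'a \<Rightarrow> 'o"
  Cod :: "'a \<Rightarrow> 'o"
  Ident :: "'o \<Rightarrow> 'a"
  Comp :: "'a \<Rightarrow> 'a \<Rightarrow> 'a"  (infixr "\<cdot>\<index>" 70)

definition Hom :: "('o, 'a, 'm) cat_scheme \<Rightarrow> 'o \<Rightarrow> 'o \<Rightarrow> 'a set" where
  "Hom C X Y = {f \<in> Arr C. Dom C f = X \<and> Cod C f = Y}"

definition category :: "('o, 'a, 'm) cat_scheme \<Rightarrow> bool" where
  "category C \<longleftrightarrow>
     (\<forall>f \<in> Arr C. Dom C f \<in> Ob C \<and> Cod C f \<in> Ob C) \<and>
     (\<forall>X \<in> Ob C. Ident C X \<in> Hom C X X) \<and>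
     (\<forall>X Y Z. \<forall>f \<in> Hom C X Y. \<forall>g \<in> Hom C Y Z. g \<cdot>\<^bsub>C\<^esub> f \<in> Hom C X Z) \<and>
     (\<forall>X Y. \<forall>f \<in> Hom C X Y. f \<cdot>\<^bsub>C\<^esub> Ident C X = f \<and> Ident C Y \<cdot>\<^bsub>C\<^esub> f = f) \<and>
     (\<forall>W X Y Z. \<forall>f \<in> Hom C W X. \<forall>g \<in> Hom C X Y. \<forall>h \<in> Hom C Y Z.
        h \<cdot>\<^bsub>C\<^esub> (g \<cdot>\<^bsub>C\<^esub> f) = (h \<cdot>\<^bsub>C\<^esub> g) \<cdot>\<^bsub>C\<^esub> f)"

definition is_iso :: "('o, 'a, 'm) cat_scheme \<Rightarrow> 'a \<Rightarrow> bool" where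
  "is_iso C f \<longleftrightarrow> f \<in> Arr C \<and>
     (\<exists>g \<in> Hom C (Cod C f) (Dom C f).
        g \<cdot>\<^bsub>C\<^esub> f = Ident C (Dom C f) \<and> f \<cdot>\<^bsub>C\<^esub> g = Ident C (Cod C f))"

definition isomorphic :: "('o, 'a, 'm) cat_scheme \<Rightarrow> 'o \<Rightarrow> 'o \<Rightarrow> bool" where
  "isomorphic C X Y \<longleftrightarrow> (\<exists>f \<in> Hom C X Y. is_iso C f)"

definition is_pushout :: "('o, 'a, 'm) cat_scheme \<Rightarrow> 'a \<Rightarrow> 'a \<Rightarrow> 'a \<Rightarrow> 'a \<Rightarrow> bool" where
  "is_pushout C i f i' f' \<longleftrightarrow>
     i \<in> Arr C \<and> f \<in> Arr C \<and> i' \<in> Arr C \<and> f' \<in> Arr C \<and>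
     Dom C i = Dom C f \<and> Dom C f' = Cod C i \<and> Dom C i' = Cod C f \<and> Cod C i' = Cod C f' \<and>
     i' \<cdot>\<^bsub>C\<^esub> f = f' \<cdot>\<^bsub>C\<^esub> i \<and>
     (\<forall>Z. \<forall>g \<in> Hom C (Cod C f) Z. \<forall>h \<in> Hom C (Cod C i) Z. g \<cdot>\<^bsub>C\<^esub> f = h \<cdot>\<^bsub>C\<^esub> i \<longrightarrow>
        (\<exists>!t. t \<in> Hom C (Cod C i') Z \<and> t \<cdot>\<^bsub>C\<^esub> i' = g \<and> t \<cdot>\<^bsub>C\<^esub> f' = h))"

definition is_pullback :: "('o, 'a, 'm) cat_scheme \<Rightarrow> 'a \<Rightarrow> 'a \<Rightarrow> 'a \<Rightarrow> 'a \<Rightarrow> bool" where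
  "is_pullback C p f p' f' \<longleftrightarrow>
     p \<in> Arr C \<and> f \<in> Arr C \<and> p' \<in> Arr C \<and> f' \<in> Arr C \<and>
     Cod C p = Cod C f \<and> Cod C f' = Dom C p \<and> Cod C p' = Dom C f \<and> Dom C p' = Dom C f' \<and>
     f \<cdot>\<^bsub>C\<^esub> p' = p \<cdot>\<^bsub>C\<^esub> f' \<and>
     (\<forall>Z. \<forall>g \<in> Hom C Z (Dom C f). \<forall>h \<in> Hom C Z (Dom C p). f \<cdot>\<^bsub>C\<^esub> g = p \<cdot>\<^bsub>C\<^esub> h \<longrightarrow>
        (\<exists>!t. t \<in> Hom C Z (Dom C p') \<and> p' \<cdot>\<^bsub>C\<^esub> t = g \<and> f' \<cdot>\<^bsub>C\<^esub> t = h))"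

definition is_coproduct ::
  "('o, 'a, 'm) cat_scheme \<Rightarrow> 'i set \<Rightarrow> ('i \<Rightarrow> 'o) \<Rightarrow> 'o \<Rightarrow> ('i \<Rightarrow> 'a) \<Rightarrow> bool" where
  "is_coproduct C I X Z u \<longleftrightarrow>
     Z \<in> Ob C \<and> (\<forall>i \<in> I. X i \<in> Ob C \<and> u i \<in> Hom C (X i) Z) \<and>
     (\<forall>W \<in> Ob C. \<forall>v. (\<forall>i \<in> I. v i \<in> Hom C (X i) W) \<longrightarrow>
        (\<exists>!t. t \<in> Hom C Z W \<and> (\<forall>i \<in> I. t \<cdot>\<^bsub>C\<^esub> u i = v i)))"

definition is_functor ::
  "('o, 'a, 'm) cat_scheme \<Rightarrow> ('p, 'b, 'n) cat_scheme \<Rightarrow> ('o \<Rightarrow> 'p) \<Rightarrow> ('a \<Rightarrow> 'b) \<Rightarrow> bool" where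
  "is_functor C D FO FA \<longleftrightarrow> category C \<and> category D \<and>
     (\<forall>X \<in> Ob C. FO X \<in> Ob D \<and> FA (Ident C X) = Ident D (FO X)) \<and>
     (\<forall>X Y. \<forall>f \<in> Hom C X Y. FA f \<in> Hom D (FO X) (FO Y)) \<and>
     (\<forall>X Y Z. \<forall>f \<in> Hom C X Y. \<forall>g \<in> Hom C Y Z. FA (g \<cdot>\<^bsub>C\<^esub> f) = FA g \<cdot>\<^bsub>D\<^esub> FA f)"

definition is_category_isomorphism ::
  "('o, 'a, 'm) cat_scheme \<Rightarrow> ('p, 'b, 'n) cat_scheme \<Rightarrow> ('o \<Rightarrow> 'p) \<Rightarrow> ('a \<Rightarrow> 'b) \<Rightarrow> bool" where
  "is_category_isomorphism C D FO FA \<longleftrightarrow> is_functor C D FO FA \<and>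
     bij_betw FO (Ob C) (Ob D) \<and> bij_betw FA (Arr C) (Arr D)"

definition right_adjoint ::
  "('o, 'a, 'm) cat_scheme \<Rightarrow> ('p, 'b, 'n) cat_scheme \<Rightarrow>
   ('o \<Rightarrow> 'p) \<Rightarrow> ('a \<Rightarrow> 'b) \<Rightarrow> ('p \<Rightarrow> 'o) \<Rightarrow> ('b \<Rightarrow> 'a) \<Rightarrow> bool" where
  "right_adjoint C D FO FA GO GA \<longleftrightarrow>
     is_functor C D FO FA \<and> is_functor D C GO GA \<and>
     (\<exists>\<phi>. (\<forall>X \<in> Ob C. \<forall>Y \<in> Ob D. bij_betw (\<phi> X Y) (Hom D (FO X) Y) (Hom C X (GO Y))) \<and>
          (\<forall>X' X Y Y'. \<forall>f \<in> Hom C X' X. \<forall>h \<in> Hom D (FO X) Y. \<forall>g \<in> Hom D Y Y'.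
             \<phi> X' Y' (g \<cdot>\<^bsub>D\<^esub> (h \<cdot>\<^bsub>D\<^esub> FA f)) = GA g \<cdot>\<^bsub>C\<^esub> (\<phi> X Y h \<cdot>\<^bsub>C\<^esub> f)))"

definition has_right_adjoint ::
  "('o, 'a, 'm) cat_scheme \<Rightarrow> ('p, 'b, 'n) cat_scheme \<Rightarrow> ('o \<Rightarrow> 'p) \<Rightarrow> ('a \<Rightarrow> 'b) \<Rightarrow> bool" where
  "has_right_adjoint C D FO FA \<longleftrightarrow> (\<exists>GO GA. right_adjoint C D FO FA GO GA)"


section \<open>Additive and exact categories\<close>

record ('o, 'a) preadd_cat = "('o, 'a) cat" +
  Add :: "'a \<Rightarrow> 'a \<Rightarrow> 'a"
  Zero :: "'o \<Rightarrow> 'o \<Rightarrow> 'a"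

definition hom_group :: "('o, 'a, 'm) preadd_cat_scheme \<Rightarrow> 'o \<Rightarrow> 'o \<Rightarrow> 'a monoid" where
  "hom_group C X Y = \<lparr>carrier = Hom C X Y, mult = Add C, one = Zero C X Y\<rparr>"

definition is_zero_object :: "('o, 'a, 'm) preadd_cat_scheme \<Rightarrow> 'o \<Rightarrow> bool" where
  "is_zero_object C Z \<longleftrightarrow> Z \<in> Ob C \<and> Ident C Z = Zero C Z Z"

definition additive_category :: "('o, 'a, 'm) preadd_cat_scheme \<Rightarrow> bool" where
  "additive_category C \<longleftrightarrow> category C \<and>
     (\<forall>X \<in> Ob C. \<forall>Y \<in> Ob C. comm_group (hom_group C X Y)) \<and>
     (\<forall>X Y Z. \<forall>f \<in> Hom C X Y. \<forall>f' \<in> Hom C X Y. \<forall>g \<in> Hom C Y Z. \<forall>g' \<in> Hom C Y Z.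
        g \<cdot>\<^bsub>C\<^esub> Add C f f' = Add C (g \<cdot>\<^bsub>C\<^esub> f) (g \<cdot>\<^bsub>C\<^esub> f') \<and>
        Add C g g' \<cdot>\<^bsub>C\<^esub> f = Add C (g \<cdot>\<^bsub>C\<^esub> f) (g' \<cdot>\<^bsub>C\<^esub> f)) \<and>
     (\<exists>Z. is_zero_object C Z) \<and>
     (\<forall>X \<in> Ob C. \<forall>Y \<in> Ob C. \<exists>B \<in> Ob C.
        \<exists>i1 \<in> Hom C X B. \<exists>i2 \<in> Hom C Y B. \<exists>p1 \<in> Hom C B X. \<exists>p2 \<in> Hom C B Y.
          p1 \<cdot>\<^bsub>C\<^esub> i1 = Ident C X \<and> p2 \<cdot>\<^bsub>C\<^esub> i2 = Ident C Y \<and>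
          p1 \<cdot>\<^bsub>C\<^esub> i2 = Zero C Y X \<and> p2 \<cdot>\<^bsub>C\<^esub> i1 = Zero C X Y \<and>
          Add C (i1 \<cdot>\<^bsub>C\<^esub> p1) (i2 \<cdot>\<^bsub>C\<^esub> p2) = Ident C B)"

definition is_kernel :: "('o, 'a, 'm) preadd_cat_scheme \<Rightarrow> 'a \<Rightarrow> 'a \<Rightarrow> bool" where
  "is_kernel C k f \<longleftrightarrow> k \<in> Arr C \<and> f \<in> Arr C \<and> Cod C k = Dom C f \<and>
     f \<cdot>\<^bsub>C\<^esub> k = Zero C (Dom C k) (Cod C f) \<and>
     (\<forall>W. \<forall>g \<in> Hom C W (Dom C f). f \<cdot>\<^bsub>C\<^esub> g = Zero C W (Cod C f) \<longrightarrow>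
        (\<exists>!h. h \<in> Hom C W (Dom C k) \<and> k \<cdot>\<^bsub>C\<^esub> h = g))"

definition is_cokernel :: "('o, 'a, 'm) preadd_cat_scheme \<Rightarrow> 'a \<Rightarrow> 'a \<Rightarrow> bool" where
  "is_cokernel C q f \<longleftrightarrow> q \<in> Arr C \<and> f \<in> Arr C \<and> Dom C q = Cod C f \<and>
     q \<cdot>\<^bsub>C\<^esub> f = Zero C (Dom C f) (Cod C q) \<and>
     (\<forall>W. \<forall>g \<in> Hom C (Cod C f) W. g \<cdot>\<^bsub>C\<^esub> f = Zero C (Dom C f) W \<longrightarrow>
        (\<exists>!h. h \<in> Hom C (Cod C q) W \<and> h \<cdot>\<^bsub>C\<^esub> q = g))"

record ('o, 'a) exact_cat = "('o, 'a) preadd_cat" +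
  Confl :: "('a \<times> 'a) set"

definition inflation :: "('o, 'a, 'm) exact_cat_scheme \<Rightarrow> 'a \<Rightarrow> bool" where
  "inflation E i \<longleftrightarrow> (\<exists>p. (i, p) \<in> Confl E)"

definition deflation :: "('o, 'a, 'm) exact_cat_scheme \<Rightarrow> 'a \<Rightarrow> bool" where
  "deflation E p \<longleftrightarrow> (\<exists>i. (i, p) \<in> Confl E)"

text \<open>Quillen's axioms for an exact category, in the form given by Keller and Buehler.\<close>

definition exact_category :: "('o, 'a, 'm) exact_cat_scheme \<Rightarrow> bool" where
  "exact_category E \<longleftrightarrow> additive_category E \<and>
     (\<forall>(i, p) \<in> Confl E. is_kernel E i p \<and> is_cokernel E p i) \<and>
     (\<forall>i p i' p' a b c. (i, p) \<in> Confl E \<longrightarrow>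
        is_iso E a \<longrightarrow> is_iso E b \<longrightarrow> is_iso E c \<longrightarrow>
        a \<in> Hom E (Dom E i) (Dom E i') \<longrightarrow> b \<in> Hom E (Cod E i) (Cod E i') \<longrightarrow>
        c \<in> Hom E (Cod E p) (Cod E p') \<longrightarrow>
        i' \<in> Arr E \<longrightarrow> p' \<in> Hom E (Cod E i') (Cod E p') \<longrightarrow>
        b \<cdot>\<^bsub>E\<^esub> i = i' \<cdot>\<^bsub>E\<^esub> a \<longrightarrow> c \<cdot>\<^bsub>E\<^esub> p = p' \<cdot>\<^bsub>E\<^esub> b \<longrightarrow> (i', p') \<in> Confl E) \<and>
     (\<forall>X \<in> Ob E. inflation E (Ident E X) \<and> deflation E (Ident E X)) \<and>
     (\<forall>i j. inflation E i \<longrightarrow> inflation E j \<longrightarrow> Cod E i = Dom E j \<longrightarrow> inflation E (j \<cdot>\<^bsub>E\<^esub> i)) \<and>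
     (\<forall>p q. deflation E p \<longrightarrow> deflation E q \<longrightarrow> Cod E p = Dom E q \<longrightarrow> deflation E (q \<cdot>\<^bsub>E\<^esub> p)) \<and>
     (\<forall>i f. inflation E i \<longrightarrow> f \<in> Arr E \<longrightarrow> Dom E f = Dom E i \<longrightarrow>
        (\<exists>i' f'. is_pushout E i f i' f' \<and> inflation E i')) \<and>
     (\<forall>p f. deflation E p \<longrightarrow> f \<in> Arr E \<longrightarrow> Cod E f = Cod E p \<longrightarrow>
        (\<exists>p' f'. is_pullback E p f p' f' \<and> deflation E p'))"

definition projective :: "('o, 'a, 'm) exact_cat_scheme \<Rightarrow> 'o \<Rightarrow> bool" where
  "projective E P \<longleftrightarrow> P \<in> Ob E \<and>
     (\<forall>p. deflation E p \<longrightarrow> (\<forall>f \<in> Hom E P (Cod E p). \<exists>g \<in> Hom E P (Dom E p). p \<cdot>\<^bsub>E\<^esub> g = f))"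

definition injective :: "('o, 'a, 'm) exact_cat_scheme \<Rightarrow> 'o \<Rightarrow> bool" where
  "injective E J \<longleftrightarrow> J \<in> Ob E \<and>
     (\<forall>i. inflation E i \<longrightarrow> (\<forall>f \<in> Hom E (Dom E i) J. \<exists>g \<in> Hom E (Cod E i) J. g \<cdot>\<^bsub>E\<^esub> i = f))"


section \<open>Frobenius categories and their stable categories\<close>

text \<open>
  The record also contains the chosen conflations \<open>X \<rightarrow> I(X) \<rightarrow> X[1]\<close>, as
  the pair \<open>(inc X, prj X)\<close>. \<open>I(X)\<close> is an injective object receiving an inflation from \<open>X\<close>; no
  minimality is implied by the name.
\<close>

record ('o, 'a) frob_cat = "('o, 'a) exact_cat" +
  inc :: "'o \<Rightarrow> 'a"
  prj :: "'o \<Rightarrow> 'a"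

definition hull :: "('o, 'a, 'm) frob_cat_scheme \<Rightarrow> 'o \<Rightarrow> 'o" where
  "hull E X = Cod E (inc E X)"

definition susp :: "('o, 'a, 'm) frob_cat_scheme \<Rightarrow> 'o \<Rightarrow> 'o" where
  "susp E X = Cod E (prj E X)"

definition frobenius_category :: "('o, 'a, 'm) frob_cat_scheme \<Rightarrow> bool" where
  "frobenius_category E \<longleftrightarrow> exact_category E \<and>
     (\<forall>X \<in> Ob E. \<exists>p. deflation E p \<and> projective E (Dom E p) \<and> Cod E p = X) \<and>
     (\<forall>X \<in> Ob E. \<exists>i. inflation E i \<and> injective E (Cod E i) \<and> Dom E i = X) \<and>
     (\<forall>X. projective E X \<longleftrightarrow> injective E X) \<and>
     (\<forall>X \<in> Ob E. (inc E X, prj E X) \<in> Confl E \<and> Dom E (inc E X) = X \<and> injective E (hull E X))"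

text \<open>Parallel arrows are identified when they differ by an arrow through a projective object.\<close>

definition stable_eq :: "('o, 'a, 'm) exact_cat_scheme \<Rightarrow> 'a \<Rightarrow> 'a \<Rightarrow> bool" where
  "stable_eq E f g \<longleftrightarrow> f \<in> Arr E \<and> g \<in> Hom E (Dom E f) (Cod E f) \<and>
     (\<exists>P. projective E P \<and>
        (\<exists>a \<in> Hom E (Dom E f) P. \<exists>b \<in> Hom E P (Cod E f). g = Add E f (b \<cdot>\<^bsub>E\<^esub> a)))"

definition stable_class :: "('o, 'a, 'm) exact_cat_scheme \<Rightarrow> 'a \<Rightarrow> 'a set" where
  "stable_class E f = {g. stable_eq E f g}"

definition stable_preadd_cat :: "('o, 'a, 'm) exact_cat_scheme \<Rightarrow> ('o, 'a set) preadd_cat" where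
  "stable_preadd_cat E =
     \<lparr>Ob = Ob E,
      Arr = stable_class E ` Arr E,
      Dom = (\<lambda>A. Dom E (SOME f. f \<in> A)),
      Cod = (\<lambda>A. Cod E (SOME f. f \<in> A)),
      Ident = (\<lambda>X. stable_class E (Ident E X)),
      Comp = (\<lambda>B A. {h. \<exists>g \<in> B. \<exists>f \<in> A. stable_eq E (g \<cdot>\<^bsub>E\<^esub> f) h}),
      Add = (\<lambda>A B. {h. \<exists>f \<in> A. \<exists>g \<in> B. stable_eq E (Add E f g) h}),
      Zero = (\<lambda>X Y. stable_class E (Zero E X Y))\<rparr>"

text \<open>\<open>f[1]\<close> is induced by any extension of \<open>f : X \<rightarrow> Y\<close> to an arrow \<open>I(X) \<rightarrow> I(Y)\<close>.\<close>

definition susp_arr :: "('o, 'a, 'm) frob_cat_scheme \<Rightarrow> 'a set \<Rightarrow> 'a set" where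
  "susp_arr E A = {h'. \<exists>f \<in> A.
     \<exists>k \<in> Hom E (hull E (Dom E f)) (hull E (Cod E f)).
     \<exists>h \<in> Hom E (susp E (Dom E f)) (susp E (Cod E f)).
       k \<cdot>\<^bsub>E\<^esub> inc E (Dom E f) = inc E (Cod E f) \<cdot>\<^bsub>E\<^esub> f \<and>
       h \<cdot>\<^bsub>E\<^esub> prj E (Dom E f) = prj E (Cod E f) \<cdot>\<^bsub>E\<^esub> k \<and>
       stable_eq E h h'}"

text \<open>
  The standard triangle \<open>X \<rightarrow> Y \<rightarrow> C \<rightarrow> X[1]\<close> on \<open>u : X \<rightarrow> Y\<close> comes from the pushout \<open>C\<close> of \<open>u\<close>
  along \<open>X \<rightarrow> I(X)\<close>; the last arrow is the one that vanishes on \<open>Y\<close> and restricts to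
  \<open>I(X) \<rightarrow> X[1]\<close>.
\<close>

definition standard_triangles :: "('o, 'a, 'm) frob_cat_scheme \<Rightarrow> ('a set \<times> 'a set \<times> 'a set) set" where
  "standard_triangles E =
     {(stable_class E u, stable_class E v, stable_class E w) | u v w.
        u \<in> Arr E \<and>
        (\<exists>q. is_pushout E (inc E (Dom E u)) u v q \<and>
             w \<in> Hom E (Cod E v) (susp E (Dom E u)) \<and>
             w \<cdot>\<^bsub>E\<^esub> v = Zero E (Cod E u) (susp E (Dom E u)) \<and>
             w \<cdot>\<^bsub>E\<^esub> q = prj E (Dom E u))}"

definition distinguished_triangles :: "('o, 'a, 'm) frob_cat_scheme \<Rightarrow> ('a set \<times> 'a set \<times> 'a set) set" where
  "distinguished_triangles E = (let T = stable_preadd_cat E in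
     {(f, g, h). \<exists>X Y Z X' Y' Z' f' g' h' a b c.
        f \<in> Hom T X Y \<and> g \<in> Hom T Y Z \<and> h \<in> Hom T Z (susp E X) \<and>
        (f', g', h') \<in> standard_triangles E \<and>
        f' \<in> Hom T X' Y' \<and> g' \<in> Hom T Y' Z' \<and> h' \<in> Hom T Z' (susp E X') \<and>
        a \<in> Hom T X X' \<and> b \<in> Hom T Y Y' \<and> c \<in> Hom T Z Z' \<and>
        is_iso T a \<and> is_iso T b \<and> is_iso T c \<and>
        b \<cdot>\<^bsub>T\<^esub> f = f' \<cdot>\<^bsub>T\<^esub> a \<and> c \<cdot>\<^bsub>T\<^esub> g = g' \<cdot>\<^bsub>T\<^esub> b \<and> susp_arr E a \<cdot>\<^bsub>T\<^esub> h = h' \<cdot>\<^bsub>T\<^esub> c})"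

text \<open>
  The data underlying a triangulated category. The stable category below satisfies the axioms of a
  triangulated category by Happel's theorem, so they are not needed as assumptions.
\<close>

record ('o, 'a) tri_cat = "('o, 'a) preadd_cat" +
  Shift :: "'o \<Rightarrow> 'o"
  ShiftA :: "'a \<Rightarrow> 'a"
  Triangles :: "('a \<times> 'a \<times> 'a) set"

definition stable_cat :: "('o, 'a, 'm) frob_cat_scheme \<Rightarrow> ('o, 'a set) tri_cat" where
  "stable_cat E = preadd_cat.extend (stable_preadd_cat E)
     (tri_cat.fields (susp E) (susp_arr E) (distinguished_triangles E))"


section \<open>Precovers, resolutions and dimension\<close>

definition precover :: "('o, 'a, 'm) cat_scheme \<Rightarrow> 'o set \<Rightarrow> 'o \<Rightarrow> 'a \<Rightarrow> bool" where
  "precover E R X f \<longleftrightarrow> f \<in> Arr E \<and> Dom E f \<in> R \<and> Cod E f = X \<and>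
     (\<forall>Y \<in> R. \<forall>g \<in> Hom E Y X. \<exists>h \<in> Hom E Y (Dom E f). f \<cdot>\<^bsub>E\<^esub> h = g)"

definition precovering :: "('o, 'a, 'm) cat_scheme \<Rightarrow> 'o set \<Rightarrow> bool" where
  "precovering E R \<longleftrightarrow> (\<forall>X \<in> Ob E. \<exists>f. precover E R X f)"

definition is_resolution ::
  "('o, 'a, 'm) preadd_cat_scheme \<Rightarrow> 'o set \<Rightarrow> 'o \<Rightarrow> (nat \<Rightarrow> 'o) \<Rightarrow> (nat \<Rightarrow> 'a) \<Rightarrow> (nat \<Rightarrow> 'a) \<Rightarrow> bool" where
  "is_resolution E R X K r k \<longleftrightarrow> K 0 = X \<and>
     (\<forall>n. precover E R (K n) (r n) \<and> is_kernel E (k n) (r n) \<and> Dom E (k n) = K (Suc n))"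

definition finite_dimension :: "('o, 'a, 'm) preadd_cat_scheme \<Rightarrow> 'o set \<Rightarrow> 'o \<Rightarrow> bool" where
  "finite_dimension E R X \<longleftrightarrow> (\<exists>K r k d. is_resolution E R X K r k \<and> K d \<in> R)"


section \<open>Localizing subcategories\<close>

text \<open>A full subcategory is given by its set of objects.\<close>

text \<open>
  Shifts are only determined up to isomorphism in \<open>T\<close> (the inverse shift is not chosen at all), so
  closure under both \<open>[1]\<close> and \<open>[-1]\<close> is understood up to isomorphism in \<open>T\<close>.
\<close>

definition shift_closed :: "('o, 'a, 'm) tri_cat_scheme \<Rightarrow> 'o set \<Rightarrow> bool" where
  "shift_closed T R \<longleftrightarrow>
     (\<forall>X \<in> R. (\<exists>Y \<in> R. isomorphic T Y (Shift T X)) \<and> (\<exists>Y \<in> R. isomorphic T (Shift T Y) X))"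

definition triangulated_subcategory :: "('o, 'a, 'm) tri_cat_scheme \<Rightarrow> 'o set \<Rightarrow> bool" where
  "triangulated_subcategory T D \<longleftrightarrow> D \<subseteq> Ob T \<and>
     (\<exists>Z \<in> D. is_zero_object T Z) \<and>
     (\<forall>X \<in> D. \<forall>Y \<in> Ob T. isomorphic T X Y \<longrightarrow> Y \<in> D) \<and>
     (\<forall>X \<in> Ob T. X \<in> D \<longleftrightarrow> Shift T X \<in> D) \<and>
     (\<forall>(f, g, h) \<in> Triangles T.
        (Dom T f \<in> D \<and> Dom T g \<in> D \<longrightarrow> Dom T h \<in> D) \<and>
        (Dom T g \<in> D \<and> Dom T h \<in> D \<longrightarrow> Dom T f \<in> D) \<and>
        (Dom T f \<in> D \<and> Dom T h \<in> D \<longrightarrow> Dom T g \<in> D))"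

text \<open>
  Closure under every coproduct that exists in \<open>T\<close> and is indexed by a set of elements of \<open>'i\<close>.
  The type \<open>'i\<close> plays the role of the universe of index sets.
\<close>

definition localizing_subcategory ::
  "'i itself \<Rightarrow> ('o, 'a, 'm) tri_cat_scheme \<Rightarrow> 'o set \<Rightarrow> bool" where
  "localizing_subcategory _ T D \<longleftrightarrow> triangulated_subcategory T D \<and>
     (\<forall>(I :: 'i set) X Z u. (\<forall>i \<in> I. X i \<in> D) \<longrightarrow> is_coproduct T I X Z u \<longrightarrow> Z \<in> D)"

definition localizing_closure ::
  "'i itself \<Rightarrow> ('o, 'a, 'm) tri_cat_scheme \<Rightarrow> 'o set \<Rightarrow> 'o set" where
  "localizing_closure \<iota> T R = \<Inter> {D. localizing_subcategory \<iota> T D \<and> R \<subseteq> D}"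


section \<open>Verdier quotients\<close>

definition cone_in :: "('o, 'a, 'm) tri_cat_scheme \<Rightarrow> 'o set \<Rightarrow> 'a set" where
  "cone_in T D = {f. \<exists>g h. (f, g, h) \<in> Triangles T \<and> Cod T g \<in> D}"

text \<open>A roof \<open>(s, f)\<close> is a diagram \<open>X \<leftarrow> Z \<rightarrow> Y\<close> with left leg \<open>s\<close> having its cone in \<open>D\<close>.\<close>

definition roofs :: "('o, 'a, 'm) tri_cat_scheme \<Rightarrow> 'o set \<Rightarrow> ('a \<times> 'a) set" where
  "roofs T D = {(s, f). s \<in> cone_in T D \<and> f \<in> Arr T \<and> Dom T s = Dom T f}"

definition roof_eq :: "('o, 'a, 'm) tri_cat_scheme \<Rightarrow> 'o set \<Rightarrow> 'a \<times> 'a \<Rightarrow> 'a \<times> 'a \<Rightarrow> bool" where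
  "roof_eq T D = (\<lambda>(s, f) (s', f'). (s, f) \<in> roofs T D \<and> (s', f') \<in> roofs T D \<and>
     Cod T s = Cod T s' \<and> Cod T f = Cod T f' \<and>
     (\<exists>W. \<exists>u \<in> Hom T W (Dom T s). \<exists>u' \<in> Hom T W (Dom T s').
        s \<cdot>\<^bsub>T\<^esub> u = s' \<cdot>\<^bsub>T\<^esub> u' \<and> s \<cdot>\<^bsub>T\<^esub> u \<in> cone_in T D \<and> f \<cdot>\<^bsub>T\<^esub> u = f' \<cdot>\<^bsub>T\<^esub> u'))"

definition roof_class :: "('o, 'a, 'm) tri_cat_scheme \<Rightarrow> 'o set \<Rightarrow> 'a \<times> 'a \<Rightarrow> ('a \<times> 'a) set" where
  "roof_class T D r = {r'. roof_eq T D r r'}"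

text \<open>
  The classes of \<open>(s, f)\<close> and \<open>(t, g)\<close> are composed by completing \<open>f\<close> and \<open>t\<close> to a commutative
  square \<open>f \<cdot> s' = t \<cdot> f'\<close> with \<open>s'\<close> again having its cone in \<open>D\<close>.
\<close>

definition fractions :: "('o, 'a, 'm) tri_cat_scheme \<Rightarrow> 'o set \<Rightarrow> ('o, ('a \<times> 'a) set) cat" where
  "fractions T D =
     \<lparr>Ob = Ob T,
      Arr = roof_class T D ` roofs T D,
      Dom = (\<lambda>A. Cod T (fst (SOME r. r \<in> A))),
      Cod = (\<lambda>A. Cod T (snd (SOME r. r \<in> A))),
      Ident = (\<lambda>X. roof_class T D (Ident T X, Ident T X)),
      Comp = (\<lambda>B A. {r. \<exists>(s, f) \<in> A. \<exists>(t, g) \<in> B. \<exists>s' f'.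
         s' \<in> cone_in T D \<and> f' \<in> Arr T \<and> Dom T s' = Dom T f' \<and>
         Cod T s' = Dom T f \<and> Cod T f' = Dom T t \<and> f \<cdot>\<^bsub>T\<^esub> s' = t \<cdot>\<^bsub>T\<^esub> f' \<and>
         roof_eq T D (s \<cdot>\<^bsub>T\<^esub> s', g \<cdot>\<^bsub>T\<^esub> f') r})\<rparr>"

text \<open>
  A functor \<open>T \<rightarrow> Q\<close> is a Verdier quotient by \<open>D\<close> if it is the canonical functor into the category
  of fractions, up to an isomorphism of the target. Such a \<open>Q\<close> with arrows in a given type
  exists only if that type is large enough to hold the classes of roofs.
\<close>

definition verdier_quotient ::
  "('o, 'a, 'm) tri_cat_scheme \<Rightarrow> 'o set \<Rightarrow> ('p, 'b, 'n) cat_scheme \<Rightarrow>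
   ('o \<Rightarrow> 'p) \<Rightarrow> ('a \<Rightarrow> 'b) \<Rightarrow> bool" where
  "verdier_quotient T D Q jO jA \<longleftrightarrow> is_functor T Q jO jA \<and>
     (\<exists>GO GA. is_category_isomorphism (fractions T D) Q GO GA \<and>
        (\<forall>X \<in> Ob T. jO X = GO X) \<and>
        (\<forall>f \<in> Arr T. jA f = GA (roof_class T D (Ident T (Dom T f), f))))"

end

theory Submission
  imports Defs
begin

text \<open>
  A quotient functor \<open>j : T \<rightarrow> T/S\<close> has a right adjoint as soon as every object \<open>X\<close> admits an arrow
  \<open>X \<rightarrow> Y\<close> whose cone lies in \<open>S\<close> and whose target \<open>Y\<close> is right orthogonal to \<open>S\<close>: such a \<open>Y\<close> is a
  local object, the arrows into it are the same in \<open>T\<close> and in \<open>T/S\<close>, and \<open>j X \<mapsto> Y\<close> is the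
  adjoint (\<open>verdier_quotient_right_adjoint\<close>). It remains to construct a triangle
  \<open>s \<rightarrow> X \<rightarrow> Y \<rightarrow> s[1]\<close> with \<open>s\<close> in \<open>S\<close> and \<open>Y\<close> orthogonal to the class \<open>\<R>\<close> of the theorem;
  orthogonality then extends from \<open>\<R>\<close> to the localizing subcategory it generates.

  The construction climbs a finite \<open>\<R>\<close>-resolution. Its sequences \<open>K \<rightarrow> R \<rightarrow> X\<close>, a precover with its
  kernel, need not be conflations, hence need not give triangles. They do give short exact sequences
  \<open>0 \<rightarrow> Hom(A, K) \<rightarrow> Hom(A, R) \<rightarrow> Hom(A, X) \<rightarrow> 0\<close> of stable hom groups for all \<open>A\<close> in \<open>\<R>\<close>. Exactness on the
  right is the precover property, exactness in the middle follows since \<open>I(A)\<close> is in \<open>\<R>\<close>, and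
  exactness on the left follows since arrows from \<open>A[1]\<close> also lift along precovers
  (\<open>precover_lift_susp\<close>, \<open>kernel_of_precover_mono_T\<close>).

  If \<open>s \<rightarrow> K\<close> is an arrow from an object of \<open>S\<close> that induces isomorphisms on \<open>Hom(A, -)\<close> for all \<open>A\<close>
  in \<open>\<R>\<close>, then the cone of the composite \<open>s \<rightarrow> K \<rightarrow> R\<close> is again in \<open>S\<close>, and the short exact sequences
  identify its hom groups with those of \<open>X\<close> (\<open>resolution_step\<close>). So an approximation of the kernel
  yields one of \<open>X\<close>, and the induction starts where the resolution reaches an object of \<open>\<R>\<close>.
  The cone of an approximation \<open>s \<rightarrow> X\<close> is the required \<open>Y\<close>.
\<close>

section \<open>Composition, isomorphisms and universal arrows\<close>

text \<open>
  The rules below are stated through domains and codomains, not through membership in hom sets, so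
  that the simplifier can decide by itself whether a composition is defined.
\<close>

locale cat =
  fixes C :: "('o, 'a, 'm) cat_scheme" (structure)
  assumes is_category: "category C"
begin

lemma dom_cod [simp]:
  assumes "f \<in> Arr C" shows "Dom C f \<in> Ob C" "Cod C f \<in> Ob C"
  using is_category assms by (auto simp: category_def)

lemma ident [simp]:
  assumes "X \<in> Ob C"
  shows "Ident C X \<in> Arr C" "Dom C (Ident C X) = X" "Cod C (Ident C X) = X"
  using is_category assms by (auto simp: category_def Hom_def)

lemma comp [simp]:
  assumes "f \<in> Arr C" "g \<in> Arr C" "Dom C g = Cod C f"
  shows "g \<cdot> f \<in> Arr C" "Dom C (g \<cdot> f) = Dom C f" "Cod C (g \<cdot> f) = Cod C g"
  using is_category assms by (auto simp: category_def Hom_def)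

lemma comp_ident [simp]:
  assumes "f \<in> Arr C"
  shows "Dom C f = X \<Longrightarrow> f \<cdot> Ident C X = f" "Cod C f = X \<Longrightarrow> Ident C X \<cdot> f = f"
  using is_category assms by (auto simp: category_def Hom_def)

lemma assoc [simp]:
  assumes "f \<in> Arr C" "g \<in> Arr C" "h \<in> Arr C" "Dom C g = Cod C f" "Dom C h = Cod C g"
  shows "(h \<cdot> g) \<cdot> f = h \<cdot> (g \<cdot> f)"
  using is_category assms by (auto simp: category_def Hom_def)

lemma iso_inverse:
  assumes "is_iso C f"
  obtains g where "g \<in> Arr C" "Dom C g = Cod C f" "Cod C g = Dom C f"
    "g \<cdot> f = Ident C (Dom C f)" "f \<cdot> g = Ident C (Cod C f)"
  using assms by (auto simp: is_iso_def Hom_def)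

lemma is_isoI:
  assumes "f \<in> Hom C X Y" "g \<in> Hom C Y X" "g \<cdot> f = Ident C X" "f \<cdot> g = Ident C Y"
  shows "is_iso C f"
  using assms by (auto simp: is_iso_def Hom_def)

lemma is_iso_ident: "X \<in> Ob C \<Longrightarrow> is_iso C (Ident C X)"
  by (rule is_isoI[where g = "Ident C X"]) (auto simp: Hom_def)

lemma isomorphic_refl: "X \<in> Ob C \<Longrightarrow> isomorphic C X X"
  unfolding isomorphic_def using is_iso_ident[of X]
  by (intro bexI[of _ "Ident C X"]) (simp_all add: Hom_def)

lemma isomorphic_sym: "isomorphic C X Y \<Longrightarrow> isomorphic C Y X"
  unfolding isomorphic_def is_iso_def by (auto simp: Hom_def)

end

text \<open>
  The universal arrow \<open>\<epsilon> Y : F (G Y) \<rightarrow> Y\<close> forces \<open>G\<close> on arrows: \<open>G h\<close> is the unique arrow with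
  \<open>\<epsilon> \<circ> F (G h) = h \<circ> \<epsilon>\<close>. Functoriality and naturality are then instances of uniqueness.
\<close>

lemma right_adjoint_if_universal_arrows:
  assumes F: "is_functor C D FO FA"
    and arrow: "\<And>Y. Y \<in> Ob D \<Longrightarrow> GO Y \<in> Ob C \<and> \<epsilon> Y \<in> Hom D (FO (GO Y)) Y"
    and universal: "\<And>X Y f. X \<in> Ob C \<Longrightarrow> Y \<in> Ob D \<Longrightarrow> f \<in> Hom D (FO X) Y \<Longrightarrow>
      \<exists>!g. g \<in> Hom C X (GO Y) \<and> \<epsilon> Y \<cdot>\<^bsub>D\<^esub> FA g = f"
  shows "has_right_adjoint C D FO FA"
proof -
  interpret C: cat C using F by unfold_locales (simp add: is_functor_def)
  interpret D: cat D using F by unfold_locales (simp add: is_functor_def)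
  have FO: "FO X \<in> Ob D" "FA (Ident C X) = Ident D (FO X)" if "X \<in> Ob C" for X
    using F that by (auto simp: is_functor_def)
  have FA: "FA f \<in> Arr D" "Dom D (FA f) = FO (Dom C f)" "Cod D (FA f) = FO (Cod C f)"
    if "f \<in> Arr C" for f
    using F that by (auto simp: is_functor_def Hom_def)
  have FA_comp: "FA (g \<cdot>\<^bsub>C\<^esub> f) = FA g \<cdot>\<^bsub>D\<^esub> FA f"
    if "f \<in> Arr C" "g \<in> Arr C" "Dom C g = Cod C f" for f g
    using F that by (auto simp: is_functor_def Hom_def)
  have eps: "GO Y \<in> Ob C" "\<epsilon> Y \<in> Arr D" "Dom D (\<epsilon> Y) = FO (GO Y)" "Cod D (\<epsilon> Y) = Y"
    if "Y \<in> Ob D" for Y using arrow[OF that] by (auto simp: Hom_def)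
  define \<phi> where "\<phi> X Y f = (THE g. g \<in> Hom C X (GO Y) \<and> \<epsilon> Y \<cdot>\<^bsub>D\<^esub> FA g = f)" for X Y f
  define GA where "GA h = \<phi> (GO (Dom D h)) (Cod D h) (h \<cdot>\<^bsub>D\<^esub> \<epsilon> (Dom D h))" for h
  have \<phi>: "\<phi> X Y f \<in> Arr C" "Dom C (\<phi> X Y f) = X" "Cod C (\<phi> X Y f) = GO Y"
      "\<epsilon> Y \<cdot>\<^bsub>D\<^esub> FA (\<phi> X Y f) = f"
    if "X \<in> Ob C" "f \<in> Arr D" "Dom D f = FO X" "Cod D f = Y" for X Y f
  proof -
    have "f \<in> Hom D (FO X) Y" "Y \<in> Ob D" using that by (auto simp: Hom_def)
    from theI'[OF universal[OF that(1) this(2,1)]]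
    show "\<phi> X Y f \<in> Arr C" "Dom C (\<phi> X Y f) = X" "Cod C (\<phi> X Y f) = GO Y"
      "\<epsilon> Y \<cdot>\<^bsub>D\<^esub> FA (\<phi> X Y f) = f" by (simp_all add: \<phi>_def Hom_def)
  qed
  have eqI: "g = g'"
    if "Y \<in> Ob D" "g \<in> Arr C" "g' \<in> Arr C" "Dom C g = Dom C g'" "Cod C g = GO Y" "Cod C g' = GO Y"
      "\<epsilon> Y \<cdot>\<^bsub>D\<^esub> FA g = \<epsilon> Y \<cdot>\<^bsub>D\<^esub> FA g'" for Y g g'
  proof -
    have "\<epsilon> Y \<cdot>\<^bsub>D\<^esub> FA g \<in> Hom D (FO (Dom C g)) Y" using that by (simp add: Hom_def FA eps)
    from universal[OF _ that(1) this] that show ?thesis by (auto simp: Hom_def)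
  qed
  have GA: "GA h \<in> Arr C" "Dom C (GA h) = GO (Dom D h)" "Cod C (GA h) = GO (Cod D h)"
    "\<epsilon> (Cod D h) \<cdot>\<^bsub>D\<^esub> FA (GA h) = h \<cdot>\<^bsub>D\<^esub> \<epsilon> (Dom D h)" if "h \<in> Arr D" for h
    unfolding GA_def using that by (simp_all add: \<phi> eps)
  have "is_functor D C GO GA"
    unfolding is_functor_def
  proof (intro conjI ballI allI)
    fix Y assume Y: "Y \<in> Ob D"
    show "GA (Ident D Y) = Ident C (GO Y)"
      using Y GA[of "Ident D Y"] by (intro eqI[of Y]) (simp_all add: eps FO)
  next
    fix X Y Z f g assume "f \<in> Hom D X Y" "g \<in> Hom D Y Z"
    then have fg: "f \<in> Arr D" "Dom D f = X" "Cod D f = Y" "g \<in> Arr D" "Dom D g = Y" "Cod D g = Z"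
      "X \<in> Ob D" "Y \<in> Ob D" "Z \<in> Ob D" by (auto simp: Hom_def)
    have "\<epsilon> Z \<cdot>\<^bsub>D\<^esub> FA (GA (g \<cdot>\<^bsub>D\<^esub> f)) = g \<cdot>\<^bsub>D\<^esub> (f \<cdot>\<^bsub>D\<^esub> \<epsilon> X)"
      using GA[of "g \<cdot>\<^bsub>D\<^esub> f"] fg by (simp add: eps)
    also have "\<dots> = (g \<cdot>\<^bsub>D\<^esub> \<epsilon> Y) \<cdot>\<^bsub>D\<^esub> FA (GA f)" using GA[of f] fg by (simp add: eps FA)
    also have "\<dots> = (\<epsilon> Z \<cdot>\<^bsub>D\<^esub> FA (GA g)) \<cdot>\<^bsub>D\<^esub> FA (GA f)" using GA(4)[of g] fg by simp
    also have "\<dots> = \<epsilon> Z \<cdot>\<^bsub>D\<^esub> FA (GA g \<cdot>\<^bsub>C\<^esub> GA f)" using GA(1-3)[of f] GA(1-3)[of g] fg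
      by (simp add: eps FA FA_comp)
    finally show "GA (g \<cdot>\<^bsub>D\<^esub> f) = GA g \<cdot>\<^bsub>C\<^esub> GA f"
      using fg by (intro eqI[of Z]) (simp_all add: GA)
  qed (auto simp: C.is_category D.is_category eps Hom_def GA)
  moreover have "bij_betw (\<phi> X Y) (Hom D (FO X) Y) (Hom C X (GO Y))"
    if "X \<in> Ob C" "Y \<in> Ob D" for X Y
  proof (rule bij_betw_byWitness[where f' = "\<lambda>g. \<epsilon> Y \<cdot>\<^bsub>D\<^esub> FA g"])
    show "\<forall>g\<in>Hom C X (GO Y). \<phi> X Y (\<epsilon> Y \<cdot>\<^bsub>D\<^esub> FA g) = g"
      using that by (auto intro!: eqI[of Y] simp: Hom_def \<phi> eps FA)
  qed (use that in \<open>auto simp: Hom_def \<phi> eps FA\<close>)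
  moreover have "\<phi> X' Y' (g \<cdot>\<^bsub>D\<^esub> (h \<cdot>\<^bsub>D\<^esub> FA f)) = GA g \<cdot>\<^bsub>C\<^esub> (\<phi> X Y h \<cdot>\<^bsub>C\<^esub> f)"
    if "f \<in> Hom C X' X" "h \<in> Hom D (FO X) Y" "g \<in> Hom D Y Y'" for X' X Y Y' f g h
  proof -
    have a: "f \<in> Arr C" "Dom C f = X'" "Cod C f = X" "h \<in> Arr D" "Dom D h = FO X" "Cod D h = Y"
      "g \<in> Arr D" "Dom D g = Y" "Cod D g = Y'" "X' \<in> Ob C" "X \<in> Ob C" "Y \<in> Ob D" "Y' \<in> Ob D"
      using that by (auto simp: Hom_def)
    have "\<epsilon> Y' \<cdot>\<^bsub>D\<^esub> FA (GA g \<cdot>\<^bsub>C\<^esub> (\<phi> X Y h \<cdot>\<^bsub>C\<^esub> f))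
      = (\<epsilon> Y' \<cdot>\<^bsub>D\<^esub> FA (GA g)) \<cdot>\<^bsub>D\<^esub> (FA (\<phi> X Y h) \<cdot>\<^bsub>D\<^esub> FA f)"
      using a GA(1-3)[of g] by (simp add: \<phi>(1-3) eps FA FA_comp)
    also have "\<dots> = (g \<cdot>\<^bsub>D\<^esub> \<epsilon> Y) \<cdot>\<^bsub>D\<^esub> (FA (\<phi> X Y h) \<cdot>\<^bsub>D\<^esub> FA f)" using GA(4)[of g] a by simp
    also have "\<dots> = g \<cdot>\<^bsub>D\<^esub> ((\<epsilon> Y \<cdot>\<^bsub>D\<^esub> FA (\<phi> X Y h)) \<cdot>\<^bsub>D\<^esub> FA f)"
      using a by (simp add: \<phi>(1-3) eps FA)
    also have "\<dots> = g \<cdot>\<^bsub>D\<^esub> (h \<cdot>\<^bsub>D\<^esub> FA f)" using a by (simp add: \<phi>(4))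
    finally show ?thesis using a by (intro eqI[of Y']) (simp_all add: \<phi> GA FA)
  qed
  ultimately have "right_adjoint C D FO FA GO GA"
    unfolding right_adjoint_def using F by blast
  then show ?thesis by (auto simp: has_right_adjoint_def)
qed

section \<open>Verdier quotients with enough local objects\<close>

text \<open>
  Local objects see the arrows with cone in \<open>D\<close> as isomorphisms. When \<open>D\<close> is a triangulated
  subcategory they are the objects right orthogonal to \<open>D\<close>; this form needs nothing but
  composition.
\<close>

definition local_object :: "('o, 'a, 'm) tri_cat_scheme \<Rightarrow> 'o set \<Rightarrow> 'o \<Rightarrow> bool" where
  "local_object T D Y \<longleftrightarrow>
     (\<forall>s \<in> cone_in T D. \<forall>f \<in> Hom T (Dom T s) Y. \<exists>!g. g \<in> Hom T (Cod T s) Y \<and> g \<cdot>\<^bsub>T\<^esub> s = f)"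

text \<open>
  A Verdier quotient comes with a category of fractions, and that the latter is a category already
  contains all of the calculus of fractions needed here: composites are defined, and the
  equivalence of roofs is transitive.
\<close>

locale fraction_category = T: cat T + Fr: cat "fractions T D"
  for T :: "('o, 'a, 'm) tri_cat_scheme" and D :: "'o set" +
  assumes cone_in_arr: "cone_in T D \<subseteq> Arr T"
begin

abbreviation "Fr \<equiv> fractions T D"
abbreviation "cls \<equiv> roof_class T D"

lemma roof_eqI:
  assumes "(s, f) \<in> roofs T D" "(s', f') \<in> roofs T D" "Cod T s = Cod T s'" "Cod T f = Cod T f'"
    and "u \<in> Arr T" "u' \<in> Arr T" "Dom T u = Dom T u'" "Cod T u = Dom T s" "Cod T u' = Dom T s'"
    and "s \<cdot>\<^bsub>T\<^esub> u = s' \<cdot>\<^bsub>T\<^esub> u'" "s \<cdot>\<^bsub>T\<^esub> u \<in> cone_in T D" "f \<cdot>\<^bsub>T\<^esub> u = f' \<cdot>\<^bsub>T\<^esub> u'"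
  shows "roof_eq T D (s, f) (s', f')"
  unfolding roof_eq_def case_prod_conv Hom_def
  using assms by (intro conjI exI[of _ "Dom T u'"] bexI[of _ u] bexI[of _ u']) simp_all

lemma roof_eq_refl: assumes "r \<in> roofs T D" shows "roof_eq T D r r"
proof -
  obtain s f where r: "r = (s, f)" by (cases r)
  have "s \<in> cone_in T D" "s \<in> Arr T" "f \<in> Arr T" "Dom T s = Dom T f"
    using assms r cone_in_arr by (auto simp: roofs_def)
  then show ?thesis using assms unfolding r
    by (intro roof_eqI[where u = "Ident T (Dom T s)" and u' = "Ident T (Dom T s)"]) simp_all
qed

lemma roof_eq_sym: "roof_eq T D r r' \<Longrightarrow> roof_eq T D r' r"
  by (cases r; cases r') (force simp: roof_eq_def)

lemma roof_eq_roofs: "roof_eq T D r r' \<Longrightarrow> r \<in> roofs T D \<and> r' \<in> roofs T D"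
  by (auto simp: roof_eq_def)

lemma Dom_cls: "(s, f) \<in> roofs T D \<Longrightarrow> Dom Fr (cls (s, f)) = Cod T s"
  and Cod_cls: "(s, f) \<in> roofs T D \<Longrightarrow> Cod Fr (cls (s, f)) = Cod T f"
proof -
  assume r: "(s, f) \<in> roofs T D"
  then have "(s, f) \<in> cls (s, f)" using roof_eq_refl by (simp add: roof_class_def)
  then have "(SOME r. r \<in> cls (s, f)) \<in> cls (s, f)" by (rule someI)
  then have "roof_eq T D (s, f) (SOME r. r \<in> cls (s, f))" by (simp add: roof_class_def)
  then show "Dom Fr (cls (s, f)) = Cod T s" "Cod Fr (cls (s, f)) = Cod T f"
    by (auto simp: fractions_def roof_eq_def split: prod.splits)
qed

lemma Arr_Fr: "Arr Fr = cls ` roofs T D" and Ob_Fr: "Ob Fr = Ob T"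
  and Ident_Fr: "Ident Fr X = cls (Ident T X, Ident T X)"
  by (auto simp: fractions_def)

lemma ident_cone_in: assumes "X \<in> Ob T" shows "Ident T X \<in> cone_in T D"
proof -
  have "Ident Fr X \<in> Arr Fr" using assms by (simp add: Ob_Fr)
  then obtain r where "r \<in> roofs T D" "Ident Fr X = cls r" by (auto simp: Arr_Fr)
  then have "roof_eq T D (Ident T X, Ident T X) r"
    using roof_eq_refl[of r] unfolding Ident_Fr by (auto simp: roof_class_def)
  then have "(Ident T X, Ident T X) \<in> roofs T D" using roof_eq_roofs by blast
  then show ?thesis by (simp add: roofs_def)
qed

lemma mem_comp:
  assumes "(s, f) \<in> A" "(t, g) \<in> B" "s' \<in> cone_in T D" "f' \<in> Arr T" "Dom T s' = Dom T f'"
    "Cod T s' = Dom T f" "Cod T f' = Dom T t" "f \<cdot>\<^bsub>T\<^esub> s' = t \<cdot>\<^bsub>T\<^esub> f'"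
    "roof_eq T D (s \<cdot>\<^bsub>T\<^esub> s', g \<cdot>\<^bsub>T\<^esub> f') r"
  shows "r \<in> B \<cdot>\<^bsub>Fr\<^esub> A"
proof -
  have "\<exists>s' f'. s' \<in> cone_in T D \<and> f' \<in> Arr T \<and> Dom T s' = Dom T f' \<and>
         Cod T s' = Dom T f \<and> Cod T f' = Dom T t \<and> f \<cdot>\<^bsub>T\<^esub> s' = t \<cdot>\<^bsub>T\<^esub> f' \<and>
         roof_eq T D (s \<cdot>\<^bsub>T\<^esub> s', g \<cdot>\<^bsub>T\<^esub> f') r" using assms(3-) by blast
  then show ?thesis using assms(1,2) unfolding fractions_def by fastforce
qed

text \<open>
  The identity law \<open>1 \<circ> [r] = [r]\<close> of the fraction category is read as a statement about
  representatives: composing a roof \<open>r'\<close> in \<open>[r]\<close> with the identity roof yields every \<open>r''\<close>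
  equivalent to \<open>r'\<close>, so that \<open>r''\<close> lies in \<open>[r]\<close>.
\<close>

lemma roof_eq_trans:
  assumes "roof_eq T D r r'" "roof_eq T D r' r''" shows "roof_eq T D r r''"
proof -
  obtain s f where r': "r' = (s, f)" by (cases r')
  have roofs: "r \<in> roofs T D" "(s, f) \<in> roofs T D" using assms roof_eq_roofs r' by blast+
  have sf: "s \<in> Arr T" "f \<in> Arr T" "Dom T s = Dom T f"
    using roofs cone_in_arr by (auto simp: roofs_def)
  have "Cod T f = Cod T (snd r)" using assms(1) r' by (auto simp: roof_eq_def)
  then have cod: "Cod Fr (cls r) = Cod T f" using Cod_cls[of "fst r" "snd r"] roofs by simp
  have "Ident Fr (Cod T f) \<cdot>\<^bsub>Fr\<^esub> cls r = cls r"
    using cod roofs by (intro Fr.comp_ident) (auto simp: Arr_Fr)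
  moreover have "r'' \<in> Ident Fr (Cod T f) \<cdot>\<^bsub>Fr\<^esub> cls r"
  proof (rule mem_comp)
    show "(s, f) \<in> cls r" using assms(1) r' by (simp add: roof_class_def)
    show "(Ident T (Cod T f), Ident T (Cod T f)) \<in> Ident Fr (Cod T f)"
      unfolding Ident_Fr roof_class_def using sf
      by (auto intro!: roof_eq_refl simp: roofs_def ident_cone_in)
    show "Ident T (Dom T f) \<in> cone_in T D" using sf by (simp add: ident_cone_in)
    show "roof_eq T D (s \<cdot>\<^bsub>T\<^esub> Ident T (Dom T f), Ident T (Cod T f) \<cdot>\<^bsub>T\<^esub> f) r''"
      using assms(2) r' sf by simp
  qed (use sf in simp_all)
  ultimately show ?thesis by (simp add: roof_class_def)
qed

lemma cls_eqI: "roof_eq T D r r' \<Longrightarrow> cls r = cls r'"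
  unfolding roof_class_def using roof_eq_trans roof_eq_sym by blast

lemma cls_eqD: "r' \<in> roofs T D \<Longrightarrow> cls r = cls r' \<Longrightarrow> roof_eq T D r r'"
  unfolding roof_class_def using roof_eq_refl by blast

text \<open>
  A composite of classes is again a class, since it is an arrow of the fraction category; hence any
  one completion of the two roofs to a square determines it.
\<close>

lemma comp_cls:
  assumes sf: "(s, f) \<in> roofs T D" and tg: "(t, g) \<in> roofs T D" and "Cod T f = Cod T t"
    and s': "s' \<in> cone_in T D" "f' \<in> Arr T" "Dom T s' = Dom T f'" "Cod T s' = Dom T f"
      "Cod T f' = Dom T t" "f \<cdot>\<^bsub>T\<^esub> s' = t \<cdot>\<^bsub>T\<^esub> f'"
    and "s \<cdot>\<^bsub>T\<^esub> s' \<in> cone_in T D"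
  shows "cls (t, g) \<cdot>\<^bsub>Fr\<^esub> cls (s, f) = cls (s \<cdot>\<^bsub>T\<^esub> s', g \<cdot>\<^bsub>T\<^esub> f')"
proof -
  have a: "s \<in> Arr T" "f \<in> Arr T" "Dom T s = Dom T f" "t \<in> Arr T" "g \<in> Arr T" "Dom T t = Dom T g"
      "s' \<in> Arr T"
    using sf tg s'(1) cone_in_arr by (auto simp: roofs_def)
  have "cls (t, g) \<cdot>\<^bsub>Fr\<^esub> cls (s, f) \<in> Arr Fr"
    using sf tg assms(3) by (intro Fr.comp) (auto simp: Dom_cls Cod_cls Arr_Fr)
  then obtain c where c: "cls (t, g) \<cdot>\<^bsub>Fr\<^esub> cls (s, f) = cls c" by (auto simp: Arr_Fr)
  have "(s \<cdot>\<^bsub>T\<^esub> s', g \<cdot>\<^bsub>T\<^esub> f') \<in> roofs T D" using assms a by (auto simp: roofs_def)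
  then have "(s \<cdot>\<^bsub>T\<^esub> s', g \<cdot>\<^bsub>T\<^esub> f') \<in> cls (t, g) \<cdot>\<^bsub>Fr\<^esub> cls (s, f)"
    using sf tg s' by (intro mem_comp[of s f _ t g _ s' f']) (auto simp: roof_class_def roof_eq_refl)
  then have "roof_eq T D c (s \<cdot>\<^bsub>T\<^esub> s', g \<cdot>\<^bsub>T\<^esub> f')" unfolding c by (simp add: roof_class_def)
  then show ?thesis unfolding c by (rule cls_eqI)
qed

definition frac :: "'a \<Rightarrow> ('a \<times> 'a) set" where
  "frac f = cls (Ident T (Dom T f), f)"

lemma roof_frac: "f \<in> Arr T \<Longrightarrow> (Ident T (Dom T f), f) \<in> roofs T D"
  by (auto simp: roofs_def ident_cone_in)

lemma frac [simp]:
  assumes "f \<in> Arr T"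
  shows "frac f \<in> Arr Fr" "Dom Fr (frac f) = Dom T f" "Cod Fr (frac f) = Cod T f"
  using assms roof_frac unfolding frac_def by (simp_all add: Dom_cls Cod_cls Arr_Fr)

lemma frac_inverse:
  assumes s: "s \<in> cone_in T D"
  defines "t \<equiv> cls (s, Ident T (Dom T s))"
  shows "t \<in> Arr Fr" "Dom Fr t = Cod T s" "Cod Fr t = Dom T s"
    "t \<cdot>\<^bsub>Fr\<^esub> frac s = Ident Fr (Dom T s)" "frac s \<cdot>\<^bsub>Fr\<^esub> t = Ident Fr (Cod T s)"
proof -
  have a: "s \<in> Arr T" using s cone_in_arr by blast
  have r: "(s, Ident T (Dom T s)) \<in> roofs T D" using s a by (auto simp: roofs_def)
  then show "t \<in> Arr Fr" "Dom Fr t = Cod T s" "Cod Fr t = Dom T s"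
    using a unfolding t_def by (simp_all add: Dom_cls Cod_cls Arr_Fr)
  show "t \<cdot>\<^bsub>Fr\<^esub> frac s = Ident Fr (Dom T s)"
    using a r roof_frac[OF a] unfolding frac_def t_def Ident_Fr
    by (subst comp_cls[where s' = "Ident T (Dom T s)" and f' = "Ident T (Dom T s)"])
      (auto simp: ident_cone_in)
  have "frac s \<cdot>\<^bsub>Fr\<^esub> t = cls (s, s)"
    using a r roof_frac[OF a] s unfolding frac_def t_def
    by (subst comp_cls[where s' = "Ident T (Dom T s)" and f' = "Ident T (Dom T s)"])
      (auto simp: ident_cone_in)
  also have "\<dots> = cls (Ident T (Cod T s), Ident T (Cod T s))"
  proof (rule cls_eqI)
    show "roof_eq T D (s, s) (Ident T (Cod T s), Ident T (Cod T s))"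
      using s a by (intro roof_eqI[where u = "Ident T (Dom T s)" and u' = s])
        (simp_all add: roofs_def ident_cone_in)
  qed
  finally show "frac s \<cdot>\<^bsub>Fr\<^esub> t = Ident Fr (Cod T s)" by (simp add: Ident_Fr)
qed

text \<open>
  A roof \<open>X \<leftarrow> Z \<rightarrow> Y\<close> into a local object is an honest arrow: locality factors the right leg
  uniquely through the left one. Two arrows with the same fraction agree after composition with
  an arrow whose cone is in \<open>D\<close>, and locality cancels the latter.
\<close>

lemma frac_bij_local:
  assumes Y: "local_object T D Y" and h: "h \<in> Hom Fr Z Y"
  shows "\<exists>!g. g \<in> Hom T Z Y \<and> frac g = h"
proof (rule ex_ex1I)
  obtain s f where r: "(s, f) \<in> roofs T D" and h_eq: "h = cls (s, f)"
    using h by (auto simp: Hom_def Arr_Fr)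
  have a: "s \<in> cone_in T D" "s \<in> Arr T" "f \<in> Arr T" "Dom T s = Dom T f" "Cod T s = Z" "Cod T f = Y"
    using h r cone_in_arr by (auto simp: h_eq Hom_def Dom_cls Cod_cls roofs_def)
  then have "f \<in> Hom T (Dom T s) Y" by (simp add: Hom_def)
  then have "\<exists>!g. g \<in> Hom T (Cod T s) Y \<and> g \<cdot>\<^bsub>T\<^esub> s = f"
    using Y a(1) by (simp add: local_object_def)
  then obtain g where g: "g \<in> Hom T (Cod T s) Y" "g \<cdot>\<^bsub>T\<^esub> s = f" by (elim ex1E conjE)
  have ga: "g \<in> Arr T" "Dom T g = Z" "Cod T g = Y" "Z \<in> Ob T" "g \<cdot>\<^bsub>T\<^esub> s = f"
    using g a(2,5) by (auto simp only: Hom_def mem_Collect_eq T.dom_cod)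
  have "roof_eq T D (Ident T Z, g) (s, f)"
    using a ga by (intro roof_eqI[where u = s and u' = "Ident T (Dom T s)"])
      (simp_all add: roofs_def ident_cone_in)
  then have "frac g = h" using ga h_eq by (simp add: frac_def cls_eqI)
  then show "\<exists>g. g \<in> Hom T Z Y \<and> frac g = h" using g(1) a(5) by auto
next
  fix g g' assume *: "g \<in> Hom T Z Y \<and> frac g = h" "g' \<in> Hom T Z Y \<and> frac g' = h"
  then have a: "g \<in> Arr T" "g' \<in> Arr T" "Dom T g = Z" "Dom T g' = Z" "Cod T g = Y" "Cod T g' = Y"
    "Z \<in> Ob T" by (auto simp: Hom_def)
  have "roof_eq T D (Ident T Z, g) (Ident T Z, g')"
    using * a roof_frac[of g'] by (auto simp: frac_def intro: cls_eqD)
  then obtain u where u: "u \<in> Arr T" "Cod T u = Z" "u \<in> cone_in T D" "g \<cdot>\<^bsub>T\<^esub> u = g' \<cdot>\<^bsub>T\<^esub> u"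
    using a by (auto simp: roof_eq_def Hom_def)
  then have "g \<cdot>\<^bsub>T\<^esub> u \<in> Hom T (Dom T u) Y" using a by (simp add: Hom_def)
  then have "\<exists>!k. k \<in> Hom T (Cod T u) Y \<and> k \<cdot>\<^bsub>T\<^esub> u = g \<cdot>\<^bsub>T\<^esub> u"
    using Y u(3) by (simp add: local_object_def)
  then show "g = g'" using * u by auto
qed

end

text \<open>
  The adjoint sends \<open>X\<close> to the local object \<open>Y\<close> in its reflection \<open>\<eta> : X \<rightarrow> Y\<close>. Since \<open>j \<eta>\<close> is
  invertible, arrows \<open>j Z \<rightarrow> j X\<close> correspond to arrows \<open>j Z \<rightarrow> j Y\<close>, which correspond to arrows
  \<open>Z \<rightarrow> Y\<close> because \<open>Y\<close> is local. So \<open>(j \<eta>)\<^sup>-\<^sup>1\<close> is a universal arrow.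
\<close>

theorem verdier_quotient_right_adjoint:
  fixes T :: "('o, 'a, 'm) tri_cat_scheme"
  assumes quotient: "verdier_quotient T D Q jO jA"
    and cone_in_arr: "cone_in T D \<subseteq> Arr T"
    and reflection: "\<And>X. X \<in> Ob T \<Longrightarrow> \<exists>\<eta> \<in> cone_in T D. Dom T \<eta> = X \<and> local_object T D (Cod T \<eta>)"
  shows "has_right_adjoint T Q jO jA"
proof -
  have j: "is_functor T Q jO jA" using quotient by (simp add: verdier_quotient_def)
  obtain GO GA where G: "is_category_isomorphism (fractions T D) Q GO GA"
    and jO: "\<And>X. X \<in> Ob T \<Longrightarrow> jO X = GO X"
    and jA': "\<And>f. f \<in> Arr T \<Longrightarrow> jA f = GA (roof_class T D (Ident T (Dom T f), f))"
    using quotient by (auto simp: verdier_quotient_def)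
  have GF: "is_functor (fractions T D) Q GO GA" and GO: "bij_betw GO (Ob (fractions T D)) (Ob Q)"
    and GA: "bij_betw GA (Arr (fractions T D)) (Arr Q)"
    using G by (auto simp: is_category_isomorphism_def)
  interpret Q: cat Q using j by unfold_locales (simp add: is_functor_def)
  interpret fraction_category T D
    using j GF cone_in_arr by unfold_locales (simp_all add: is_functor_def)
  have jA: "jA f = GA (frac f)" if "f \<in> Arr T" for f using jA'[OF that] by (simp add: frac_def)
  have GA_arr: "GA h \<in> Arr Q" "Dom Q (GA h) = GO (Dom Fr h)" "Cod Q (GA h) = GO (Cod Fr h)"
    if "h \<in> Arr Fr" for h using GF that by (auto simp: is_functor_def Hom_def)
  have GA_comp: "GA (g \<cdot>\<^bsub>Fr\<^esub> f) = GA g \<cdot>\<^bsub>Q\<^esub> GA f"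
    if "f \<in> Arr Fr" "g \<in> Arr Fr" "Dom Fr g = Cod Fr f" for f g
    using GF that by (auto simp: is_functor_def Hom_def)
  define \<eta> where "\<eta> X = (SOME \<eta>. \<eta> \<in> cone_in T D \<and> Dom T \<eta> = X \<and> local_object T D (Cod T \<eta>))" for X
  have \<eta>: "\<eta> X \<in> cone_in T D" "Dom T (\<eta> X) = X" "local_object T D (Cod T (\<eta> X))" "\<eta> X \<in> Arr T"
    if "X \<in> Ob T" for X
    using someI_ex[of "\<lambda>\<eta>. \<eta> \<in> cone_in T D \<and> Dom T \<eta> = X \<and> local_object T D (Cod T \<eta>)"]
      reflection[OF that] cone_in_arr unfolding \<eta>_def by blast+
  define \<epsilon> where "\<epsilon> X = cls (\<eta> X, Ident T X)" for X
  have \<epsilon>: "\<epsilon> X \<in> Arr Fr" "Dom Fr (\<epsilon> X) = Cod T (\<eta> X)" "Cod Fr (\<epsilon> X) = X"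
    "\<epsilon> X \<cdot>\<^bsub>Fr\<^esub> frac (\<eta> X) = Ident Fr X" "frac (\<eta> X) \<cdot>\<^bsub>Fr\<^esub> \<epsilon> X = Ident Fr (Cod T (\<eta> X))"
    if "X \<in> Ob T" for X
    using frac_inverse[of "\<eta> X"] \<eta>[OF that] by (simp_all add: \<epsilon>_def)
  have universal: "\<exists>!g. g \<in> Hom T Z (Cod T (\<eta> X)) \<and> \<epsilon> X \<cdot>\<^bsub>Fr\<^esub> frac g = h"
    if X: "X \<in> Ob T" and h: "h \<in> Hom Fr Z X" for X Z h
  proof -
    have ha: "h \<in> Arr Fr" "Dom Fr h = Z" "Cod Fr h = X" using h by (auto simp: Hom_def)
    have solve: "\<epsilon> X \<cdot>\<^bsub>Fr\<^esub> k = h \<longleftrightarrow> k = frac (\<eta> X) \<cdot>\<^bsub>Fr\<^esub> h" if k: "k \<in> Hom Fr Z (Cod T (\<eta> X))" for k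
    proof
      have ka: "k \<in> Arr Fr" "Dom Fr k = Z" "Cod Fr k = Cod T (\<eta> X)" using k by (auto simp: Hom_def)
      note [simp] = \<eta>[OF X] \<epsilon>(1-3)[OF X] ka ha
      assume "\<epsilon> X \<cdot>\<^bsub>Fr\<^esub> k = h"
      then have "frac (\<eta> X) \<cdot>\<^bsub>Fr\<^esub> h = (frac (\<eta> X) \<cdot>\<^bsub>Fr\<^esub> \<epsilon> X) \<cdot>\<^bsub>Fr\<^esub> k" by (subst Fr.assoc) simp_all
      then show "k = frac (\<eta> X) \<cdot>\<^bsub>Fr\<^esub> h" by (simp add: \<epsilon>(5)[OF X])
    next
      note [simp] = \<eta>[OF X] \<epsilon>(1-3)[OF X] ha
      assume "k = frac (\<eta> X) \<cdot>\<^bsub>Fr\<^esub> h"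
      then have "\<epsilon> X \<cdot>\<^bsub>Fr\<^esub> k = (\<epsilon> X \<cdot>\<^bsub>Fr\<^esub> frac (\<eta> X)) \<cdot>\<^bsub>Fr\<^esub> h" by (subst Fr.assoc) simp_all
      then show "\<epsilon> X \<cdot>\<^bsub>Fr\<^esub> k = h" by (simp add: \<epsilon>(4)[OF X])
    qed
    have *: "g \<in> Hom T Z (Cod T (\<eta> X)) \<and> \<epsilon> X \<cdot>\<^bsub>Fr\<^esub> frac g = h \<longleftrightarrow>
        g \<in> Hom T Z (Cod T (\<eta> X)) \<and> frac g = frac (\<eta> X) \<cdot>\<^bsub>Fr\<^esub> h" for g
      by (rule conj_cong[OF refl], rule solve) (auto simp: Hom_def)
    have "frac (\<eta> X) \<cdot>\<^bsub>Fr\<^esub> h \<in> Hom Fr Z (Cod T (\<eta> X))"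
      using ha \<eta>[OF X] by (simp add: Hom_def)
    from frac_bij_local[OF \<eta>(3)[OF X] this] show ?thesis by (simp only: *)
  qed
  define preim where "preim = the_inv_into (Ob Fr) GO"
  have preim: "preim Y \<in> Ob T" "GO (preim Y) = Y" if "Y \<in> Ob Q" for Y
    using GO that the_inv_into_into[of GO "Ob Fr" Y "Ob Fr"] f_the_inv_into_f[of GO "Ob Fr" Y]
    unfolding preim_def bij_betw_def by (auto simp: Ob_Fr)
  show ?thesis
  proof (rule right_adjoint_if_universal_arrows
      [where GO = "\<lambda>Y. Cod T (\<eta> (preim Y))" and \<epsilon> = "\<lambda>Y. GA (\<epsilon> (preim Y))"])
    show "is_functor T Q jO jA" by (rule j)
    fix Y assume Y: "Y \<in> Ob Q"
    show "Cod T (\<eta> (preim Y)) \<in> Ob T \<and> GA (\<epsilon> (preim Y)) \<in> Hom Q (jO (Cod T (\<eta> (preim Y)))) Y"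
      using preim[OF Y] \<eta>[of "preim Y"] \<epsilon>(1-3)[of "preim Y"] by (simp add: Hom_def GA_arr jO)
    fix X f assume X: "X \<in> Ob T" and f: "f \<in> Hom Q (jO X) Y"
    have "f \<in> GA ` Arr Fr" using f GA by (auto simp: bij_betw_def Hom_def)
    then obtain h where h: "h \<in> Arr Fr" "f = GA h" by auto
    have "GO (Dom Fr h) = GO X" "GO (Cod Fr h) = GO (preim Y)"
      using h f X preim[OF Y] by (auto simp: Hom_def GA_arr jO)
    then have "h \<in> Hom Fr X (preim Y)"
      using GO h X preim[OF Y] Fr.dom_cod[OF h(1)] unfolding bij_betw_def inj_on_def Hom_def
      by (auto simp: Ob_Fr)
    note ex1 = universal[OF preim(1)[OF Y] this]
    have "GA (\<epsilon> (preim Y)) \<cdot>\<^bsub>Q\<^esub> jA g = f \<longleftrightarrow> \<epsilon> (preim Y) \<cdot>\<^bsub>Fr\<^esub> frac g = h"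
      if "g \<in> Hom T X (Cod T (\<eta> (preim Y)))" for g
    proof -
      have g: "g \<in> Arr T" "Cod T g = Cod T (\<eta> (preim Y))" using that by (auto simp: Hom_def)
      have "GA (\<epsilon> (preim Y)) \<cdot>\<^bsub>Q\<^esub> jA g = GA (\<epsilon> (preim Y) \<cdot>\<^bsub>Fr\<^esub> frac g)"
        using g preim[OF Y] by (simp add: jA GA_comp \<epsilon>)
      moreover have "\<epsilon> (preim Y) \<cdot>\<^bsub>Fr\<^esub> frac g \<in> Arr Fr" using g preim[OF Y] by (simp add: \<epsilon>)
      ultimately show ?thesis using GA h by (auto simp: bij_betw_def inj_on_def)
    qed
    with ex1 show "\<exists>!g. g \<in> Hom T X (Cod T (\<eta> (preim Y))) \<and> GA (\<epsilon> (preim Y)) \<cdot>\<^bsub>Q\<^esub> jA g = f"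
      by (metis (no_types, lifting))
  qed
qed

section \<open>Arrows and conflations of a Frobenius category\<close>

locale frobenius =
  fixes E :: "('o, 'a, 'm) frob_cat_scheme" (structure)
  assumes frobenius: "frobenius_category E"
begin

lemma exact: "exact_category E" and additive: "additive_category E"
  using frobenius by (auto simp: frobenius_category_def exact_category_def)

sublocale cat E
  using additive by unfold_locales (simp add: additive_category_def)

abbreviation add (infixl "\<oplus>" 65) where "f \<oplus> g \<equiv> Add E f g"

definition diff (infixl "\<ominus>" 65) where
  "f \<ominus> g = f \<oplus> inv\<^bsub>hom_group E (Dom E g) (Cod E g)\<^esub> g"

lemma hom_comm_group: "X \<in> Ob E \<Longrightarrow> Y \<in> Ob E \<Longrightarrow> comm_group (hom_group E X Y)"
  using additive by (simp add: additive_category_def)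

lemma zero [simp]:
  assumes "X \<in> Ob E" "Y \<in> Ob E"
  shows "Zero E X Y \<in> Arr E" "Dom E (Zero E X Y) = X" "Cod E (Zero E X Y) = Y"
proof -
  interpret G: comm_group "hom_group E X Y" using assms by (rule hom_comm_group)
  show "Zero E X Y \<in> Arr E" "Dom E (Zero E X Y) = X" "Cod E (Zero E X Y) = Y"
    using G.one_closed by (simp_all add: hom_group_def Hom_def)
qed

lemma parallel_group:
  assumes "f \<in> Arr E"
  shows "comm_group (hom_group E (Dom E f) (Cod E f))"
    and "carrier (hom_group E (Dom E f) (Cod E f)) = Hom E (Dom E f) (Cod E f)"
    and "mult (hom_group E (Dom E f) (Cod E f)) = Add E"
    and "one (hom_group E (Dom E f) (Cod E f)) = Zero E (Dom E f) (Cod E f)"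
  using assms by (simp_all add: hom_comm_group) (simp_all add: hom_group_def)

lemma
  assumes "f \<in> Arr E" "g \<in> Arr E" "Dom E g = Dom E f" "Cod E g = Cod E f"
  shows add [simp]: "f \<oplus> g \<in> Arr E" "Dom E (f \<oplus> g) = Dom E f" "Cod E (f \<oplus> g) = Cod E f"
    and diff [simp]: "f \<ominus> g \<in> Arr E" "Dom E (f \<ominus> g) = Dom E f" "Cod E (f \<ominus> g) = Cod E f"
    and diff_add: "(f \<ominus> g) \<oplus> g = f" and add_diff: "(f \<oplus> g) \<ominus> g = f"
    and diff_eq_zero_iff: "f \<ominus> g = Zero E (Dom E f) (Cod E f) \<longleftrightarrow> f = g"
    and diff_zero_aux: "f \<ominus> Zero E (Dom E f) (Cod E f) = f"
    and add_comm: "f \<oplus> g = g \<oplus> f"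
proof -
  interpret G: comm_group "hom_group E (Dom E f) (Cod E f)"
    by (rule parallel_group[OF assms(1)])
  note G = parallel_group(2-)[OF assms(1)]
  have fg: "f \<in> carrier (hom_group E (Dom E f) (Cod E f))" "g \<in> carrier (hom_group E (Dom E f) (Cod E f))"
    using assms unfolding G by (simp_all add: Hom_def)
  have z: "Zero E (Dom E f) (Cod E f) \<in> Arr E" "Dom E (Zero E (Dom E f) (Cod E f)) = Dom E f"
    "Cod E (Zero E (Dom E f) (Cod E f)) = Cod E f" using assms by simp_all
  show "f \<oplus> g \<in> Arr E" "Dom E (f \<oplus> g) = Dom E f" "Cod E (f \<oplus> g) = Cod E f"
    using G.m_closed[OF fg] unfolding G by (simp_all add: Hom_def)
  show "f \<ominus> g \<in> Arr E" "Dom E (f \<ominus> g) = Dom E f" "Cod E (f \<ominus> g) = Cod E f"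
    using G.m_closed[OF fg(1) G.inv_closed[OF fg(2)]] unfolding G diff_def assms(3,4)
    by (simp_all add: Hom_def)
  show "(f \<ominus> g) \<oplus> g = f"
    using G.inv_solve_right'[OF _ fg(2) fg(1)] G.m_assoc[OF fg(1) G.inv_closed[OF fg(2)] fg(2)] fg
    unfolding diff_def assms(3,4) G(2)[symmetric] by simp
  show "(f \<oplus> g) \<ominus> g = f"
    using G.m_assoc[OF fg fg(2)[THEN G.inv_closed]] fg
    unfolding diff_def assms(3,4) G(2)[symmetric] by simp
  show "f \<ominus> g = Zero E (Dom E f) (Cod E f) \<longleftrightarrow> f = g"
    using fg G.inv_equality[of f "inv\<^bsub>hom_group E (Dom E f) (Cod E f)\<^esub> g"]
    unfolding diff_def assms(3,4) G(2,3)[symmetric] by (metis G.inv_closed G.inv_inv G.r_inv)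
  show "f \<ominus> Zero E (Dom E f) (Cod E f) = f"
  proof -
    have "f \<ominus> Zero E (Dom E f) (Cod E f) =
      f \<otimes>\<^bsub>hom_group E (Dom E f) (Cod E f)\<^esub> inv\<^bsub>hom_group E (Dom E f) (Cod E f)\<^esub> \<one>\<^bsub>hom_group E (Dom E f) (Cod E f)\<^esub>"
      by (simp only: diff_def z G)
    then show ?thesis using fg by simp
  qed
  show "f \<oplus> g = g \<oplus> f" using fg G.m_comm unfolding G(2)[symmetric] by simp
qed

lemma diff_zero [simp]: "f \<in> Arr E \<Longrightarrow> Dom E f = X \<Longrightarrow> Cod E f = Y \<Longrightarrow> f \<ominus> Zero E X Y = f"
  using diff_zero_aux[of f f] by simp

lemma diff_trans:
  assumes "f \<in> Arr E" "g \<in> Arr E" "h \<in> Arr E" "Dom E g = Dom E f" "Cod E g = Cod E f"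
    "Dom E h = Dom E f" "Cod E h = Cod E f"
  shows "(h \<ominus> g) \<oplus> (g \<ominus> f) = h \<ominus> f"
proof -
  interpret G: comm_group "hom_group E (Dom E f) (Cod E f)"
    by (rule parallel_group[OF assms(1)])
  note G = parallel_group(2-)[OF assms(1)]
  let ?G = "hom_group E (Dom E f) (Cod E f)"
  have fgh: "f \<in> carrier ?G" "g \<in> carrier ?G" "h \<in> carrier ?G"
    using assms unfolding G by (simp_all add: Hom_def)
  then have "(h \<otimes>\<^bsub>?G\<^esub> inv\<^bsub>?G\<^esub> g) \<otimes>\<^bsub>?G\<^esub> (g \<otimes>\<^bsub>?G\<^esub> inv\<^bsub>?G\<^esub> f) = h \<otimes>\<^bsub>?G\<^esub> ((inv\<^bsub>?G\<^esub> g \<otimes>\<^bsub>?G\<^esub> g) \<otimes>\<^bsub>?G\<^esub> inv\<^bsub>?G\<^esub> f)"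
    by (simp only: G.m_assoc G.m_closed G.inv_closed)
  also have "\<dots> = h \<otimes>\<^bsub>?G\<^esub> inv\<^bsub>?G\<^esub> f" using fgh by simp
  finally show ?thesis using assms by (simp add: diff_def G(2))
qed

lemma bilinear:
  assumes "f \<in> Hom E X Y" "f' \<in> Hom E X Y" "g \<in> Hom E Y Z" "g' \<in> Hom E Y Z"
  shows "g \<cdot> (f \<oplus> f') = (g \<cdot> f) \<oplus> (g \<cdot> f')" "(g \<oplus> g') \<cdot> f = (g \<cdot> f) \<oplus> (g' \<cdot> f)"
proof -
  have "\<forall>X Y Z. \<forall>f \<in> Hom E X Y. \<forall>f' \<in> Hom E X Y. \<forall>g \<in> Hom E Y Z. \<forall>g' \<in> Hom E Y Z.
        g \<cdot> Add E f f' = Add E (g \<cdot> f) (g \<cdot> f') \<and> Add E g g' \<cdot> f = Add E (g \<cdot> f) (g' \<cdot> f)"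
    using additive unfolding additive_category_def by (elim conjE)
  with assms show "g \<cdot> (f \<oplus> f') = (g \<cdot> f) \<oplus> (g \<cdot> f')" "(g \<oplus> g') \<cdot> f = (g \<cdot> f) \<oplus> (g' \<cdot> f)"
    by blast+
qed

lemma comp_add:
  assumes "f \<in> Arr E" "f' \<in> Arr E" "g \<in> Arr E" "Dom E f' = Dom E f" "Cod E f' = Cod E f" "Dom E g = Cod E f"
  shows "g \<cdot> (f \<oplus> f') = (g \<cdot> f) \<oplus> (g \<cdot> f')"
  using assms by (intro bilinear(1)[where g' = g]) (auto simp: Hom_def)

lemma add_comp:
  assumes "f \<in> Arr E" "g \<in> Arr E" "g' \<in> Arr E" "Dom E g' = Dom E g" "Cod E g' = Cod E g" "Dom E g = Cod E f"
  shows "(g \<oplus> g') \<cdot> f = (g \<cdot> f) \<oplus> (g' \<cdot> f)"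
  using assms by (intro bilinear(2)[where f' = f]) (auto simp: Hom_def)

lemma comp_diff:
  assumes "f \<in> Arr E" "f' \<in> Arr E" "g \<in> Arr E" "Dom E f' = Dom E f" "Cod E f' = Cod E f" "Dom E g = Cod E f"
  shows "g \<cdot> (f \<ominus> f') = (g \<cdot> f) \<ominus> (g \<cdot> f')"
proof -
  have "(g \<cdot> (f \<ominus> f')) \<oplus> (g \<cdot> f') = g \<cdot> f"
    using comp_add[of "f \<ominus> f'" f' g] assms by (simp add: diff_add)
  then show ?thesis using add_diff[of "g \<cdot> (f \<ominus> f')" "g \<cdot> f'"] assms by simp
qed

lemma diff_comp:
  assumes "f \<in> Arr E" "g \<in> Arr E" "g' \<in> Arr E" "Dom E g' = Dom E g" "Cod E g' = Cod E g" "Dom E g = Cod E f"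
  shows "(g \<ominus> g') \<cdot> f = (g \<cdot> f) \<ominus> (g' \<cdot> f)"
proof -
  have "((g \<ominus> g') \<cdot> f) \<oplus> (g' \<cdot> f) = g \<cdot> f"
    using add_comp[of f "g \<ominus> g'" g'] assms by (simp add: diff_add)
  then show ?thesis using add_diff[of "(g \<ominus> g') \<cdot> f" "g' \<cdot> f"] assms by simp
qed

lemma diff_self: "f \<in> Arr E \<Longrightarrow> f \<ominus> f = Zero E (Dom E f) (Cod E f)"
  by (simp add: diff_eq_zero_iff)

lemma comp_zero [simp]:
  assumes "g \<in> Arr E" "X \<in> Ob E" "Dom E g = Y"
  shows "g \<cdot> Zero E X Y = Zero E X (Cod E g)"
  using comp_diff[of "Zero E X Y" "Zero E X Y" g] assms by (auto simp: diff_self)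

lemma zero_comp [simp]:
  assumes "f \<in> Arr E" "Z \<in> Ob E" "Cod E f = Y"
  shows "Zero E Y Z \<cdot> f = Zero E (Dom E f) Z"
  using diff_comp[of f "Zero E Y Z" "Zero E Y Z"] assms by (auto simp: diff_self)

lemma confl_kernel: "(i, p) \<in> Confl E \<Longrightarrow> is_kernel E i p"
  and confl_cokernel: "(i, p) \<in> Confl E \<Longrightarrow> is_cokernel E p i"
proof -
  have "\<forall>(i, p) \<in> Confl E. is_kernel E i p \<and> is_cokernel E p i"
    using exact unfolding exact_category_def by (elim conjE)
  then show "(i, p) \<in> Confl E \<Longrightarrow> is_kernel E i p" "(i, p) \<in> Confl E \<Longrightarrow> is_cokernel E p i"
    by blast+
qed

lemma confl:
  assumes "(i, p) \<in> Confl E"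
  shows "i \<in> Arr E" "p \<in> Arr E" "Cod E i = Dom E p" "p \<cdot> i = Zero E (Dom E i) (Cod E p)"
  using confl_kernel[OF assms] by (simp_all add: is_kernel_def)

lemma kernel_arr:
  assumes "is_kernel E k f"
  shows "k \<in> Arr E" "f \<in> Arr E" "Cod E k = Dom E f" "f \<cdot> k = Zero E (Dom E k) (Cod E f)"
  using assms by (simp_all add: is_kernel_def)

lemma kernel_universal:
  assumes "is_kernel E k f" "g \<in> Arr E" "Cod E g = Dom E f" "f \<cdot> g = Zero E (Dom E g) (Cod E f)"
  shows "\<exists>!h. h \<in> Hom E (Dom E g) (Dom E k) \<and> k \<cdot> h = g"
proof -
  have "g \<in> Hom E (Dom E g) (Dom E f)" using assms by (simp add: Hom_def)
  then show ?thesis using assms(1,4) unfolding is_kernel_def by blast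
qed

lemma kernel_factor:
  assumes "is_kernel E k f" "g \<in> Arr E" "Cod E g = Dom E f" "f \<cdot> g = Zero E (Dom E g) (Cod E f)"
  obtains h where "h \<in> Arr E" "Dom E h = Dom E g" "Cod E h = Dom E k" "k \<cdot> h = g"
  using ex1_implies_ex[OF kernel_universal[OF assms]] that by (auto simp only: Hom_def mem_Collect_eq)

lemma kernel_mono:
  assumes "is_kernel E k f" "h \<in> Arr E" "h' \<in> Arr E" "Dom E h' = Dom E h" "Cod E h = Dom E k"
    "Cod E h' = Dom E k" "k \<cdot> h = k \<cdot> h'"
  shows "h = h'"
proof -
  note k = kernel_arr[OF assms(1)]
  have "f \<cdot> (k \<cdot> h) = (f \<cdot> k) \<cdot> h" using k(1-3) assms(2-6) by simp
  then have "f \<cdot> (k \<cdot> h) = Zero E (Dom E (k \<cdot> h)) (Cod E f)" using k assms(2-6) by simp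
  then have "\<exists>!l. l \<in> Hom E (Dom E (k \<cdot> h)) (Dom E k) \<and> k \<cdot> l = k \<cdot> h"
    using k(1-3) assms(2-6) by (intro kernel_universal[OF assms(1)]) simp_all
  moreover have "h \<in> Hom E (Dom E (k \<cdot> h)) (Dom E k)" "h' \<in> Hom E (Dom E (k \<cdot> h)) (Dom E k)"
    using k assms(2-6) by (simp_all add: Hom_def)
  ultimately show ?thesis using assms(7)[symmetric] by blast
qed

lemma cokernel_universal:
  assumes "is_cokernel E q f" "g \<in> Arr E" "Dom E g = Cod E f" "g \<cdot> f = Zero E (Dom E f) (Cod E g)"
  shows "\<exists>!h. h \<in> Hom E (Cod E q) (Cod E g) \<and> h \<cdot> q = g"
proof -
  have "g \<in> Hom E (Cod E f) (Cod E g)" using assms by (simp add: Hom_def)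
  then show ?thesis using assms(1,4) unfolding is_cokernel_def by blast
qed

lemma cokernel_factor:
  assumes "is_cokernel E q f" "g \<in> Arr E" "Dom E g = Cod E f" "g \<cdot> f = Zero E (Dom E f) (Cod E g)"
  obtains h where "h \<in> Arr E" "Dom E h = Cod E q" "Cod E h = Cod E g" "h \<cdot> q = g"
  using ex1_implies_ex[OF cokernel_universal[OF assms]] that by (auto simp only: Hom_def mem_Collect_eq)

lemma cokernel_epi:
  assumes "is_cokernel E q f" "h \<in> Arr E" "h' \<in> Arr E" "Cod E h' = Cod E h" "Dom E h = Cod E q"
    "Dom E h' = Cod E q" "h \<cdot> q = h' \<cdot> q"
  shows "h = h'"
proof -
  have q: "q \<in> Arr E" "f \<in> Arr E" "Dom E q = Cod E f" "q \<cdot> f = Zero E (Dom E f) (Cod E q)"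
    using assms(1) by (simp_all add: is_cokernel_def)
  have "(h \<cdot> q) \<cdot> f = Zero E (Dom E f) (Cod E (h \<cdot> q))" using q assms(2-6) by simp
  then have "\<exists>!l. l \<in> Hom E (Cod E q) (Cod E (h \<cdot> q)) \<and> l \<cdot> q = h \<cdot> q"
    using q(1-3) assms(2-6) by (intro cokernel_universal[OF assms(1)]) simp_all
  moreover have "h \<in> Hom E (Cod E q) (Cod E (h \<cdot> q))" "h' \<in> Hom E (Cod E q) (Cod E (h \<cdot> q))"
    using q assms(2-6) by (simp_all add: Hom_def)
  ultimately show ?thesis using assms(7)[symmetric] by blast
qed

lemma inc_prj:
  assumes "X \<in> Ob E"
  shows inc_prj_confl: "(inc E X, prj E X) \<in> Confl E" and hull_injective: "injective E (hull E X)"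
    and inc_arr: "inc E X \<in> Arr E" "Dom E (inc E X) = X" "Cod E (inc E X) = hull E X"
    and prj_arr: "prj E X \<in> Arr E" "Dom E (prj E X) = hull E X" "Cod E (prj E X) = susp E X"
    and hull_ob: "hull E X \<in> Ob E" and susp_ob: "susp E X \<in> Ob E"
proof -
  show c: "(inc E X, prj E X) \<in> Confl E" and i: "injective E (hull E X)"
    and "Dom E (inc E X) = X"
    using frobenius assms by (simp_all add: frobenius_category_def)
  then show "inc E X \<in> Arr E" "prj E X \<in> Arr E" "Cod E (inc E X) = hull E X"
    "Cod E (prj E X) = susp E X" "Dom E (prj E X) = hull E X"
    using confl[OF c] by (simp_all add: hull_def susp_def)
  show "hull E X \<in> Ob E" using i by (simp add: injective_def)
  show "susp E X \<in> Ob E" using \<open>prj E X \<in> Arr E\<close> by (simp add: susp_def)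
qed

declare inc_arr [simp] prj_arr [simp] hull_ob [simp] susp_ob [simp]

lemma projective_iff_injective: "projective E P \<longleftrightarrow> injective E P"
  using frobenius by (simp add: frobenius_category_def)

lemma injective_extend:
  assumes "injective E J" "(i, p) \<in> Confl E" "f \<in> Arr E" "Dom E f = Dom E i" "Cod E f = J"
  obtains g where "g \<in> Arr E" "Dom E g = Cod E i" "Cod E g = J" "g \<cdot> i = f"
proof -
  have "inflation E i" using assms(2) by (auto simp: inflation_def)
  then have "\<exists>g \<in> Hom E (Cod E i) J. g \<cdot> i = f" using assms(1,3-) by (simp add: injective_def Hom_def)
  then show ?thesis using that by (auto simp: Hom_def)
qed

lemma injective_lift:
  assumes "injective E P" "(i, p) \<in> Confl E" "f \<in> Arr E" "Cod E f = Cod E p" "Dom E f = P"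
  obtains g where "g \<in> Arr E" "Dom E g = P" "Cod E g = Dom E p" "p \<cdot> g = f"
proof -
  have "deflation E p" using assms(2) by (auto simp: deflation_def)
  then have "\<exists>g \<in> Hom E P (Dom E p). p \<cdot> g = f"
    using assms(1,3-) unfolding projective_iff_injective[symmetric] projective_def by (simp add: Hom_def)
  then show ?thesis using that by (auto simp: Hom_def)
qed

text \<open>
  The arrows that vanish in the stable category. Demanding a factorization through the chosen hull
  \<open>I(X)\<close> loses nothing, because an arrow from \<open>X\<close> to an injective object extends along
  \<open>X \<rightarrow> I(X)\<close>. It makes sums of null arrows null without forming direct sums.
\<close>

definition null :: "'a \<Rightarrow> bool" where
  "null f \<longleftrightarrow> f \<in> Arr E \<and>
     (\<exists>b \<in> Arr E. Dom E b = hull E (Dom E f) \<and> Cod E b = Cod E f \<and> b \<cdot> inc E (Dom E f) = f)"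

lemma null_through_injective:
  assumes "injective E J" "a \<in> Arr E" "b \<in> Arr E" "Cod E a = J" "Dom E b = J"
  shows "null (b \<cdot> a)"
proof -
  have X: "Dom E a \<in> Ob E" using assms by simp
  obtain c where "c \<in> Arr E" "Dom E c = Cod E (inc E (Dom E a))" "Cod E c = J" "c \<cdot> inc E (Dom E a) = a"
    using X assms by (auto intro: injective_extend[OF assms(1) inc_prj_confl[OF X] assms(2)])
  then show ?thesis unfolding null_def using assms X
    by (auto intro!: bexI[of _ "b \<cdot> c"])
qed

lemma null_arr: "null f \<Longrightarrow> f \<in> Arr E" by (simp add: null_def)

lemma null_factor:
  assumes "null f"
  obtains b where "b \<in> Arr E" "Dom E b = hull E (Dom E f)" "Cod E b = Cod E f" "b \<cdot> inc E (Dom E f) = f"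
  using assms by (auto simp: null_def)

text \<open>
  Null arrows extend along every inflation and, dually, lift along every deflation: factor through
  the hull, which is both injective and projective.
\<close>

lemma null_extend:
  assumes "null f" "(i, p) \<in> Confl E" "Dom E i = Dom E f"
  obtains t where "t \<in> Arr E" "Dom E t = Cod E i" "Cod E t = Cod E f" "t \<cdot> i = f"
proof -
  have f: "f \<in> Arr E" "Dom E f \<in> Ob E" using assms(1) by (auto dest: null_arr)
  obtain b where b: "b \<in> Arr E" "Dom E b = hull E (Dom E f)" "Cod E b = Cod E f" "b \<cdot> inc E (Dom E f) = f"
    using assms(1) by (rule null_factor)
  obtain c where c: "c \<in> Arr E" "Dom E c = Cod E i" "Cod E c = hull E (Dom E f)" "c \<cdot> i = inc E (Dom E f)"
    by (rule injective_extend[OF hull_injective[OF f(2)] assms(2), of "inc E (Dom E f)"])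
      (use f assms in simp_all)
  show ?thesis using b c confl(1)[OF assms(2)] by (intro that[of "b \<cdot> c"]) simp_all
qed

lemma null_lift:
  assumes "null f" "(i, p) \<in> Confl E" "Cod E p = Cod E f"
  obtains t where "t \<in> Arr E" "Dom E t = Dom E f" "Cod E t = Dom E p" "p \<cdot> t = f"
proof -
  have f: "f \<in> Arr E" "Dom E f \<in> Ob E" using assms(1) by (auto dest: null_arr)
  obtain b where b: "b \<in> Arr E" "Dom E b = hull E (Dom E f)" "Cod E b = Cod E f" "b \<cdot> inc E (Dom E f) = f"
    using assms(1) by (rule null_factor)
  obtain c where c: "c \<in> Arr E" "Dom E c = hull E (Dom E f)" "Cod E c = Dom E p" "p \<cdot> c = b"
    by (rule injective_lift[OF hull_injective[OF f(2)] assms(2), of b]) (use f b assms in simp_all)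
  have "p \<cdot> (c \<cdot> inc E (Dom E f)) = (p \<cdot> c) \<cdot> inc E (Dom E f)"
    using c(1-3) f confl[OF assms(2)] by simp
  then have "p \<cdot> (c \<cdot> inc E (Dom E f)) = f" using b(4) c(4) by simp
  then show ?thesis using f c that[of "c \<cdot> inc E (Dom E f)"] by simp
qed

lemma null_comp:
  assumes "null f" "g \<in> Arr E" "Dom E g = Cod E f" shows "null (g \<cdot> f)"
proof -
  have f: "f \<in> Arr E" "Dom E f \<in> Ob E" using assms(1) by (auto dest: null_arr)
  obtain b where b: "b \<in> Arr E" "Dom E b = hull E (Dom E f)" "Cod E b = Cod E f" "b \<cdot> inc E (Dom E f) = f"
    using assms(1) by (rule null_factor)
  have "g \<cdot> (b \<cdot> inc E (Dom E f)) = (g \<cdot> b) \<cdot> inc E (Dom E f)" using b(1-3) f assms by simp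
  then have *: "g \<cdot> f = (g \<cdot> b) \<cdot> inc E (Dom E f)" using b(4) by simp
  show ?thesis unfolding * using f b assms
    by (intro null_through_injective[OF hull_injective[OF f(2)]]) simp_all
qed

lemma comp_null:
  assumes "null g" "f \<in> Arr E" "Cod E f = Dom E g" shows "null (g \<cdot> f)"
proof -
  have g: "g \<in> Arr E" "Dom E g \<in> Ob E" using assms(1) by (auto dest: null_arr)
  obtain b where b: "b \<in> Arr E" "Dom E b = hull E (Dom E g)" "Cod E b = Cod E g" "b \<cdot> inc E (Dom E g) = g"
    using assms(1) by (rule null_factor)
  have "(b \<cdot> inc E (Dom E g)) \<cdot> f = b \<cdot> (inc E (Dom E g) \<cdot> f)" using b(1-3) g assms by simp
  then have *: "g \<cdot> f = b \<cdot> (inc E (Dom E g) \<cdot> f)" using b(4) by simp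
  show ?thesis unfolding * using g b assms
    by (intro null_through_injective[OF hull_injective[OF g(2)]]) simp_all
qed

lemma null_add_diff:
  assumes "null f" "null g" "Dom E g = Dom E f" "Cod E g = Cod E f"
  shows "null (f \<oplus> g)" "null (f \<ominus> g)"
proof -
  have f: "f \<in> Arr E" "Dom E f \<in> Ob E" "g \<in> Arr E" using assms(1,2) by (auto dest: null_arr)
  obtain b where b: "b \<in> Arr E" "Dom E b = hull E (Dom E f)" "Cod E b = Cod E f" "b \<cdot> inc E (Dom E f) = f"
    using assms(1) by (rule null_factor)
  obtain c where c: "c \<in> Arr E" "Dom E c = hull E (Dom E f)" "Cod E c = Cod E f" "c \<cdot> inc E (Dom E f) = g"
    using assms(2) by (rule null_factor) (simp add: assms)
  have "f \<oplus> g = (b \<oplus> c) \<cdot> inc E (Dom E f)" "f \<ominus> g = (b \<ominus> c) \<cdot> inc E (Dom E f)"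
    using b c f by (simp_all add: add_comp diff_comp)
  then show "null (f \<oplus> g)" "null (f \<ominus> g)" using b(1-3) c(1-3) f
    by (auto intro!: null_through_injective[OF hull_injective[OF f(2)]])
qed

lemma null_zero: "X \<in> Ob E \<Longrightarrow> Y \<in> Ob E \<Longrightarrow> null (Zero E X Y)"
  unfolding null_def by (auto intro!: bexI[of _ "Zero E (hull E X) Y"])

lemma stable_eq_iff:
  "stable_eq E f g \<longleftrightarrow> f \<in> Arr E \<and> g \<in> Arr E \<and> Dom E g = Dom E f \<and> Cod E g = Cod E f \<and> null (g \<ominus> f)"
proof (intro iffI conjI)
  assume "stable_eq E f g"
  then obtain P a b where *: "f \<in> Arr E" "g \<in> Arr E" "Dom E g = Dom E f" "Cod E g = Cod E f"
    "projective E P" "a \<in> Arr E" "Dom E a = Dom E f" "Cod E a = P"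
    "b \<in> Arr E" "Dom E b = P" "Cod E b = Cod E f" "g = f \<oplus> b \<cdot> a"
    by (auto simp: stable_eq_def Hom_def)
  then show "f \<in> Arr E" "g \<in> Arr E" "Dom E g = Dom E f" "Cod E g = Cod E f" by blast+
  have "g \<ominus> f = b \<cdot> a" unfolding *(12) using *(1-11) by (simp add: add_comm[of f] add_diff)
  then show "null (g \<ominus> f)"
    using * by (auto simp: projective_iff_injective intro: null_through_injective)
next
  assume *: "f \<in> Arr E \<and> g \<in> Arr E \<and> Dom E g = Dom E f \<and> Cod E g = Cod E f \<and> null (g \<ominus> f)"
  then have X: "Dom E f \<in> Ob E" by simp
  have d: "Dom E (g \<ominus> f) = Dom E f" "Cod E (g \<ominus> f) = Cod E f" using * by simp_all
  from * have "null (g \<ominus> f)" by blast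
  then obtain b where b: "b \<in> Arr E" "Dom E b = hull E (Dom E f)" "Cod E b = Cod E f"
    "b \<cdot> inc E (Dom E f) = g \<ominus> f" unfolding null_def d by blast
  have "f \<oplus> (g \<ominus> f) = g" using * by (simp add: add_comm[of f] diff_add)
  then have "g = f \<oplus> (b \<cdot> inc E (Dom E f))" using b(4) by simp
  moreover have "projective E (hull E (Dom E f))" using X by (simp add: projective_iff_injective hull_injective)
  moreover have "inc E (Dom E f) \<in> Hom E (Dom E f) (hull E (Dom E f))" "b \<in> Hom E (hull E (Dom E f)) (Cod E f)"
    "g \<in> Hom E (Dom E f) (Cod E f)"
    using X b * by (auto simp: Hom_def)
  ultimately show "stable_eq E f g" unfolding stable_eq_def using * by blast
qed

lemma stable_eq_refl: "f \<in> Arr E \<Longrightarrow> stable_eq E f f"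
  by (simp add: stable_eq_iff diff_self null_zero)

lemma stable_eq_sym: assumes "stable_eq E f g" shows "stable_eq E g f"
proof -
  have a: "f \<in> Arr E" "g \<in> Arr E" "Dom E g = Dom E f" "Cod E g = Cod E f" "null (g \<ominus> f)"
    using assms by (simp_all add: stable_eq_iff)
  have "(f \<ominus> g) \<oplus> (g \<ominus> f) = f \<ominus> f" using a by (intro diff_trans) simp_all
  then have "((f \<ominus> g) \<oplus> (g \<ominus> f)) \<ominus> (g \<ominus> f) = (f \<ominus> f) \<ominus> (g \<ominus> f)" by simp
  then have "f \<ominus> g = (f \<ominus> f) \<ominus> (g \<ominus> f)" using a by (simp add: add_diff)
  moreover have "null ((f \<ominus> f) \<ominus> (g \<ominus> f))"
    by (rule null_add_diff(2)) (use a in \<open>simp_all add: diff_self null_zero\<close>)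
  ultimately show ?thesis using a by (simp add: stable_eq_iff)
qed

lemma stable_eq_trans: assumes "stable_eq E f g" "stable_eq E g h" shows "stable_eq E f h"
proof -
  have a: "f \<in> Arr E" "g \<in> Arr E" "Dom E g = Dom E f" "Cod E g = Cod E f" "null (g \<ominus> f)"
    "h \<in> Arr E" "Dom E h = Dom E f" "Cod E h = Cod E f" "null (h \<ominus> g)"
    using assms by (auto simp: stable_eq_iff)
  have "null ((h \<ominus> g) \<oplus> (g \<ominus> f))" by (rule null_add_diff(1)) (use a in simp_all)
  then show ?thesis using a by (simp add: stable_eq_iff diff_trans)
qed

lemma stable_eq_comp:
  assumes "stable_eq E f f'" "stable_eq E g g'" "Dom E g = Cod E f"
  shows "stable_eq E (g \<cdot> f) (g' \<cdot> f')"
proof -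
  have a: "f \<in> Arr E" "f' \<in> Arr E" "Dom E f' = Dom E f" "Cod E f' = Cod E f" "null (f' \<ominus> f)"
    "g \<in> Arr E" "g' \<in> Arr E" "Dom E g' = Dom E g" "Cod E g' = Cod E g" "null (g' \<ominus> g)"
    using assms by (auto simp: stable_eq_iff)
  have "null (g \<cdot> (f' \<ominus> f))" using a assms(3) by (intro null_comp) simp_all
  then have "stable_eq E (g \<cdot> f) (g \<cdot> f')" using a assms(3) by (simp add: stable_eq_iff comp_diff)
  moreover have "null ((g' \<ominus> g) \<cdot> f')" using a assms(3) by (intro comp_null) simp_all
  then have "stable_eq E (g \<cdot> f') (g' \<cdot> f')" using a assms(3) by (simp add: stable_eq_iff diff_comp)
  ultimately show ?thesis by (rule stable_eq_trans)
qed

section \<open>The stable category\<close>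

abbreviation "T \<equiv> stable_cat E"
abbreviation "cl \<equiv> stable_class E"
abbreviation comp_T (infixr "\<star>" 70) where "g \<star> f \<equiv> g \<cdot>\<^bsub>T\<^esub> f"

lemma stable_cat_simps:
  "Ob T = Ob E" "Arr T = cl ` Arr E" "Ident T = (\<lambda>X. cl (Ident E X))" "Zero T = (\<lambda>X Y. cl (Zero E X Y))"
  "Shift T = susp E" "ShiftA T = susp_arr E" "Triangles T = distinguished_triangles E"
  "Dom T = (\<lambda>A. Dom E (SOME f. f \<in> A))" "Cod T = (\<lambda>A. Cod E (SOME f. f \<in> A))"
  "Comp T = (\<lambda>B A. {h. \<exists>g \<in> B. \<exists>f \<in> A. stable_eq E (g \<cdot> f) h})"
  by (simp_all add: stable_cat_def stable_preadd_cat_def preadd_cat.extend_def tri_cat.fields_def)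

lemma cl_eq_iff: "f \<in> Arr E \<Longrightarrow> g \<in> Arr E \<Longrightarrow> cl f = cl g \<longleftrightarrow> stable_eq E f g"
  unfolding stable_class_def using stable_eq_refl stable_eq_sym stable_eq_trans by blast

lemma mem_cl: "g \<in> cl f \<longleftrightarrow> stable_eq E f g" by (simp add: stable_class_def)

lemma cl_some: "f \<in> Arr E \<Longrightarrow> stable_eq E f (SOME g. g \<in> cl f)"
  unfolding mem_cl by (rule someI[of _ f]) (rule stable_eq_refl)

lemma cl [simp]:
  assumes "f \<in> Arr E" shows "cl f \<in> Arr T" "Dom T (cl f) = Dom E f" "Cod T (cl f) = Cod E f"
  using assms cl_some[OF assms] by (auto simp: stable_cat_simps stable_eq_iff)

lemma comp_cl [simp]:
  assumes "f \<in> Arr E" "g \<in> Arr E" "Dom E g = Cod E f"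
  shows "cl g \<star> cl f = cl (g \<cdot> f)"
proof -
  have "h \<in> cl (g \<cdot> f)" if "g' \<in> cl g" "f' \<in> cl f" "stable_eq E (g' \<cdot> f') h" for g' f' h
    using that stable_eq_comp[of f f' g g'] assms by (auto simp: mem_cl intro: stable_eq_trans)
  moreover have "g \<in> cl g" "f \<in> cl f" using assms by (simp_all add: mem_cl stable_eq_refl)
  ultimately show ?thesis unfolding stable_cat_simps(10) by (force simp: mem_cl)
qed

lemma arr_T_E:
  assumes "A \<in> Arr T" obtains f where "f \<in> Arr E" "A = cl f" "Dom T A = Dom E f" "Cod T A = Cod E f"
  using assms by (auto simp: stable_cat_simps(2))

lemma hom_T_E:
  assumes "A \<in> Hom T X Y" obtains f where "f \<in> Arr E" "A = cl f" "Dom E f = X" "Cod E f = Y"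
proof -
  have "A \<in> Arr T" "Dom T A = X" "Cod T A = Y" using assms by (auto simp: Hom_def)
  then show ?thesis using that by (auto elim: arr_T_E)
qed

lemma cl_hom: "f \<in> Arr E \<Longrightarrow> cl f \<in> Hom T (Dom E f) (Cod E f)"
  by (simp add: Hom_def)

lemma Ob_T [simp]: "Ob T = Ob E" by (simp add: stable_cat_simps)
lemma Ident_T: "Ident T X = cl (Ident E X)" by (simp add: stable_cat_simps)
lemma Zero_T: "Zero T X Y = cl (Zero E X Y)" by (simp add: stable_cat_simps)

lemma category_T: "category T"
  unfolding category_def
proof (intro conjI ballI allI)
  show "f \<in> Arr T \<Longrightarrow> Dom T f \<in> Ob T" "f \<in> Arr T \<Longrightarrow> Cod T f \<in> Ob T" for f by (auto elim!: arr_T_E)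
  show "X \<in> Ob T \<Longrightarrow> Ident T X \<in> Hom T X X" for X using cl_hom[of "Ident E X"] by (simp add: Ident_T)
  show "g \<star> f \<in> Hom T X Z" if "f \<in> Hom T X Y" "g \<in> Hom T Y Z" for f g X Y Z
  proof -
    obtain f' where "f' \<in> Arr E" "f = cl f'" "Dom E f' = X" "Cod E f' = Y"
      using \<open>f \<in> Hom T X Y\<close> by (rule hom_T_E)
    moreover obtain g' where "g' \<in> Arr E" "g = cl g'" "Dom E g' = Y" "Cod E g' = Z"
      using \<open>g \<in> Hom T Y Z\<close> by (rule hom_T_E)
    ultimately show ?thesis by (simp add: Hom_def)
  qed
  show "f \<star> Ident T X = f" "Ident T Y \<star> f = f" if "f \<in> Hom T X Y" for f X Y
    using that by (auto elim!: hom_T_E simp: Ident_T)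
  show "h \<star> (g \<star> f) = (h \<star> g) \<star> f"
    if "f \<in> Hom T W X" "g \<in> Hom T X Y" "h \<in> Hom T Y Z" for f g h W X Y Z
    using that by (auto elim!: hom_T_E)
qed

sublocale T: cat T by unfold_locales (rule category_T)

lemma cl_eq_zero_iff: "f \<in> Arr E \<Longrightarrow> cl f = Zero T (Dom E f) (Cod E f) \<longleftrightarrow> null f"
proof -
  assume f: "f \<in> Arr E"
  have "cl f = Zero T (Dom E f) (Cod E f) \<longleftrightarrow> stable_eq E f (Zero E (Dom E f) (Cod E f))"
    using f by (simp add: Zero_T cl_eq_iff)
  also have "\<dots> \<longleftrightarrow> stable_eq E (Zero E (Dom E f) (Cod E f)) f"
    using stable_eq_sym by blast
  also have "\<dots> \<longleftrightarrow> null f" using f by (simp add: stable_eq_iff diff_zero)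
  finally show "cl f = Zero T (Dom E f) (Cod E f) \<longleftrightarrow> null f" .
qed

end

text \<open>
  Consecutive arrows of a triangle are weak cokernels of each other. In this
  form, as exactness of the contravariant hom functors, triangles enter the arguments on
  orthogonality and locality.
\<close>

definition weak_cokernel :: "('o, 'a, 'm) preadd_cat_scheme \<Rightarrow> 'a \<Rightarrow> 'a \<Rightarrow> bool" where
  "weak_cokernel C g f \<longleftrightarrow> f \<in> Arr C \<and> g \<in> Arr C \<and> Dom C g = Cod C f \<and>
     g \<cdot>\<^bsub>C\<^esub> f = Zero C (Dom C f) (Cod C g) \<and>
     (\<forall>\<phi> \<in> Arr C. Dom C \<phi> = Cod C f \<longrightarrow> \<phi> \<cdot>\<^bsub>C\<^esub> f = Zero C (Dom C f) (Cod C \<phi>) \<longrightarrow>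
        (\<exists>\<psi> \<in> Arr C. Dom C \<psi> = Cod C g \<and> Cod C \<psi> = Cod C \<phi> \<and> \<psi> \<cdot>\<^bsub>C\<^esub> g = \<phi>))"

lemma weak_cokernel_factor:
  assumes "weak_cokernel C g f" "\<phi> \<in> Arr C" "Dom C \<phi> = Cod C f"
    "\<phi> \<cdot>\<^bsub>C\<^esub> f = Zero C (Dom C f) (Cod C \<phi>)"
  obtains \<psi> where "\<psi> \<in> Arr C" "Dom C \<psi> = Cod C g" "Cod C \<psi> = Cod C \<phi>" "\<psi> \<cdot>\<^bsub>C\<^esub> g = \<phi>"
  using assms unfolding weak_cokernel_def by blast

context frobenius begin

lemma zero_T [simp]:
  assumes "X \<in> Ob E" "Y \<in> Ob E"
  shows "Zero T X Y \<in> Arr T" "Dom T (Zero T X Y) = X" "Cod T (Zero T X Y) = Y"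
  using assms by (simp_all add: Zero_T)

lemma comp_zero_T [simp]:
  assumes "g \<in> Arr T" "X \<in> Ob E" "Dom T g = Y"
  shows "g \<star> Zero T X Y = Zero T X (Cod T g)"
proof -
  obtain g' where "g' \<in> Arr E" "g = cl g'" "Dom T g = Dom E g'" "Cod T g = Cod E g'"
    using assms(1) by (rule arr_T_E)
  moreover have "Y \<in> Ob E" using T.dom_cod[OF assms(1)] assms(3) by simp
  ultimately show ?thesis using assms by (simp add: Zero_T)
qed

lemma zero_comp_T [simp]:
  assumes "f \<in> Arr T" "Z \<in> Ob E" "Cod T f = Y"
  shows "Zero T Y Z \<star> f = Zero T (Dom T f) Z"
proof -
  obtain f' where "f' \<in> Arr E" "f = cl f'" "Dom T f = Dom E f'" "Cod T f = Cod E f'"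
    using assms(1) by (rule arr_T_E)
  moreover have "Y \<in> Ob E" using T.dom_cod[OF assms(1)] assms(3) by simp
  ultimately show ?thesis using assms by (simp add: Zero_T)
qed

lemma weak_cokernel_iso:
  assumes wc: "weak_cokernel T g' f'"
    and f: "f \<in> Arr T" "Dom T f = X" "Cod T f = Y" and g: "g \<in> Arr T" "Dom T g = Y" "Cod T g = Z"
    and f': "Dom T f' = X'" "Cod T f' = Y'" and g': "Cod T g' = Z'"
    and a: "is_iso T a" "a \<in> Hom T X X'" and b: "is_iso T b" "b \<in> Hom T Y Y'"
    and c: "is_iso T c" "c \<in> Hom T Z Z'"
    and sq: "b \<star> f = f' \<star> a" "c \<star> g = g' \<star> b"
  shows "weak_cokernel T g f"
proof -
  have [simp]: "f' \<in> Arr T" "g' \<in> Arr T" "Dom T g' = Y'" using wc f' by (auto simp: weak_cokernel_def)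
  have gf': "g' \<star> f' = Zero T X' Z'" using wc f' g' by (auto simp: weak_cokernel_def)
  have [simp]: "a \<in> Arr T" "Dom T a = X" "Cod T a = X'" "b \<in> Arr T" "Dom T b = Y" "Cod T b = Y'"
    "c \<in> Arr T" "Dom T c = Z" "Cod T c = Z'" using a b c by (auto simp: Hom_def)
  note [simp] = f g f' g'
  have "X \<in> Ob E" "Y \<in> Ob E" "Z \<in> Ob E" "X' \<in> Ob E" "Y' \<in> Ob E" "Z' \<in> Ob E"
    using T.dom_cod[of a] T.dom_cod[of b] T.dom_cod[of c] by simp_all
  note [simp] = this
  obtain a' where a' [simp]: "a' \<in> Arr T" "Dom T a' = X'" "Cod T a' = X" and
    "a' \<star> a = Ident T X" and aa': "a \<star> a' = Ident T X'"
    using T.iso_inverse[OF a(1)] by auto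
  obtain b' where b' [simp]: "b' \<in> Arr T" "Dom T b' = Y'" "Cod T b' = Y" and
    b'b: "b' \<star> b = Ident T Y" and "b \<star> b' = Ident T Y'"
    using T.iso_inverse[OF b(1)] by auto
  obtain c' where c' [simp]: "c' \<in> Arr T" "Dom T c' = Z'" "Cod T c' = Z" and
    c'c: "c' \<star> c = Ident T Z" and "c \<star> c' = Ident T Z'"
    using T.iso_inverse[OF c(1)] by auto
  have "c \<star> (g \<star> f) = (c \<star> g) \<star> f" by simp
  also have "\<dots> = g' \<star> (b \<star> f)" unfolding sq(2) by simp
  also have "\<dots> = (g' \<star> f') \<star> a" unfolding sq(1) by simp
  also have "\<dots> = Zero T X Z'" by (simp add: gf')
  finally have "c' \<star> (c \<star> (g \<star> f)) = Zero T X Z" by simp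
  moreover have "c' \<star> (c \<star> (g \<star> f)) = (c' \<star> c) \<star> (g \<star> f)" by simp
  ultimately have gf: "g \<star> f = Zero T X Z" by (simp add: c'c)
  have "\<exists>\<psi> \<in> Arr T. Dom T \<psi> = Z \<and> Cod T \<psi> = Cod T \<phi> \<and> \<psi> \<star> g = \<phi>"
    if \<phi> [simp]: "\<phi> \<in> Arr T" "Dom T \<phi> = Y" and 0: "\<phi> \<star> f = Zero T X (Cod T \<phi>)" for \<phi>
  proof -
    have [simp]: "Cod T \<phi> \<in> Ob E" using T.dom_cod[of \<phi>] by simp
    have "(\<phi> \<star> b') \<star> f' = \<phi> \<star> (b' \<star> ((f' \<star> (a \<star> a'))))" by (simp add: aa')
    also have "\<dots> = \<phi> \<star> (b' \<star> ((f' \<star> a) \<star> a'))" by simp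
    also have "\<dots> = \<phi> \<star> ((b' \<star> b) \<star> (f \<star> a'))" unfolding sq(1)[symmetric] by simp
    also have "\<dots> = (\<phi> \<star> f) \<star> a'" by (simp add: b'b)
    also have "\<dots> = Zero T X' (Cod T (\<phi> \<star> b'))" by (simp add: 0)
    finally have "(\<phi> \<star> b') \<star> f' = Zero T (Dom T f') (Cod T (\<phi> \<star> b'))" by simp
    from weak_cokernel_factor[OF wc _ _ this] obtain \<psi> where
      \<psi>: "\<psi> \<in> Arr T" "Dom T \<psi> = Cod T g'" "Cod T \<psi> = Cod T (\<phi> \<star> b')"
      and eq: "\<psi> \<star> g' = \<phi> \<star> b'" by auto
    have [simp]: "\<psi> \<in> Arr T" "Dom T \<psi> = Z'" "Cod T \<psi> = Cod T \<phi>" using \<psi> by simp_all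
    have "\<phi> = \<phi> \<star> (b' \<star> b)" by (simp add: b'b)
    also have "\<dots> = (\<phi> \<star> b') \<star> b" by simp
    also have "\<dots> = \<psi> \<star> (g' \<star> b)" unfolding eq[symmetric] by simp
    also have "\<dots> = (\<psi> \<star> c) \<star> g" unfolding sq(2)[symmetric] by simp
    finally have "(\<psi> \<star> c) \<star> g = \<phi>" by (rule sym)
    moreover have "\<psi> \<star> c \<in> Arr T" "Dom T (\<psi> \<star> c) = Z" "Cod T (\<psi> \<star> c) = Cod T \<phi>" by simp_all
    ultimately show ?thesis by blast
  qed
  then show ?thesis using gf by (simp add: weak_cokernel_def)
qed

section \<open>The shift\<close>

text \<open>
  \<open>f\<close> and \<open>h\<close> are the outer components of a morphism of conflations
  \<open>(i, p) \<rightarrow> (i', p')\<close>. For the conflations \<open>X \<rightarrow> I(X) \<rightarrow> X[1]\<close>, such an \<open>h\<close> represents \<open>f[1]\<close>.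
\<close>

definition induces :: "'a \<Rightarrow> 'a \<Rightarrow> 'a \<Rightarrow> 'a \<Rightarrow> 'a \<Rightarrow> 'a \<Rightarrow> bool" where
  "induces i p i' p' f h \<longleftrightarrow> f \<in> Arr E \<and> Dom E f = Dom E i \<and> Cod E f = Dom E i' \<and>
     h \<in> Arr E \<and> Dom E h = Cod E p \<and> Cod E h = Cod E p' \<and>
     (\<exists>k \<in> Arr E. Dom E k = Cod E i \<and> Cod E k = Cod E i' \<and> k \<cdot> i = i' \<cdot> f \<and> h \<cdot> p = p' \<cdot> k)"

lemma induces_exists:
  assumes c: "(i, p) \<in> Confl E" and c': "(i', p') \<in> Confl E" and J: "injective E (Cod E i')"
    and f: "f \<in> Arr E" "Dom E f = Dom E i" "Cod E f = Dom E i'"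
  obtains h where "induces i p i' p' f h"
proof -
  note [simp] = confl(1-3)[OF c] confl(1-3)[OF c'] f
  obtain k where k [simp]: "k \<in> Arr E" "Dom E k = Dom E p" "Cod E k = Dom E p'" and ki: "k \<cdot> i = i' \<cdot> f"
    using injective_extend[OF J c, of "i' \<cdot> f"] by auto
  have "(p' \<cdot> k) \<cdot> i = p' \<cdot> (k \<cdot> i)" by simp
  also have "\<dots> = (p' \<cdot> i') \<cdot> f" unfolding ki by simp
  also have "\<dots> = Zero E (Dom E i) (Cod E (p' \<cdot> k))" by (simp add: confl(4)[OF c'])
  finally obtain h where "h \<in> Arr E" "Dom E h = Cod E p" "Cod E h = Cod E p'" "h \<cdot> p = p' \<cdot> k"
    by (rule cokernel_factor[OF confl_cokernel[OF c], rotated 2]) simp_all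
  then have "induces i p i' p' f h" unfolding induces_def using ki by (auto intro!: bexI[of _ k])
  then show ?thesis by (rule that)
qed

text \<open>
  Two extensions \<open>k, k'\<close> of stably equal arrows differ by \<open>i' \<circ> b + t \<circ> p\<close>, where \<open>b\<close> comes from
  extending the null arrow \<open>f' - f\<close> along \<open>i\<close>. The first summand dies in the cokernel, and the
  second contributes \<open>p' \<circ> t\<close>, which factors through an injective object.
\<close>

lemma induces_unique:
  assumes c: "(i, p) \<in> Confl E" and c': "(i', p') \<in> Confl E" and J: "injective E (Cod E i')"
    and h: "induces i p i' p' f h" and h': "induces i p i' p' f' h'" and eq: "stable_eq E f f'"
  shows "stable_eq E h h'"
proof -
  note [simp] = confl(1-3)[OF c] confl(1-3)[OF c']
  obtain k where k [simp]: "k \<in> Arr E" "Dom E k = Dom E p" "Cod E k = Dom E p'"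
    and ki: "k \<cdot> i = i' \<cdot> f" and hp: "h \<cdot> p = p' \<cdot> k" using h by (auto simp: induces_def)
  obtain k' where k' [simp]: "k' \<in> Arr E" "Dom E k' = Dom E p" "Cod E k' = Dom E p'"
    and ki': "k' \<cdot> i = i' \<cdot> f'" and hp': "h' \<cdot> p = p' \<cdot> k'" using h' by (auto simp: induces_def)
  have [simp]: "f \<in> Arr E" "Dom E f = Dom E i" "Cod E f = Dom E i'"
     "f' \<in> Arr E" "Dom E f' = Dom E i" "Cod E f' = Dom E i'"
     "h \<in> Arr E" "Dom E h = Cod E p" "Cod E h = Cod E p'"
     "h' \<in> Arr E" "Dom E h' = Cod E p" "Cod E h' = Cod E p'"
    using h h' by (simp_all add: induces_def)
  have "null (f' \<ominus> f)" using eq by (simp add: stable_eq_iff)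
  then obtain b where b [simp]: "b \<in> Arr E" "Dom E b = Dom E p" "Cod E b = Dom E i'"
    and bi: "b \<cdot> i = f' \<ominus> f" using null_extend[OF _ c, of "f' \<ominus> f"] by auto
  have "(k' \<ominus> k) \<cdot> i = i' \<cdot> (f' \<ominus> f)" by (simp add: diff_comp comp_diff ki ki')
  then have "((k' \<ominus> k) \<ominus> (i' \<cdot> b)) \<cdot> i = Zero E (Dom E i) (Cod E ((k' \<ominus> k) \<ominus> (i' \<cdot> b)))"
    by (simp add: diff_comp bi diff_self)
  then obtain t where t [simp]: "t \<in> Arr E" "Dom E t = Cod E p" "Cod E t = Dom E p'"
    and tp: "t \<cdot> p = (k' \<ominus> k) \<ominus> (i' \<cdot> b)"
    using cokernel_factor[OF confl_cokernel[OF c], of "(k' \<ominus> k) \<ominus> (i' \<cdot> b)"] by auto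
  have pib: "p' \<cdot> (i' \<cdot> b) = Zero E (Dom E p) (Cod E p')"
    using assoc[of b i' p'] by (simp add: confl(4)[OF c'])
  have "(p' \<cdot> t) \<cdot> p = p' \<cdot> (t \<cdot> p)" by simp
  also have "\<dots> = (p' \<cdot> (k' \<ominus> k)) \<ominus> Zero E (Dom E p) (Cod E p')"
    unfolding tp by (subst comp_diff) (simp_all add: pib)
  also have "\<dots> = (h' \<ominus> h) \<cdot> p"
    by (simp add: comp_diff diff_comp hp hp')
  finally have "p' \<cdot> t = h' \<ominus> h"
    by - (rule cokernel_epi[OF confl_cokernel[OF c], of "p' \<cdot> t"], simp_all)
  moreover have "null (p' \<cdot> t)" using J by (intro null_through_injective[of "Dom E p'"]) simp_all
  ultimately show ?thesis by (simp add: stable_eq_iff)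
qed

lemma induces_ident:
  assumes c: "(i, p) \<in> Confl E" shows "induces i p i p (Ident E (Dom E i)) (Ident E (Cod E p))"
  using confl(1-3)[OF c] by (auto simp: induces_def intro!: bexI[of _ "Ident E (Cod E i)"])

lemma induces_comp:
  assumes c: "(i, p) \<in> Confl E" and c': "(i', p') \<in> Confl E" and c'': "(i'', p'') \<in> Confl E"
    and h: "induces i p i' p' f h" and h': "induces i' p' i'' p'' f' h'"
  shows "induces i p i'' p'' (f' \<cdot> f) (h' \<cdot> h)"
proof -
  note [simp] = confl(1-3)[OF c] confl(1-3)[OF c'] confl(1-3)[OF c'']
  obtain k where k [simp]: "k \<in> Arr E" "Dom E k = Dom E p" "Cod E k = Dom E p'"
    and ki: "k \<cdot> i = i' \<cdot> f" and hp: "h \<cdot> p = p' \<cdot> k" using h by (auto simp: induces_def)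
  obtain k' where k' [simp]: "k' \<in> Arr E" "Dom E k' = Dom E p'" "Cod E k' = Dom E p''"
    and ki': "k' \<cdot> i' = i'' \<cdot> f'" and hp': "h' \<cdot> p' = p'' \<cdot> k'" using h' by (auto simp: induces_def)
  have [simp]: "f \<in> Arr E" "Dom E f = Dom E i" "Cod E f = Dom E i'"
     "f' \<in> Arr E" "Dom E f' = Dom E i'" "Cod E f' = Dom E i''"
     "h \<in> Arr E" "Dom E h = Cod E p" "Cod E h = Cod E p'"
     "h' \<in> Arr E" "Dom E h' = Cod E p'" "Cod E h' = Cod E p''"
    using h h' by (simp_all add: induces_def)
  have "(k' \<cdot> k) \<cdot> i = (k' \<cdot> i') \<cdot> f" by (simp add: ki)
  then have "(k' \<cdot> k) \<cdot> i = i'' \<cdot> (f' \<cdot> f)" unfolding ki' by simp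
  moreover have "(h' \<cdot> h) \<cdot> p = (h' \<cdot> p') \<cdot> k" by (simp add: hp)
  then have "(h' \<cdot> h) \<cdot> p = p'' \<cdot> (k' \<cdot> k)" unfolding hp' by simp
  ultimately show ?thesis unfolding induces_def by (auto intro!: bexI[of _ "k' \<cdot> k"])
qed

lemma isomorphic_TI:
  assumes f: "f \<in> Arr E" "Dom E f = X" "Cod E f = Y" and g: "g \<in> Arr E" "Dom E g = Y" "Cod E g = X"
    and gf: "stable_eq E (g \<cdot> f) (Ident E X)" and fg: "stable_eq E (f \<cdot> g) (Ident E Y)"
  shows "isomorphic T X Y"
proof -
  have "X \<in> Ob E" "Y \<in> Ob E" using f by auto
  then have "is_iso T (cl f)"
    using assms by (intro T.is_isoI[of _ X Y "cl g"]) (auto simp: Hom_def Ident_T cl_eq_iff)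
  moreover have "cl f \<in> Hom T X Y" using f by (simp add: Hom_def)
  ultimately show ?thesis unfolding isomorphic_def by blast
qed

text \<open>
  Schanuel's lemma: \<open>X[1]\<close> can be computed from any inflation of \<open>X\<close> into an injective object.
\<close>

lemma cokernels_isomorphic:
  assumes c: "(i, p) \<in> Confl E" and c': "(i', p') \<in> Confl E" and "Dom E i' = Dom E i"
    and J: "injective E (Cod E i)" and J': "injective E (Cod E i')"
  shows "isomorphic T (Cod E p) (Cod E p')"
proof -
  note [simp] = confl(1-3)[OF c] confl(1-3)[OF c'] assms(3)
  have X [simp]: "Dom E i \<in> Ob E" by simp
  obtain h where h: "induces i p i' p' (Ident E (Dom E i)) h"
    by (rule induces_exists[OF c c' J', of "Ident E (Dom E i)"]) simp_all
  obtain h' where h': "induces i' p' i p (Ident E (Dom E i)) h'"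
    by (rule induces_exists[OF c' c J, of "Ident E (Dom E i)"]) simp_all
  have eq: "stable_eq E (Ident E (Dom E i) \<cdot> Ident E (Dom E i)) (Ident E (Dom E i))"
    by (simp add: stable_eq_refl)
  have "stable_eq E (h' \<cdot> h) (Ident E (Cod E p))"
    by (rule induces_unique[OF c c J induces_comp[OF c c' c h h'] induces_ident[OF c] eq])
  moreover have "induces i' p' i' p' (Ident E (Dom E i)) (Ident E (Cod E p'))"
    using induces_ident[OF c'] by simp
  from induces_unique[OF c' c' J' induces_comp[OF c' c c' h' h] this eq]
  have "stable_eq E (h \<cdot> h') (Ident E (Cod E p'))" .
  ultimately show ?thesis using h h' by (intro isomorphic_TI) (simp_all add: induces_def)
qed

abbreviation "susp_rep X Y \<equiv> induces (inc E X) (prj E X) (inc E Y) (prj E Y)"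

lemma susp_arr_eq:
  assumes f: "f \<in> Arr E" and h: "susp_rep (Dom E f) (Cod E f) f h"
  shows "susp_arr E (cl f) = cl h"
proof -
  have X [simp]: "Dom E f \<in> Ob E" "Cod E f \<in> Ob E" using f by auto
  note c = inc_prj_confl[OF X(1)] inc_prj_confl[OF X(2)]
  have J: "injective E (Cod E (inc E (Cod E f)))" using f by (simp add: hull_injective)
  show ?thesis
  proof (intro equalityI subsetI)
    fix h' assume "h' \<in> susp_arr E (cl f)"
    then obtain f' k h'' where f': "f' \<in> cl f" and k: "k \<in> Hom E (hull E (Dom E f')) (hull E (Cod E f'))"
      and h'': "h'' \<in> Hom E (susp E (Dom E f')) (susp E (Cod E f'))"
      and sq: "k \<cdot> inc E (Dom E f') = inc E (Cod E f') \<cdot> f'" "h'' \<cdot> prj E (Dom E f') = prj E (Cod E f') \<cdot> k"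
      and eq: "stable_eq E h'' h'" unfolding susp_arr_def by blast
    have f'': "stable_eq E f f'" "f' \<in> Arr E" "Dom E f' = Dom E f" "Cod E f' = Cod E f"
      using f' by (simp_all add: mem_cl stable_eq_iff)
    then have "susp_rep (Dom E f) (Cod E f) f' h''"
      using k h'' sq by (auto simp: induces_def Hom_def)
    then have "stable_eq E h h''" by (rule induces_unique[OF c J h _ f''(1)])
    then show "h' \<in> cl h" using eq unfolding mem_cl by (rule stable_eq_trans)
  next
    fix h' assume h': "h' \<in> cl h"
    obtain k where "k \<in> Hom E (hull E (Dom E f)) (hull E (Cod E f))"
      and "k \<cdot> inc E (Dom E f) = inc E (Cod E f) \<cdot> f" "h \<cdot> prj E (Dom E f) = prj E (Cod E f) \<cdot> k"
      using h X by (auto simp: induces_def Hom_def)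
    moreover have "h \<in> Hom E (susp E (Dom E f)) (susp E (Cod E f))"
      using h X by (simp add: induces_def Hom_def)
    moreover have "f \<in> cl f" using f by (simp add: mem_cl stable_eq_refl)
    moreover have "stable_eq E h h'" using h' by (simp add: mem_cl)
    ultimately show "h' \<in> susp_arr E (cl f)" unfolding susp_arr_def by blast
  qed
qed

lemma susp_rep_exists:
  assumes "f \<in> Arr E" obtains h where "susp_rep (Dom E f) (Cod E f) f h"
proof -
  have X [simp]: "Dom E f \<in> Ob E" "Cod E f \<in> Ob E" using assms by auto
  show ?thesis by (rule induces_exists[OF inc_prj_confl[OF X(1)] inc_prj_confl[OF X(2)], of f])
    (use assms that in \<open>simp_all add: hull_injective\<close>)
qed

lemma susp_rep:
  assumes h: "susp_rep X Y f h" and "X \<in> Ob E" "Y \<in> Ob E"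
  shows "h \<in> Arr E" "Dom E h = susp E X" "Cod E h = susp E Y" "f \<in> Arr E" "Dom E f = X" "Cod E f = Y"
  using assms by (simp_all add: induces_def)

lemma susp_arr_E:
  assumes "A \<in> Arr T"
  obtains f h where "f \<in> Arr E" "A = cl f" "Dom E f = Dom T A" "Cod E f = Cod T A"
    "susp_rep (Dom T A) (Cod T A) f h" "susp_arr E A = cl h"
    "h \<in> Arr E" "Dom E h = susp E (Dom T A)" "Cod E h = susp E (Cod T A)"
proof -
  obtain f where f: "f \<in> Arr E" "A = cl f" "Dom T A = Dom E f" "Cod T A = Cod E f"
    using assms by (rule arr_T_E)
  obtain h where h: "susp_rep (Dom E f) (Cod E f) f h" using f(1) by (rule susp_rep_exists)
  show ?thesis using that[of f h] f h susp_arr_eq[OF f(1) h] susp_rep[OF h] by simp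
qed

lemma susp_arr [simp]:
  assumes "A \<in> Arr T"
  shows "susp_arr E A \<in> Arr T" "Dom T (susp_arr E A) = susp E (Dom T A)"
    "Cod T (susp_arr E A) = susp E (Cod T A)"
  using susp_arr_E[OF assms] cl by metis+

lemma susp_ident: assumes "X \<in> Ob E" shows "susp_arr E (Ident T X) = Ident T (susp E X)"
  using susp_arr_eq[of "Ident E X" "Ident E (susp E X)"] induces_ident[OF inc_prj_confl[OF assms]] assms
  by (simp add: Ident_T)

lemma susp_comp:
  assumes "A \<in> Arr T" "B \<in> Arr T" "Dom T B = Cod T A"
  shows "susp_arr E (B \<star> A) = susp_arr E B \<star> susp_arr E A"
proof -
  obtain f h where f: "f \<in> Arr E" "A = cl f" "Dom E f = Dom T A" "Cod E f = Cod T A"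
    "susp_rep (Dom T A) (Cod T A) f h" "susp_arr E A = cl h"
    "h \<in> Arr E" "Dom E h = susp E (Dom T A)" "Cod E h = susp E (Cod T A)"
    using assms(1) by (rule susp_arr_E)
  obtain g k where g: "g \<in> Arr E" "B = cl g" "Dom E g = Dom T B" "Cod E g = Cod T B"
    "susp_rep (Dom T B) (Cod T B) g k" "susp_arr E B = cl k"
    "k \<in> Arr E" "Dom E k = susp E (Dom T B)" "Cod E k = susp E (Cod T B)"
    using assms(2) by (rule susp_arr_E)
  have X: "Dom T A \<in> Ob E" "Cod T A \<in> Ob E" "Cod T B \<in> Ob E"
    using T.dom_cod[OF assms(1)] T.dom_cod[OF assms(2)] by simp_all
  have "susp_rep (Dom T A) (Cod T B) (g \<cdot> f) (k \<cdot> h)"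
    using induces_comp[OF inc_prj_confl[OF X(1)] inc_prj_confl[OF X(2)] inc_prj_confl[OF X(3)] f(5)]
      g(5) assms(3) by simp
  then have "susp_arr E (cl (g \<cdot> f)) = cl (k \<cdot> h)"
    using f(1,3,4) g(1,3,4) assms(3) by (intro susp_arr_eq) simp_all
  moreover have "B \<star> A = cl (g \<cdot> f)" unfolding f(2) g(2) using f(1,3,4) g(1,3,4) assms(3) by simp
  moreover have "cl k \<star> cl h = cl (k \<cdot> h)" using f(7-) g(7-) assms(3) by simp
  ultimately show ?thesis unfolding f(6) g(6) by simp
qed

lemma susp_zero: assumes "X \<in> Ob E" "Y \<in> Ob E"
  shows "susp_arr E (Zero T X Y) = Zero T (susp E X) (susp E Y)"
proof -
  have "susp_rep X Y (Zero E X Y) (Zero E (susp E X) (susp E Y))"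
    using assms by (auto simp: induces_def intro!: bexI[of _ "Zero E (hull E X) (hull E Y)"])
  then show ?thesis using susp_arr_eq[of "Zero E X Y"] assms by (simp add: Zero_T)
qed

text \<open>
  If \<open>h = f[1]\<close> is null, it lifts to \<open>t : X[1] \<rightarrow> I(Y)\<close>. Then \<open>k - t \<circ> prj\<close> takes values in the
  kernel \<open>Y\<close> of \<open>I(Y) \<rightarrow> Y[1]\<close> and still extends \<open>f\<close>, so \<open>f\<close> factors through \<open>I(X)\<close>.
\<close>

lemma susp_faithful:
  assumes A: "A \<in> Arr T" and 0: "susp_arr E A = Zero T (susp E (Dom T A)) (susp E (Cod T A))"
  shows "A = Zero T (Dom T A) (Cod T A)"
proof -
  have X [simp]: "Dom T A \<in> Ob E" "Cod T A \<in> Ob E" using T.dom_cod[OF A] by simp_all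
  note c = inc_prj_confl[OF X(1)] inc_prj_confl[OF X(2)]
  obtain f h where f: "f \<in> Arr E" "A = cl f" "Dom E f = Dom T A" "Cod E f = Cod T A"
    "susp_rep (Dom T A) (Cod T A) f h" "susp_arr E A = cl h"
    "h \<in> Arr E" "Dom E h = susp E (Dom T A)" "Cod E h = susp E (Cod T A)"
    using A by (rule susp_arr_E)
  note [simp] = f(1,3,4,7-9)
  obtain k where k [simp]: "k \<in> Arr E" "Dom E k = hull E (Dom T A)" "Cod E k = hull E (Cod T A)"
    and ki: "k \<cdot> inc E (Dom T A) = inc E (Cod T A) \<cdot> f" and hp: "h \<cdot> prj E (Dom T A) = prj E (Cod T A) \<cdot> k"
    using f(5) by (auto simp: induces_def)
  have "null h" using 0 f(6) cl_eq_zero_iff[of h] by simp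
  then obtain t where t [simp]: "t \<in> Arr E" "Dom E t = susp E (Dom T A)" "Cod E t = hull E (Cod T A)"
    and ht: "prj E (Cod T A) \<cdot> t = h" using null_lift[OF _ c(2), of h] by auto
  have "prj E (Cod T A) \<cdot> (k \<ominus> (t \<cdot> prj E (Dom T A))) = (h \<cdot> prj E (Dom T A)) \<ominus> (prj E (Cod T A) \<cdot> (t \<cdot> prj E (Dom T A)))"
    by (simp add: comp_diff hp)
  also have "\<dots> = Zero E (hull E (Dom T A)) (susp E (Cod T A))" unfolding ht[symmetric] by (simp add: diff_self)
  finally obtain e where e [simp]: "e \<in> Arr E" "Dom E e = hull E (Dom T A)" "Cod E e = Cod T A"
    and ie: "inc E (Cod T A) \<cdot> e = k \<ominus> (t \<cdot> prj E (Dom T A))"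
    using kernel_factor[OF confl_kernel[OF c(2)], of "k \<ominus> (t \<cdot> prj E (Dom T A))"] by auto
  have tpi: "t \<cdot> (prj E (Dom T A) \<cdot> inc E (Dom T A)) = Zero E (Dom T A) (hull E (Cod T A))"
    using confl(4)[OF c(1)] by simp
  have "inc E (Cod T A) \<cdot> (e \<cdot> inc E (Dom T A)) = (inc E (Cod T A) \<cdot> e) \<cdot> inc E (Dom T A)" by simp
  also have "\<dots> = (inc E (Cod T A) \<cdot> f) \<ominus> Zero E (Dom T A) (hull E (Cod T A))"
    unfolding ie by (simp add: diff_comp ki tpi)
  also have "\<dots> = inc E (Cod T A) \<cdot> f" by simp
  finally have ef: "e \<cdot> inc E (Dom T A) = f"
    by - (rule kernel_mono[OF confl_kernel[OF c(2)], of "e \<cdot> inc E (Dom T A)" f], simp_all)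
  have "null f" unfolding ef[symmetric]
    by (intro null_through_injective[OF hull_injective[OF X(1)]]) simp_all
  then have "cl f = Zero T (Dom E f) (Cod E f)" using cl_eq_zero_iff[OF f(1)] by blast
  then show ?thesis unfolding f(2)[symmetric] f(3,4) .
qed

text \<open>
  \<open>I(X)\<close> is projective, so \<open>I(X) \<rightarrow> X[1] \<rightarrow> Y[1]\<close> lifts to \<open>I(X) \<rightarrow> I(Y)\<close>; the lift restricts
  to the kernels \<open>X\<close> and \<open>Y\<close>.
\<close>

lemma susp_full:
  assumes B: "B \<in> Arr T" "Dom T B = susp E X" "Cod T B = susp E Y" and X: "X \<in> Ob E" "Y \<in> Ob E"
  obtains A where "A \<in> Arr T" "Dom T A = X" "Cod T A = Y" "susp_arr E A = B"
proof -
  note c = inc_prj_confl[OF X(1)] inc_prj_confl[OF X(2)]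
  note [simp] = X
  obtain h where h: "h \<in> Arr E" "B = cl h" "Dom T B = Dom E h" "Cod T B = Cod E h"
    using B(1) by (rule arr_T_E)
  have [simp]: "h \<in> Arr E" "Dom E h = susp E X" "Cod E h = susp E Y" using h B by auto
  obtain k where k [simp]: "k \<in> Arr E" "Dom E k = hull E X" "Cod E k = hull E Y"
    and pk: "prj E Y \<cdot> k = h \<cdot> prj E X"
    using injective_lift[OF hull_injective[OF X(1)] c(2), of "h \<cdot> prj E X"] by auto
  have "prj E Y \<cdot> (k \<cdot> inc E X) = (prj E Y \<cdot> k) \<cdot> inc E X" by simp
  also have "\<dots> = h \<cdot> (prj E X \<cdot> inc E X)" unfolding pk by simp
  also have "\<dots> = Zero E X (susp E Y)" using confl(4)[OF c(1)] by simp
  finally obtain f where f [simp]: "f \<in> Arr E" "Dom E f = X" "Cod E f = Y" and "inc E Y \<cdot> f = k \<cdot> inc E X"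
    using kernel_factor[OF confl_kernel[OF c(2)], of "k \<cdot> inc E X"] by auto
  then have "susp_rep X Y f h" using pk by (auto simp: induces_def intro!: bexI[of _ k])
  then have "susp_arr E (cl f) = cl h" using susp_arr_eq[of f h] by simp
  then show ?thesis using that[of "cl f"] h(2) by simp
qed

lemma susp_iso: assumes "is_iso T A" shows "is_iso T (susp_arr E A)"
proof -
  have A [simp]: "A \<in> Arr T" using assms by (simp add: is_iso_def)
  obtain B where B [simp]: "B \<in> Arr T" "Dom T B = Cod T A" "Cod T B = Dom T A"
    and BA: "B \<star> A = Ident T (Dom T A)" "A \<star> B = Ident T (Cod T A)"
    using assms by (rule T.iso_inverse)
  have X: "Dom T A \<in> Ob E" "Cod T A \<in> Ob E" using T.dom_cod[OF A] by simp_all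
  have "susp_arr E B \<star> susp_arr E A = Ident T (susp E (Dom T A))"
    "susp_arr E A \<star> susp_arr E B = Ident T (susp E (Cod T A))"
    using X by (simp_all add: susp_comp[symmetric] BA susp_ident)
  then show ?thesis
    by (intro T.is_isoI[of _ "susp E (Dom T A)" "susp E (Cod T A)" "susp_arr E B"]) (simp_all add: Hom_def)
qed

text \<open>
  The kernel of a deflation from a projective object onto \<open>X\<close> is a desuspension of \<open>X\<close>.
\<close>

lemma susp_surj: assumes X: "X \<in> Ob E" obtains Y where "Y \<in> Ob E" "isomorphic T (susp E Y) X"
proof -
  have "\<exists>p. deflation E p \<and> projective E (Dom E p) \<and> Cod E p = X"
    using frobenius X by (auto simp: frobenius_category_def)
  then obtain i p where p: "(i, p) \<in> Confl E" "injective E (Dom E p)" "Cod E p = X"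
    by (auto simp: deflation_def projective_iff_injective)
  have Y: "Dom E i \<in> Ob E" using confl(1)[OF p(1)] by simp
  have "isomorphic T (Cod E (prj E (Dom E i))) (Cod E p)"
    using p Y confl(3)[OF p(1)]
    by (intro cokernels_isomorphic[OF inc_prj_confl[OF Y] p(1)]) (simp_all add: hull_injective)
  then show ?thesis using that[OF Y] p(3) Y by simp
qed

section \<open>Standard triangles and exactness\<close>

lemma stable_eq_diff:
  assumes "f \<in> Arr E" "null n" "Dom E n = Dom E f" "Cod E n = Cod E f"
  shows "stable_eq E (f \<ominus> n) f"
proof -
  note [simp] = assms(1,3,4) null_arr[OF assms(2)]
  have "n \<oplus> (f \<ominus> n) = f" using add_comm[of n "f \<ominus> n"] diff_add[of f n] by simp
  then have "f \<ominus> (f \<ominus> n) = n" using add_diff[of n "f \<ominus> n"] by simp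
  then show ?thesis using assms(2) by (simp add: stable_eq_iff)
qed

lemma pushout_arr:
  assumes "is_pushout E i f i' f'"
  shows "i \<in> Arr E" "f \<in> Arr E" "i' \<in> Arr E" "f' \<in> Arr E" "Dom E f = Dom E i"
    "Dom E f' = Cod E i" "Dom E i' = Cod E f" "Cod E f' = Cod E i'" "i' \<cdot> f = f' \<cdot> i"
  using assms by (simp_all add: is_pushout_def)

lemma pushout_universal:
  assumes "is_pushout E i f i' f'" "g \<in> Arr E" "h \<in> Arr E" "Dom E g = Cod E f" "Dom E h = Cod E i"
    "Cod E h = Cod E g" "g \<cdot> f = h \<cdot> i"
  shows "\<exists>!t. t \<in> Hom E (Cod E i') (Cod E g) \<and> t \<cdot> i' = g \<and> t \<cdot> f' = h"
proof -
  have "g \<in> Hom E (Cod E f) (Cod E g)" "h \<in> Hom E (Cod E i) (Cod E g)"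
    using assms by (simp_all add: Hom_def)
  then show ?thesis using assms(1,7) unfolding is_pushout_def by blast
qed

lemma pushout_factor:
  assumes "is_pushout E i f i' f'" "g \<in> Arr E" "h \<in> Arr E" "Dom E g = Cod E f" "Dom E h = Cod E i"
    "Cod E h = Cod E g" "g \<cdot> f = h \<cdot> i"
  obtains t where "t \<in> Arr E" "Dom E t = Cod E i'" "Cod E t = Cod E g" "t \<cdot> i' = g" "t \<cdot> f' = h"
  using ex1_implies_ex[OF pushout_universal[OF assms]] that by (auto simp only: Hom_def mem_Collect_eq)

lemma pushout_eqI:
  assumes "is_pushout E i f i' f'" "t \<in> Arr E" "t' \<in> Arr E" "Dom E t = Cod E i'" "Dom E t' = Cod E i'"
    "Cod E t' = Cod E t" "t \<cdot> i' = t' \<cdot> i'" "t \<cdot> f' = t' \<cdot> f'"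
  shows "t = t'"
proof -
  note p = pushout_arr[OF assms(1)]
  have "(t \<cdot> i') \<cdot> f = (t \<cdot> f') \<cdot> i" using p assms(2-6) by simp
  then have "\<exists>!s. s \<in> Hom E (Cod E i') (Cod E (t \<cdot> i')) \<and> s \<cdot> i' = t \<cdot> i' \<and> s \<cdot> f' = t \<cdot> f'"
    using p(1-8) assms(2-6) by (intro pushout_universal[OF assms(1)]) simp_all
  moreover have "t \<in> Hom E (Cod E i') (Cod E (t \<cdot> i'))" "t' \<in> Hom E (Cod E i') (Cod E (t \<cdot> i'))"
    using p(1-8) assms(2-6) by (simp_all add: Hom_def)
  ultimately show ?thesis using assms(7,8) by metis
qed

lemma pushout_sym:
  assumes "is_pushout E i f i' f'" shows "is_pushout E f i f' i'"
proof -
  note p = pushout_arr[OF assms]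
  have "\<exists>!t. t \<in> Hom E (Cod E f') Z \<and> t \<cdot> f' = g \<and> t \<cdot> i' = h"
    if "g \<in> Hom E (Cod E i) Z" "h \<in> Hom E (Cod E f) Z" "g \<cdot> i = h \<cdot> f" for Z g h
  proof -
    have "\<exists>!t. t \<in> Hom E (Cod E i') (Cod E h) \<and> t \<cdot> i' = h \<and> t \<cdot> f' = g"
      using that by (intro pushout_universal[OF assms]) (simp_all add: Hom_def)
    then show ?thesis using that(2) p(8) by (auto simp: Hom_def)
  qed
  then show ?thesis unfolding is_pushout_def using p by simp
qed

lemma inflation_pushout:
  assumes "(i, p) \<in> Confl E" "f \<in> Arr E" "Dom E f = Dom E i"
  obtains i' f' where "is_pushout E i f i' f'" "inflation E i'"
proof -
  have *: "\<forall>i f. inflation E i \<longrightarrow> f \<in> Arr E \<longrightarrow> Dom E f = Dom E i \<longrightarrow>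
        (\<exists>i' f'. is_pushout E i f i' f' \<and> inflation E i')"
    using exact unfolding exact_category_def by (elim conjE)
  have "inflation E i" using assms(1) by (auto simp: inflation_def)
  with * assms(2,3) show ?thesis using that by blast
qed

lemma inflation_comp:
  assumes "(i, p) \<in> Confl E" "(j, q) \<in> Confl E" "Dom E j = Cod E i"
  obtains r where "(j \<cdot> i, r) \<in> Confl E"
proof -
  have *: "\<forall>i j. inflation E i \<longrightarrow> inflation E j \<longrightarrow> Cod E i = Dom E j \<longrightarrow> inflation E (j \<cdot> i)"
    using exact unfolding exact_category_def by (elim conjE)
  have "inflation E i" "inflation E j" using assms by (auto simp: inflation_def)
  with * assms(3) have "inflation E (j \<cdot> i)" by simp
  then show ?thesis using that by (auto simp: inflation_def)
qed

lemma confl_iso_closed: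
  assumes "(i, p) \<in> Confl E" "is_iso E a" "is_iso E b" "is_iso E c"
    "a \<in> Hom E (Dom E i) (Dom E i')" "b \<in> Hom E (Cod E i) (Cod E i')" "c \<in> Hom E (Cod E p) (Cod E p')"
    "i' \<in> Arr E" "p' \<in> Hom E (Cod E i') (Cod E p')" "b \<cdot> i = i' \<cdot> a" "c \<cdot> p = p' \<cdot> b"
  shows "(i', p') \<in> Confl E"
proof -
  have "\<forall>i p i' p' a b c. (i, p) \<in> Confl E \<longrightarrow>
        is_iso E a \<longrightarrow> is_iso E b \<longrightarrow> is_iso E c \<longrightarrow>
        a \<in> Hom E (Dom E i) (Dom E i') \<longrightarrow> b \<in> Hom E (Cod E i) (Cod E i') \<longrightarrow>
        c \<in> Hom E (Cod E p) (Cod E p') \<longrightarrow>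
        i' \<in> Arr E \<longrightarrow> p' \<in> Hom E (Cod E i') (Cod E p') \<longrightarrow>
        b \<cdot> i = i' \<cdot> a \<longrightarrow> c \<cdot> p = p' \<cdot> b \<longrightarrow> (i', p') \<in> Confl E"
    using exact unfolding exact_category_def by (elim conjE)
  with assms show ?thesis by blast
qed

text \<open>
  The axioms provide a pushout whose first arrow is an inflation. Any other pushout is
  isomorphic to it, and since conflations are closed under isomorphism its first arrow is an
  inflation as well. Its cokernel is that of \<open>i\<close>.
\<close>

lemma pushout_conflation:
  assumes PO: "is_pushout E i f i' f'" and c: "(i, p) \<in> Confl E"
    and w: "w \<in> Arr E" "Dom E w = Cod E i'" "Cod E w = Cod E p"
    and wi: "w \<cdot> i' = Zero E (Dom E i') (Cod E p)" and wf: "w \<cdot> f' = p"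
  shows "(i', w) \<in> Confl E"
proof -
  note p = pushout_arr[OF PO]
  note [simp] = p(1-8) confl(1-3)[OF c] w
  obtain j g where PO': "is_pushout E i f j g" and "inflation E j"
    by (rule inflation_pushout[OF c p(2,5)])
  then obtain r where r: "(j, r) \<in> Confl E" by (auto simp: inflation_def)
  note p' = pushout_arr[OF PO']
  note [simp] = p'(3,4,6-8) confl(2)[OF r] confl(3)[OF r, symmetric]
  obtain \<theta> where \<theta> [simp]: "\<theta> \<in> Arr E" "Dom E \<theta> = Cod E j" "Cod E \<theta> = Cod E i'"
    and \<theta>j: "\<theta> \<cdot> j = i'" and \<theta>g: "\<theta> \<cdot> g = f'"
    using pushout_factor[OF PO', of i' f'] p(9) by auto
  obtain \<theta>' where \<theta>' [simp]: "\<theta>' \<in> Arr E" "Dom E \<theta>' = Cod E i'" "Cod E \<theta>' = Cod E j"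
    and \<theta>'i: "\<theta>' \<cdot> i' = j" and \<theta>'f: "\<theta>' \<cdot> f' = g"
    using pushout_factor[OF PO, of j g] p'(9) by auto
  have \<theta>'\<theta>: "\<theta>' \<cdot> \<theta> = Ident E (Cod E j)"
    by (rule pushout_eqI[OF PO']) (simp_all add: \<theta>j \<theta>g \<theta>'i \<theta>'f)
  have \<theta>\<theta>': "\<theta> \<cdot> \<theta>' = Ident E (Cod E i')"
    by (rule pushout_eqI[OF PO]) (simp_all add: \<theta>j \<theta>g \<theta>'i \<theta>'f)
  obtain \<zeta> where \<zeta> [simp]: "\<zeta> \<in> Arr E" "Dom E \<zeta> = Cod E r" "Cod E \<zeta> = Cod E p" and \<zeta>r: "\<zeta> \<cdot> r = w \<cdot> \<theta>"
    using cokernel_factor[OF confl_cokernel[OF r], of "w \<cdot> \<theta>"] by (auto simp: \<theta>j wi)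
  have "(r \<cdot> g) \<cdot> i = (r \<cdot> j) \<cdot> f" using p'(9) by simp
  also have "\<dots> = Zero E (Dom E i) (Cod E (r \<cdot> g))" using confl(4)[OF r] by simp
  finally obtain \<xi> where \<xi> [simp]: "\<xi> \<in> Arr E" "Dom E \<xi> = Cod E p" "Cod E \<xi> = Cod E r" and \<xi>p: "\<xi> \<cdot> p = r \<cdot> g"
    using cokernel_factor[OF confl_cokernel[OF c], of "r \<cdot> g"] by auto
  have "(\<xi> \<cdot> w) \<cdot> \<theta> = r"
  proof (rule pushout_eqI[OF PO'])
    show "((\<xi> \<cdot> w) \<cdot> \<theta>) \<cdot> j = r \<cdot> j" using confl(4)[OF r] by (simp add: \<theta>j wi)
    show "((\<xi> \<cdot> w) \<cdot> \<theta>) \<cdot> g = r \<cdot> g" by (simp add: \<theta>g wf \<xi>p)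
  qed simp_all
  then have "\<xi> \<cdot> \<zeta> = Ident E (Cod E r)"
    by - (rule cokernel_epi[OF confl_cokernel[OF r]], simp_all add: \<zeta>r)
  moreover have "\<zeta> \<cdot> (\<xi> \<cdot> p) = (\<zeta> \<cdot> r) \<cdot> g" unfolding \<xi>p by simp
  then have "(\<zeta> \<cdot> \<xi>) \<cdot> p = p" by (simp add: \<zeta>r \<theta>g wf)
  then have "\<zeta> \<cdot> \<xi> = Ident E (Cod E p)"
    by - (rule cokernel_epi[OF confl_cokernel[OF c]], simp_all)
  ultimately have "is_iso E \<zeta>" by (intro is_isoI[of _ "Cod E r" "Cod E p" \<xi>]) (simp_all add: Hom_def)
  moreover have "is_iso E \<theta>"
    using \<theta>'\<theta> \<theta>\<theta>' by (intro is_isoI[of _ "Cod E j" "Cod E i'" \<theta>']) (simp_all add: Hom_def)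
  moreover have "is_iso E (Ident E (Cod E f))" by (simp add: is_iso_ident)
  ultimately show ?thesis
    by (intro confl_iso_closed[OF r, of "Ident E (Cod E f)" \<theta> \<zeta>]) (simp_all add: Hom_def \<theta>j \<zeta>r)
qed

text \<open>
  An arrow that is null on the subobject extends from there to a null arrow; after subtraction of
  this extension the arrow factors through the cokernel. The next lemma is the dual argument.
\<close>

lemma weak_cokernel_confl:
  assumes c: "(i, p) \<in> Confl E" shows "weak_cokernel T (cl p) (cl i)"
  unfolding weak_cokernel_def
proof (intro conjI ballI impI)
  note [simp] = confl(1-3)[OF c]
  show "cl i \<in> Arr T" "cl p \<in> Arr T" "Dom T (cl p) = Cod T (cl i)" by simp_all
  show "cl p \<star> cl i = Zero T (Dom T (cl i)) (Cod T (cl p))" using confl(4)[OF c] by (simp add: Zero_T)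
  fix \<phi> assume \<phi>: "\<phi> \<in> Arr T" and dom: "Dom T \<phi> = Cod T (cl i)"
    and 0: "\<phi> \<star> cl i = Zero T (Dom T (cl i)) (Cod T \<phi>)"
  obtain f where f: "f \<in> Arr E" "\<phi> = cl f" "Dom T \<phi> = Dom E f" "Cod T \<phi> = Cod E f" using \<phi> by (rule arr_T_E)
  have [simp]: "f \<in> Arr E" "Dom E f = Dom E p" using f dom by simp_all
  have "null (f \<cdot> i)" using 0 cl_eq_zero_iff[of "f \<cdot> i"] unfolding f(2) by simp
  then obtain t where t [simp]: "t \<in> Arr E" "Dom E t = Cod E (inc E (Dom E i))" "Cod E t = Cod E f"
    and ti: "t \<cdot> inc E (Dom E i) = f \<cdot> i" using null_extend[OF _ inc_prj_confl, of "f \<cdot> i" "Dom E i"] by auto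
  obtain e where e [simp]: "e \<in> Arr E" "Dom E e = Dom E p" "Cod E e = hull E (Dom E i)" and ei: "e \<cdot> i = inc E (Dom E i)"
    using injective_extend[OF hull_injective c, of "Dom E i" "inc E (Dom E i)"] by auto
  have te [simp]: "Dom E t = hull E (Dom E i)" by simp
  have "(f \<ominus> (t \<cdot> e)) \<cdot> i = Zero E (Dom E i) (Cod E (f \<ominus> (t \<cdot> e)))"
    by (simp add: diff_comp ei ti diff_self)
  then obtain g where g [simp]: "g \<in> Arr E" "Dom E g = Cod E p" "Cod E g = Cod E f" and gp: "g \<cdot> p = f \<ominus> (t \<cdot> e)"
    using cokernel_factor[OF confl_cokernel[OF c], of "f \<ominus> (t \<cdot> e)"] by auto
  have "null (t \<cdot> e)" by (rule null_through_injective[OF hull_injective[of "Dom E i"]]) simp_all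
  then have "stable_eq E (g \<cdot> p) f" unfolding gp by (intro stable_eq_diff) simp_all
  then have "cl g \<star> cl p = \<phi>" unfolding f(2) by (simp add: cl_eq_iff)
  then show "\<exists>\<psi> \<in> Arr T. Dom T \<psi> = Cod T (cl p) \<and> Cod T \<psi> = Cod T \<phi> \<and> \<psi> \<star> cl p = \<phi>"
    using f(4) by (intro bexI[of _ "cl g"]) simp_all
qed

lemma confl_lift_T:
  assumes c: "(i, p) \<in> Confl E" and \<phi>: "\<phi> \<in> Arr T" "Cod T \<phi> = Dom E p"
    and 0: "cl p \<star> \<phi> = Zero T (Dom T \<phi>) (Cod E p)"
  obtains \<psi> where "\<psi> \<in> Arr T" "Dom T \<psi> = Dom T \<phi>" "Cod T \<psi> = Dom E i" "cl i \<star> \<psi> = \<phi>"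
proof -
  note [simp] = confl(1-3)[OF c]
  obtain f where f: "f \<in> Arr E" "\<phi> = cl f" "Dom T \<phi> = Dom E f" "Cod T \<phi> = Cod E f" using \<phi>(1) by (rule arr_T_E)
  have [simp]: "f \<in> Arr E" "Cod E f = Dom E p" using f \<phi> by simp_all
  have "null (p \<cdot> f)" using 0 cl_eq_zero_iff[of "p \<cdot> f"] unfolding f(2) by simp
  then obtain b where b [simp]: "b \<in> Arr E" "Dom E b = hull E (Dom E f)" "Cod E b = Cod E p"
    and bi: "b \<cdot> inc E (Dom E f) = p \<cdot> f" using null_factor[of "p \<cdot> f"] by auto
  obtain e where e [simp]: "e \<in> Arr E" "Dom E e = hull E (Dom E f)" "Cod E e = Dom E p" and pe: "p \<cdot> e = b"
    using injective_lift[OF hull_injective c, of "Dom E f" b] by auto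
  have "(p \<cdot> e) \<cdot> inc E (Dom E f) = p \<cdot> f" unfolding pe by (rule bi)
  then have "p \<cdot> (f \<ominus> (e \<cdot> inc E (Dom E f))) = Zero E (Dom E (f \<ominus> (e \<cdot> inc E (Dom E f)))) (Cod E p)"
    by (simp add: comp_diff diff_self)
  then obtain g where g [simp]: "g \<in> Arr E" "Dom E g = Dom E f" "Cod E g = Dom E i"
    and ig: "i \<cdot> g = f \<ominus> (e \<cdot> inc E (Dom E f))"
    using kernel_factor[OF confl_kernel[OF c], of "f \<ominus> (e \<cdot> inc E (Dom E f))"] by auto
  have "null (e \<cdot> inc E (Dom E f))" by (rule null_through_injective[OF hull_injective[of "Dom E f"]]) simp_all
  then have "stable_eq E (i \<cdot> g) f" unfolding ig by (intro stable_eq_diff) simp_all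
  then have "cl i \<star> cl g = \<phi>" unfolding f(2) by (simp add: cl_eq_iff)
  then show ?thesis using that[of "cl g"] f(3) by simp
qed

text \<open>
  The representing arrows of a standard triangle, with the pushout arrow \<open>q : I(X) \<rightarrow> C\<close> as an
  explicit argument: the proofs of exactness use the universal property of the pushout.
\<close>

definition std_triangle :: "'a \<Rightarrow> 'a \<Rightarrow> 'a \<Rightarrow> 'a \<Rightarrow> bool" where
  "std_triangle u v w q \<longleftrightarrow> u \<in> Arr E \<and> is_pushout E (inc E (Dom E u)) u v q \<and>
     w \<in> Hom E (Cod E v) (susp E (Dom E u)) \<and>
     w \<cdot> v = Zero E (Cod E u) (susp E (Dom E u)) \<and> w \<cdot> q = prj E (Dom E u)"

lemma std_triangle:
  assumes "std_triangle u v w q"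
  shows "u \<in> Arr E" "is_pushout E (inc E (Dom E u)) u v q" "w \<in> Arr E" "Dom E w = Cod E v"
    "Cod E w = susp E (Dom E u)" "w \<cdot> v = Zero E (Cod E u) (susp E (Dom E u))" "w \<cdot> q = prj E (Dom E u)"
    "Dom E v = Cod E u" "v \<in> Arr E" "q \<in> Arr E" "Dom E q = hull E (Dom E u)" "Cod E q = Cod E v"
    "v \<cdot> u = q \<cdot> inc E (Dom E u)"
  using assms pushout_arr[of "inc E (Dom E u)" u v q] by (auto simp: std_triangle_def Hom_def)

lemma standard_exists:
  assumes u: "u \<in> Arr E" obtains v w q where "std_triangle u v w q"
proof -
  have X [simp]: "Dom E u \<in> Ob E" "Cod E u \<in> Ob E" using u by simp_all
  obtain v q where PO: "is_pushout E (inc E (Dom E u)) u v q"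
    by (rule inflation_pushout[OF inc_prj_confl[OF X(1)] u]) simp_all
  have "prj E (Dom E u) \<cdot> inc E (Dom E u) = Zero E (Dom E u) (susp E (Dom E u))"
    using confl(4)[OF inc_prj_confl[OF X(1)]] by simp
  then obtain w where "w \<in> Arr E" "Dom E w = Cod E v" "Cod E w = susp E (Dom E u)"
    "w \<cdot> v = Zero E (Cod E u) (susp E (Dom E u))" "w \<cdot> q = prj E (Dom E u)"
    using pushout_factor[OF PO, of "Zero E (Cod E u) (susp E (Dom E u))" "prj E (Dom E u)"] u by auto
  then have "std_triangle u v w q" using u PO by (simp add: std_triangle_def Hom_def)
  then show ?thesis by (rule that)
qed

text \<open>
  \<open>Y \<rightarrow> C \<rightarrow> X[1]\<close> is the pushout of the conflation \<open>X \<rightarrow> I(X) \<rightarrow> X[1]\<close>, so that exactness at \<open>C\<close>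
  is exactness of a conflation.
\<close>

lemma standard_confl: assumes "std_triangle u v w q" shows "(v, w) \<in> Confl E"
proof -
  note s = std_triangle[OF assms]
  have X: "Dom E u \<in> Ob E" using s(1) by simp
  show ?thesis using s X by (intro pushout_conflation[OF s(2) inc_prj_confl[OF X]]) simp_all
qed

lemma standard_weak_cokernel1:
  assumes "std_triangle u v w q" shows "weak_cokernel T (cl v) (cl u)"
  unfolding weak_cokernel_def
proof (intro conjI ballI impI)
  note s = std_triangle[OF assms]
  have X [simp]: "Dom E u \<in> Ob E" using s(1) by simp
  note [simp] = s(1,3-5,8-12)
  show "cl u \<in> Arr T" "cl v \<in> Arr T" "Dom T (cl v) = Cod T (cl u)" by simp_all
  have "null (q \<cdot> inc E (Dom E u))" by (rule null_through_injective[OF hull_injective[OF X]]) simp_all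
  then show "cl v \<star> cl u = Zero T (Dom T (cl u)) (Cod T (cl v))"
    using cl_eq_zero_iff[of "v \<cdot> u"] s(13) by simp
  fix \<phi> assume \<phi>: "\<phi> \<in> Arr T" and dom: "Dom T \<phi> = Cod T (cl u)"
    and 0: "\<phi> \<star> cl u = Zero T (Dom T (cl u)) (Cod T \<phi>)"
  obtain f where f: "f \<in> Arr E" "\<phi> = cl f" "Dom T \<phi> = Dom E f" "Cod T \<phi> = Cod E f" using \<phi> by (rule arr_T_E)
  have [simp]: "f \<in> Arr E" "Dom E f = Cod E u" using f dom by simp_all
  have "null (f \<cdot> u)" using 0 cl_eq_zero_iff[of "f \<cdot> u"] unfolding f(2) by simp
  then obtain b where b [simp]: "b \<in> Arr E" "Dom E b = hull E (Dom E u)" "Cod E b = Cod E f"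
    and bi: "b \<cdot> inc E (Dom E u) = f \<cdot> u" using null_factor[of "f \<cdot> u"] by auto
  obtain t where t [simp]: "t \<in> Arr E" "Dom E t = Cod E v" "Cod E t = Cod E f" and tv: "t \<cdot> v = f"
    using pushout_factor[OF s(2), of f b] bi by auto
  have "cl t \<star> cl v = \<phi>" unfolding f(2) by (simp add: tv)
  then show "\<exists>\<psi> \<in> Arr T. Dom T \<psi> = Cod T (cl v) \<and> Cod T \<psi> = Cod T \<phi> \<and> \<psi> \<star> cl v = \<phi>"
    using f(4) by (intro bexI[of _ "cl t"]) simp_all
qed

text \<open>
  Exactness at \<open>X[1]\<close>. Composing \<open>Y \<rightarrow> C\<close> with \<open>C \<rightarrow> I(C)\<close> gives an inflation with some
  cokernel \<open>r\<close>. An arrow \<open>f : X[1] \<rightarrow> W\<close> that is null on \<open>C\<close> factors as \<open>b' \<circ> \<zeta>\<close>, where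
  \<open>\<zeta> : C / Y \<rightarrow> I(C) / Y\<close>. Since \<open>I(C)\<close> is injective, \<open>I(C) / Y\<close> receives a comparison arrow \<open>\<delta>\<close>
  from \<open>Y[1]\<close>, and \<open>\<zeta>\<close> agrees stably with \<open>\<delta> \<circ> u[1]\<close>: their difference on \<open>I(X)\<close> is
  computed by an arrow into \<open>I(C)\<close> that kills \<open>X\<close>.
\<close>

lemma standard_weak_cokernel3:
  assumes "std_triangle u v w q" shows "weak_cokernel T (susp_arr E (cl u)) (cl w)"
  unfolding weak_cokernel_def
proof (intro conjI ballI impI)
  define X Y C where "X = Dom E u" and "Y = Cod E u" and "C = Cod E v"
  note s = std_triangle[OF assms, folded X_def Y_def C_def]
  have ob [simp]: "X \<in> Ob E" "Y \<in> Ob E" "C \<in> Ob E" using s(1,9) by (simp_all add: X_def Y_def C_def)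
  note [simp] = s(1,3-5,8-12) X_def[symmetric] Y_def[symmetric] C_def[symmetric]
  have vw: "(v, w) \<in> Confl E" using assms by (rule standard_confl)
  have pi: "prj E X \<cdot> inc E X = Zero E X (susp E X)" "prj E Y \<cdot> inc E Y = Zero E Y (susp E Y)"
    using confl(4)[OF inc_prj_confl[OF ob(1)]] confl(4)[OF inc_prj_confl[OF ob(2)]] by simp_all
  obtain h where h: "susp_rep X Y u h" using susp_rep_exists[OF s(1)] by auto
  have susp_u: "susp_arr E (cl u) = cl h" using susp_arr_eq[OF s(1)] h by simp
  note [simp] = susp_rep[OF h]
  obtain k where k [simp]: "k \<in> Arr E" "Dom E k = hull E X" "Cod E k = hull E Y"
    and ki: "k \<cdot> inc E X = inc E Y \<cdot> u" and hp: "h \<cdot> prj E X = prj E Y \<cdot> k"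
    using h by (auto simp: induces_def)
  show "cl w \<in> Arr T" "susp_arr E (cl u) \<in> Arr T" "Dom T (susp_arr E (cl u)) = Cod T (cl w)" by simp_all
  \<comment> \<open>\<open>u[1] \<circ> w\<close> is null because it factors through \<open>m : C \<rightarrow> I(Y)\<close>, given on the pushout by \<open>Y \<rightarrow> I(Y)\<close> and \<open>k\<close>\<close>
  obtain m where m [simp]: "m \<in> Arr E" "Dom E m = C" "Cod E m = hull E Y" and mv: "m \<cdot> v = inc E Y" and mq: "m \<cdot> q = k"
    using pushout_factor[OF s(2), of "inc E Y" k] ki by auto
  have "prj E Y \<cdot> m = h \<cdot> w"
    by (rule pushout_eqI[OF s(2)]) (simp_all add: mv mq s(6,7) pi hp)
  moreover have "null (prj E Y \<cdot> m)" by (rule null_through_injective[OF hull_injective[OF ob(2)]]) simp_all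
  ultimately show "susp_arr E (cl u) \<star> cl w = Zero T (Dom T (cl w)) (Cod T (susp_arr E (cl u)))"
    using cl_eq_zero_iff[of "h \<cdot> w"] unfolding susp_u by simp
  fix \<phi> assume \<phi>: "\<phi> \<in> Arr T" and dom: "Dom T \<phi> = Cod T (cl w)"
    and 0: "\<phi> \<star> cl w = Zero T (Dom T (cl w)) (Cod T \<phi>)"
  obtain f where f: "f \<in> Arr E" "\<phi> = cl f" "Dom T \<phi> = Dom E f" "Cod T \<phi> = Cod E f" using \<phi> by (rule arr_T_E)
  have [simp]: "f \<in> Arr E" "Dom E f = susp E X" using f dom by simp_all
  have "null (f \<cdot> w)" using 0 cl_eq_zero_iff[of "f \<cdot> w"] unfolding f(2) by simp
  then obtain b where b [simp]: "b \<in> Arr E" "Dom E b = hull E C" "Cod E b = Cod E f"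
    and bi: "b \<cdot> inc E C = f \<cdot> w" using null_factor[of "f \<cdot> w"] by auto
  \<comment> \<open>\<open>r\<close> is the projection \<open>I(C) \<rightarrow> I(C) / Y\<close>\<close>
  obtain r where r: "(inc E C \<cdot> v, r) \<in> Confl E"
    by (rule inflation_comp[OF vw inc_prj_confl[OF ob(3)]]) simp_all
  have r_arr [simp]: "r \<in> Arr E" "Dom E r = hull E C" using confl(2,3)[OF r] by simp_all
  have riv: "r \<cdot> (inc E C \<cdot> v) = Zero E Y (Cod E r)" using confl(4)[OF r] by simp
  have "b \<cdot> (inc E C \<cdot> v) = (b \<cdot> inc E C) \<cdot> v" by simp
  also have "\<dots> = Zero E Y (Cod E f)" unfolding bi by (simp add: s(6))
  finally obtain b' where b' [simp]: "b' \<in> Arr E" "Dom E b' = Cod E r" "Cod E b' = Cod E f" and b'r: "b' \<cdot> r = b"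
    using cokernel_factor[OF confl_cokernel[OF r], of b] by auto
  obtain \<zeta> where \<zeta> [simp]: "\<zeta> \<in> Arr E" "Dom E \<zeta> = susp E X" "Cod E \<zeta> = Cod E r" and \<zeta>w: "\<zeta> \<cdot> w = r \<cdot> inc E C"
    using cokernel_factor[OF confl_cokernel[OF vw], of "r \<cdot> inc E C"] riv by auto
  have "(b' \<cdot> \<zeta>) \<cdot> w = (b' \<cdot> r) \<cdot> inc E C" by (simp add: \<zeta>w)
  then have f_eq: "b' \<cdot> \<zeta> = f"
    unfolding b'r bi by - (rule cokernel_epi[OF confl_cokernel[OF vw], of "b' \<cdot> \<zeta>"], simp_all)
  obtain d where d [simp]: "d \<in> Arr E" "Dom E d = hull E Y" "Cod E d = hull E C" and di: "d \<cdot> inc E Y = inc E C \<cdot> v"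
    using injective_extend[OF hull_injective[OF ob(3)] inc_prj_confl[OF ob(2)], of "inc E C \<cdot> v"] by auto
  have "(r \<cdot> d) \<cdot> inc E Y = Zero E Y (Cod E r)" by (simp add: di riv)
  then obtain \<delta> where \<delta> [simp]: "\<delta> \<in> Arr E" "Dom E \<delta> = susp E Y" "Cod E \<delta> = Cod E r" and \<delta>p: "\<delta> \<cdot> prj E Y = r \<cdot> d"
    using cokernel_factor[OF confl_cokernel[OF inc_prj_confl[OF ob(2)]], of "r \<cdot> d"] by auto
  have "(d \<cdot> inc E Y) \<cdot> u = inc E C \<cdot> (v \<cdot> u)" unfolding di by simp
  then have "((d \<cdot> k) \<ominus> (inc E C \<cdot> q)) \<cdot> inc E X = Zero E X (hull E C)"
    by (simp add: diff_comp ki s(13) diff_self)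
  then obtain \<tau> where \<tau> [simp]: "\<tau> \<in> Arr E" "Dom E \<tau> = susp E X" "Cod E \<tau> = hull E C"
    and \<tau>p: "\<tau> \<cdot> prj E X = (d \<cdot> k) \<ominus> (inc E C \<cdot> q)"
    using cokernel_factor[OF confl_cokernel[OF inc_prj_confl[OF ob(1)]], of "(d \<cdot> k) \<ominus> (inc E C \<cdot> q)"] by auto
  have "(\<delta> \<cdot> h) \<cdot> prj E X = (\<delta> \<cdot> prj E Y) \<cdot> k" by (simp add: hp)
  moreover have "\<zeta> \<cdot> (w \<cdot> q) = (\<zeta> \<cdot> w) \<cdot> q" by simp
  ultimately have "((\<delta> \<cdot> h) \<ominus> \<zeta>) \<cdot> prj E X = (r \<cdot> (d \<cdot> k)) \<ominus> (r \<cdot> (inc E C \<cdot> q))"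
    unfolding \<delta>p \<zeta>w s(7) by (simp add: diff_comp)
  also have "\<dots> = (r \<cdot> \<tau>) \<cdot> prj E X" by (simp add: \<tau>p comp_diff)
  finally have "(\<delta> \<cdot> h) \<ominus> \<zeta> = r \<cdot> \<tau>"
    by - (rule cokernel_epi[OF confl_cokernel[OF inc_prj_confl[OF ob(1)]]], simp_all)
  moreover have "null (r \<cdot> \<tau>)" by (rule null_through_injective[OF hull_injective[OF ob(3)]]) simp_all
  ultimately have "stable_eq E \<zeta> (\<delta> \<cdot> h)" by (simp add: stable_eq_iff)
  then have "stable_eq E (b' \<cdot> \<zeta>) (b' \<cdot> (\<delta> \<cdot> h))" by (intro stable_eq_comp stable_eq_refl) simp_all
  then have "cl (b' \<cdot> (\<delta> \<cdot> h)) = \<phi>" unfolding f(2) f_eq by (simp add: cl_eq_iff stable_eq_sym)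
  then have "cl (b' \<cdot> \<delta>) \<star> susp_arr E (cl u) = \<phi>" unfolding susp_u by simp
  then show "\<exists>\<psi> \<in> Arr T. Dom T \<psi> = Cod T (susp_arr E (cl u)) \<and> Cod T \<psi> = Cod T \<phi> \<and> \<psi> \<star> susp_arr E (cl u) = \<phi>"
    using f(4) by (intro bexI[of _ "cl (b' \<cdot> \<delta>)"]) simp_all
qed

text \<open>
  The part of the rotation axiom needed later: the cone of \<open>Y \<rightarrow> C\<close> is \<open>X[1]\<close>. It is an
  extension of \<open>X[1] = C / Y\<close> by the injective object \<open>I(Y)\<close>, and such an extension splits.
\<close>

lemma standard_cone:
  assumes uv: "std_triangle u v w q" and v': "std_triangle v v' w' q'"
  shows "isomorphic T (Cod E v') (susp E (Dom E u))"
proof -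
  define X Y C C' where "X = Dom E u" and "Y = Cod E u" and "C = Cod E v" and "C' = Cod E v'"
  note s = std_triangle[OF uv, folded X_def Y_def C_def]
  note s' = std_triangle[OF v', unfolded s(8), folded C_def C'_def]
  have ob [simp]: "X \<in> Ob E" "Y \<in> Ob E" "C \<in> Ob E" "C' \<in> Ob E"
    using s(1,9) s'(9) by (simp_all add: X_def Y_def C_def C'_def)
  note [simp] = s(1,3-5,8-12) s'(3-5,8-12) X_def[symmetric] Y_def[symmetric] C_def[symmetric] C'_def[symmetric]
  obtain p where p [simp]: "p \<in> Arr E" "Dom E p = C'" "Cod E p = susp E X" and pv: "p \<cdot> v' = w"
    and pq: "p \<cdot> q' = Zero E (hull E Y) (susp E X)"
    using pushout_factor[OF s'(2), of w "Zero E (hull E Y) (susp E X)"] s(6) by auto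
  have c: "(q', p) \<in> Confl E"
    by (rule pushout_conflation[OF pushout_sym[OF s'(2)] standard_confl[OF uv]]) (simp_all add: pv pq)
  obtain \<rho> where \<rho> [simp]: "\<rho> \<in> Arr E" "Dom E \<rho> = C'" "Cod E \<rho> = hull E Y" and \<rho>q: "\<rho> \<cdot> q' = Ident E (hull E Y)"
    using injective_extend[OF hull_injective[OF ob(2)] c, of "Ident E (hull E Y)"] by auto
  have "(Ident E C' \<ominus> (q' \<cdot> \<rho>)) \<cdot> q' = Zero E (hull E Y) C'" by (simp add: diff_comp \<rho>q diff_self)
  then obtain \<sigma> where \<sigma> [simp]: "\<sigma> \<in> Arr E" "Dom E \<sigma> = susp E X" "Cod E \<sigma> = C'"
    and \<sigma>p: "\<sigma> \<cdot> p = Ident E C' \<ominus> (q' \<cdot> \<rho>)"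
    using cokernel_factor[OF confl_cokernel[OF c], of "Ident E C' \<ominus> (q' \<cdot> \<rho>)"] by auto
  have "p \<cdot> (q' \<cdot> \<rho>) = (p \<cdot> q') \<cdot> \<rho>" by simp
  then have "(p \<cdot> \<sigma>) \<cdot> p = p" by (simp add: \<sigma>p comp_diff pq)
  then have p\<sigma>: "p \<cdot> \<sigma> = Ident E (susp E X)" by - (rule cokernel_epi[OF confl_cokernel[OF c]], simp_all)
  have "null (q' \<cdot> \<rho>)" by (rule null_through_injective[OF hull_injective[OF ob(2)]]) simp_all
  then have "stable_eq E (\<sigma> \<cdot> p) (Ident E C')" unfolding \<sigma>p by (intro stable_eq_diff) simp_all
  then have "isomorphic T C' (susp E X)"
    by (intro isomorphic_TI[of p _ _ \<sigma>]) (simp_all add: p\<sigma> stable_eq_refl)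
  then show ?thesis by simp
qed

lemma stable_preadd_cat_simps:
  "Hom (stable_preadd_cat E) = Hom T" "Comp (stable_preadd_cat E) = Comp T" "is_iso (stable_preadd_cat E) = is_iso T"
proof -
  have *: "Arr (stable_preadd_cat E) = Arr T" "Dom (stable_preadd_cat E) = Dom T" "Cod (stable_preadd_cat E) = Cod T"
    "Ident (stable_preadd_cat E) = Ident T" "Comp (stable_preadd_cat E) = Comp T"
    by (simp_all add: stable_cat_simps) (simp_all add: stable_preadd_cat_def)
  then show "Hom (stable_preadd_cat E) = Hom T" "Comp (stable_preadd_cat E) = Comp T"
    "is_iso (stable_preadd_cat E) = is_iso T"
    by (simp_all add: fun_eq_iff Hom_def Defs.is_iso_def)
qed

lemma standard_triangles_iff:
  "(f, g, h) \<in> standard_triangles E \<longleftrightarrow> (\<exists>u v w q. std_triangle u v w q \<and> f = cl u \<and> g = cl v \<and> h = cl w)"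
  unfolding standard_triangles_def std_triangle_def by blast

lemma standard_in_Triangles: assumes "std_triangle u v w q" shows "(cl u, cl v, cl w) \<in> Triangles T"
proof -
  note s = std_triangle[OF assms]
  have ob: "Dom E u \<in> Ob E" "Cod E u \<in> Ob E" "Cod E v \<in> Ob E" using s(1,9) by simp_all
  have h: "cl u \<in> Hom T (Dom E u) (Cod E u)" "cl v \<in> Hom T (Cod E u) (Cod E v)"
    "cl w \<in> Hom T (Cod E v) (susp E (Dom E u))" using s by (simp_all add: Hom_def)
  have id: "Ident T X \<in> Hom T X X" "is_iso T (Ident T X)" if "X \<in> Ob E" for X
    using that T.is_iso_ident by (simp_all add: Hom_def)
  have "(cl u, cl v, cl w) \<in> standard_triangles E" using assms standard_triangles_iff by blast
  moreover have "Ident T (Cod E u) \<star> cl u = cl u \<star> Ident T (Dom E u)"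
    "Ident T (Cod E v) \<star> cl v = cl v \<star> Ident T (Cod E u)"
    "susp_arr E (Ident T (Dom E u)) \<star> cl w = cl w \<star> Ident T (Cod E v)"
    using s ob by (simp_all add: susp_ident)
  ultimately show ?thesis
    unfolding stable_cat_simps(7) distinguished_triangles_def Let_def stable_preadd_cat_simps
    using h id[OF ob(1)] id[OF ob(2)] id[OF ob(3)] by blast
qed

text \<open>
  The three weak cokernels of a standard triangle are transported along an isomorphism of
  triangles; the third uses that the shift preserves the isomorphism and its commuting square.
\<close>

lemma distinguished:
  assumes "(f, g, h) \<in> Triangles T"
  shows "weak_cokernel T g f" "weak_cokernel T h g" "weak_cokernel T (susp_arr E f) h"
    "Cod T h = susp E (Dom T f)"
proof -
  obtain X Y Z X' Y' Z' f' g' h' a b c where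
    fgh: "f \<in> Hom T X Y" "g \<in> Hom T Y Z" "h \<in> Hom T Z (susp E X)"
    and st: "(f', g', h') \<in> standard_triangles E"
    and fgh': "f' \<in> Hom T X' Y'" "g' \<in> Hom T Y' Z'" "h' \<in> Hom T Z' (susp E X')"
    and a: "a \<in> Hom T X X'" "is_iso T a" and b: "b \<in> Hom T Y Y'" "is_iso T b" and c: "c \<in> Hom T Z Z'" "is_iso T c"
    and sq: "b \<star> f = f' \<star> a" "c \<star> g = g' \<star> b" "susp_arr E a \<star> h = h' \<star> c"
    using assms unfolding stable_cat_simps(7) distinguished_triangles_def Let_def stable_preadd_cat_simps by blast
  obtain u v w q where std: "std_triangle u v w q" and cl: "f' = cl u" "g' = cl v" "h' = cl w"
    using st unfolding standard_triangles_iff by blast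
  have wc: "weak_cokernel T g' f'" "weak_cokernel T h' g'" "weak_cokernel T (susp_arr E f') h'"
    unfolding cl using standard_weak_cokernel1[OF std] weak_cokernel_confl[OF standard_confl[OF std]]
      standard_weak_cokernel3[OF std] by blast+
  have arr: "f \<in> Arr T" "Dom T f = X" "Cod T f = Y" "g \<in> Arr T" "Dom T g = Y" "Cod T g = Z"
    "h \<in> Arr T" "Dom T h = Z" "Cod T h = susp E X" "f' \<in> Arr T" "Dom T f' = X'" "Cod T f' = Y'"
    "g' \<in> Arr T" "Dom T g' = Y'" "Cod T g' = Z'" "h' \<in> Arr T" "Dom T h' = Z'" "Cod T h' = susp E X'"
    "a \<in> Arr T" "Dom T a = X" "Cod T a = X'" "b \<in> Arr T" "Dom T b = Y" "Cod T b = Y'"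
    using fgh fgh' a b by (simp_all add: Hom_def)
  have sa: "is_iso T (susp_arr E a)" "susp_arr E a \<in> Hom T (susp E X) (susp E X')"
    "is_iso T (susp_arr E b)" "susp_arr E b \<in> Hom T (susp E Y) (susp E Y')"
    using a b susp_iso arr by (simp_all add: Hom_def)
  have sq': "susp_arr E b \<star> susp_arr E f = susp_arr E f' \<star> susp_arr E a"
    using sq(1) arr by (simp add: susp_comp[symmetric])
  show "weak_cokernel T g f"
    by (rule weak_cokernel_iso[OF wc(1) _ _ _ _ _ _ _ _ _ a(2,1) b(2,1) c(2,1) sq(1,2)]) (use arr in simp_all)
  show "weak_cokernel T h g"
    by (rule weak_cokernel_iso[OF wc(2) _ _ _ _ _ _ _ _ _ b(2,1) c(2,1) sa(1,2) sq(2,3)]) (use arr in simp_all)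
  show "weak_cokernel T (susp_arr E f) h"
    by (rule weak_cokernel_iso[OF wc(3) _ _ _ _ _ _ _ _ _ c(2,1) sa sq(3) sq']) (use arr in simp_all)
  show "Cod T h = susp E (Dom T f)" using arr by simp
qed

section \<open>Orthogonality and localizing subcategories\<close>

lemma cl_eq_iff_null:
  assumes "f \<in> Arr E" "g \<in> Arr E" "Dom E g = Dom E f" "Cod E g = Cod E f"
  shows "cl f = cl g \<longleftrightarrow> null (f \<ominus> g)"
proof -
  have "cl f = cl g \<longleftrightarrow> stable_eq E g f" using assms cl_eq_iff stable_eq_sym by metis
  then show ?thesis using assms by (simp add: stable_eq_iff)
qed

lemma induces_diff:
  assumes c: "(i, p) \<in> Confl E" and c': "(i', p') \<in> Confl E"
    and h: "induces i p i' p' f h" and h': "induces i p i' p' f' h'"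
  shows "induces i p i' p' (f \<ominus> f') (h \<ominus> h')"
proof -
  note [simp] = confl(1-3)[OF c] confl(1-3)[OF c']
  obtain k where k [simp]: "k \<in> Arr E" "Dom E k = Dom E p" "Cod E k = Dom E p'"
    and ki: "k \<cdot> i = i' \<cdot> f" and hp: "h \<cdot> p = p' \<cdot> k" using h by (auto simp: induces_def)
  obtain k' where k' [simp]: "k' \<in> Arr E" "Dom E k' = Dom E p" "Cod E k' = Dom E p'"
    and ki': "k' \<cdot> i = i' \<cdot> f'" and hp': "h' \<cdot> p = p' \<cdot> k'" using h' by (auto simp: induces_def)
  have [simp]: "f \<in> Arr E" "Dom E f = Dom E i" "Cod E f = Dom E i'"
     "f' \<in> Arr E" "Dom E f' = Dom E i" "Cod E f' = Dom E i'"
     "h \<in> Arr E" "Dom E h = Cod E p" "Cod E h = Cod E p'"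
     "h' \<in> Arr E" "Dom E h' = Cod E p" "Cod E h' = Cod E p'"
    using h h' by (simp_all add: induces_def)
  have "(k \<ominus> k') \<cdot> i = i' \<cdot> (f \<ominus> f')" "(h \<ominus> h') \<cdot> p = p' \<cdot> (k \<ominus> k')"
    by (simp_all add: diff_comp comp_diff ki ki' hp hp')
  then show ?thesis unfolding induces_def by (auto intro!: bexI[of _ "k \<ominus> k'"])
qed

text \<open>
  Uniqueness statements are reduced to vanishing statements by subtraction. The difference is
  formed on representatives.
\<close>

lemma difference_T:
  assumes A: "A \<in> Arr T" and B: "B \<in> Arr T" "Dom T B = Dom T A" "Cod T B = Cod T A"
  obtains d where "d \<in> Arr T" "Dom T d = Dom T A" "Cod T d = Cod T A"
    "d = Zero T (Dom T A) (Cod T A) \<Longrightarrow> A = B"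
    "\<And>F. F \<in> Arr T \<Longrightarrow> Cod T F = Dom T A \<Longrightarrow> A \<star> F = B \<star> F \<Longrightarrow> d \<star> F = Zero T (Dom T F) (Cod T A)"
    "susp_arr E A = susp_arr E B \<Longrightarrow> susp_arr E d = Zero T (susp E (Dom T A)) (susp E (Cod T A))"
proof -
  obtain f h where f: "f \<in> Arr E" "A = cl f" "Dom E f = Dom T A" "Cod E f = Cod T A"
    "susp_rep (Dom T A) (Cod T A) f h" "susp_arr E A = cl h"
    "h \<in> Arr E" "Dom E h = susp E (Dom T A)" "Cod E h = susp E (Cod T A)"
    using A by (rule susp_arr_E)
  obtain g k where "g \<in> Arr E" "B = cl g" "Dom E g = Dom T B" "Cod E g = Cod T B"
    "susp_rep (Dom T B) (Cod T B) g k" "susp_arr E B = cl k"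
    "k \<in> Arr E" "Dom E k = susp E (Dom T B)" "Cod E k = susp E (Cod T B)"
    using B(1) by (rule susp_arr_E)
  note g = this[unfolded B(2,3)]
  have X: "Dom T A \<in> Ob E" "Cod T A \<in> Ob E" using T.dom_cod[OF A] by simp_all
  have fg: "f \<ominus> g \<in> Arr E" "Dom E (f \<ominus> g) = Dom T A" "Cod E (f \<ominus> g) = Cod T A"
    using f(1,3,4) g(1,3,4) by simp_all
  show ?thesis
  proof (rule that[of "cl (f \<ominus> g)"])
    show "cl (f \<ominus> g) \<in> Arr T" "Dom T (cl (f \<ominus> g)) = Dom T A" "Cod T (cl (f \<ominus> g)) = Cod T A"
      using fg by simp_all
    assume "cl (f \<ominus> g) = Zero T (Dom T A) (Cod T A)"
    then have "null (f \<ominus> g)" using cl_eq_zero_iff[OF fg(1)] fg by simp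
    then show "A = B" unfolding f(2) g(2) using f(1,3,4) g(1,3,4) cl_eq_iff_null[of f g] by simp
  next
    fix F assume F: "F \<in> Arr T" "Cod T F = Dom T A" "A \<star> F = B \<star> F"
    obtain e where e: "e \<in> Arr E" "F = cl e" "Dom T F = Dom E e" "Cod T F = Cod E e"
      using F(1) by (rule arr_T_E)
    have ce: "Cod E e = Dom T A" using e F(2) by simp
    have "cl (f \<cdot> e) = cl (g \<cdot> e)"
      using F(3) unfolding f(2) g(2) e(2) using f(1,3) g(1,3) e(1) ce by simp
    then have "null ((f \<ominus> g) \<cdot> e)" using f(1,3,4) g(1,3,4) e(1) ce by (simp add: cl_eq_iff_null diff_comp)
    then have "cl ((f \<ominus> g) \<cdot> e) = Zero T (Dom E e) (Cod T A)"
      using cl_eq_zero_iff[of "(f \<ominus> g) \<cdot> e"] fg e(1) ce by simp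
    moreover have "cl (f \<ominus> g) \<star> cl e = cl ((f \<ominus> g) \<cdot> e)"
      using fg e(1) ce by (intro comp_cl) simp_all
    ultimately show "cl (f \<ominus> g) \<star> F = Zero T (Dom T F) (Cod T A)"
      unfolding e(3) unfolding e(2) by simp
  next
    assume "susp_arr E A = susp_arr E B"
    then have "cl h = cl k" unfolding f(6) g(6) .
    then have "null (h \<ominus> k)" using f(7-) g(7-) by (simp add: cl_eq_iff_null)
    moreover have "susp_rep (Dom T A) (Cod T A) (f \<ominus> g) (h \<ominus> k)"
      by (rule induces_diff[OF inc_prj_confl[OF X(1)] inc_prj_confl[OF X(2)] f(5) g(5)])
    then have "susp_arr E (cl (f \<ominus> g)) = cl (h \<ominus> k)" using susp_arr_eq[OF fg(1)] fg by simp
    ultimately show "susp_arr E (cl (f \<ominus> g)) = Zero T (susp E (Dom T A)) (susp E (Cod T A))"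
      using cl_eq_zero_iff[of "h \<ominus> k"] f(7-) g(7-) by simp
  qed
qed

lemma susp_inj:
  assumes "A \<in> Arr T" "B \<in> Arr T" "Dom T B = Dom T A" "Cod T B = Cod T A" "susp_arr E A = susp_arr E B"
  shows "A = B"
proof -
  obtain d where d: "d \<in> Arr T" "Dom T d = Dom T A" "Cod T d = Cod T A"
    "d = Zero T (Dom T A) (Cod T A) \<Longrightarrow> A = B"
    "susp_arr E A = susp_arr E B \<Longrightarrow> susp_arr E d = Zero T (susp E (Dom T A)) (susp E (Cod T A))"
    by (rule difference_T[OF assms(1-4)]) blast
  have "susp_arr E d = Zero T (susp E (Dom T d)) (susp E (Cod T d))" using d(5)[OF assms(5)] d(2,3) by simp
  from susp_faithful[OF d(1) this] show ?thesis using d(2-4) by simp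
qed

definition vanishing :: "'o \<Rightarrow> 'o \<Rightarrow> bool" where
  "vanishing X Y \<longleftrightarrow> (\<forall>\<phi> \<in> Hom T X Y. \<phi> = Zero T X Y)"

lemma vanishingD: "vanishing X Y \<Longrightarrow> \<phi> \<in> Arr T \<Longrightarrow> Dom T \<phi> = X \<Longrightarrow> Cod T \<phi> = Y \<Longrightarrow> \<phi> = Zero T X Y"
  by (auto simp: vanishing_def Hom_def)

lemma vanishingI:
  "(\<And>\<phi>. \<phi> \<in> Arr T \<Longrightarrow> Dom T \<phi> = X \<Longrightarrow> Cod T \<phi> = Y \<Longrightarrow> \<phi> = Zero T X Y) \<Longrightarrow> vanishing X Y"
  by (auto simp: vanishing_def Hom_def)

lemma isomorphic_T_E:
  assumes "isomorphic T X Y"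
  obtains a b where "a \<in> Arr T" "Dom T a = X" "Cod T a = Y" "b \<in> Arr T" "Dom T b = Y" "Cod T b = X"
    "b \<star> a = Ident T X" "a \<star> b = Ident T Y" "X \<in> Ob E" "Y \<in> Ob E"
proof -
  obtain a where a: "a \<in> Hom T X Y" "is_iso T a" using assms by (auto simp: isomorphic_def)
  then have a': "a \<in> Arr T" "Dom T a = X" "Cod T a = Y" by (simp_all add: Hom_def)
  have "X \<in> Ob E" "Y \<in> Ob E" using T.dom_cod[OF a'(1)] a' by simp_all
  then show ?thesis using T.iso_inverse[OF a(2)] that a' by metis
qed

lemma vanishing_iso:
  assumes v: "vanishing X Y" and X: "isomorphic T X X'" and Y: "isomorphic T Y Y'"
  shows "vanishing X' Y'"
proof (rule vanishingI)
  obtain a a' where [simp]: "a \<in> Arr T" "Dom T a = X" "Cod T a = X'" "a' \<in> Arr T" "Dom T a' = X'" "Cod T a' = X"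
    "X \<in> Ob E" "X' \<in> Ob E" and aa': "a \<star> a' = Ident T X'" using X by (rule isomorphic_T_E)
  obtain b b' where [simp]: "b \<in> Arr T" "Dom T b = Y" "Cod T b = Y'" "b' \<in> Arr T" "Dom T b' = Y'" "Cod T b' = Y"
    "Y \<in> Ob E" "Y' \<in> Ob E" and bb': "b \<star> b' = Ident T Y'" using Y by (rule isomorphic_T_E)
  fix \<phi> assume \<phi> [simp]: "\<phi> \<in> Arr T" "Dom T \<phi> = X'" "Cod T \<phi> = Y'"
  have 0: "b' \<star> (\<phi> \<star> a) = Zero T X Y" by (rule vanishingD[OF v]) simp_all
  have "\<phi> = (b \<star> b') \<star> (\<phi> \<star> (a \<star> a'))" by (simp add: aa' bb')
  also have "\<dots> = b \<star> ((b' \<star> (\<phi> \<star> a)) \<star> a')" by simp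
  also have "\<dots> = Zero T X' Y'" unfolding 0 by simp
  finally show "\<phi> = Zero T X' Y'" .
qed

lemma vanishing_susp:
  assumes [simp]: "X \<in> Ob E" "Y \<in> Ob E"
  shows "vanishing (susp E X) (susp E Y) \<longleftrightarrow> vanishing X Y"
proof
  assume v: "vanishing (susp E X) (susp E Y)"
  show "vanishing X Y"
  proof (rule vanishingI)
    fix \<phi> assume \<phi>: "\<phi> \<in> Arr T" "Dom T \<phi> = X" "Cod T \<phi> = Y"
    then have "susp_arr E \<phi> = Zero T (susp E X) (susp E Y)" by (intro vanishingD[OF v]) simp_all
    with susp_faithful[OF \<phi>(1)] show "\<phi> = Zero T X Y" unfolding \<phi>(2,3) by blast
  qed
next
  assume v: "vanishing X Y"
  show "vanishing (susp E X) (susp E Y)"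
  proof (rule vanishingI)
    fix \<phi> assume \<phi>: "\<phi> \<in> Arr T" "Dom T \<phi> = susp E X" "Cod T \<phi> = susp E Y"
    obtain A where A: "A \<in> Arr T" "Dom T A = X" "Cod T A = Y" "susp_arr E A = \<phi>"
      by (rule susp_full[OF \<phi> assms])
    have "A = Zero T X Y" by (rule vanishingD[OF v A(1-3)])
    then show "\<phi> = Zero T (susp E X) (susp E Y)" using A(4) susp_zero[OF assms] by simp
  qed
qed

lemma triangle_arr:
  assumes "(f, g, h) \<in> Triangles T"
  shows "f \<in> Arr T" "g \<in> Arr T" "h \<in> Arr T" "Dom T g = Cod T f" "Dom T h = Cod T g"
    "Cod T h = susp E (Dom T f)"
  using distinguished[OF assms] by (simp_all add: weak_cokernel_def)

lemma Shift_T [simp]: "Shift T = susp E" by (simp add: stable_cat_simps)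

lemma zero_object_exists: obtains Z where "is_zero_object T Z"
proof -
  obtain Z where "is_zero_object E Z" using additive by (auto simp: additive_category_def)
  then have "is_zero_object T Z" by (simp add: is_zero_object_def Ident_T Zero_T)
  then show ?thesis by (rule that)
qed

lemma zero_objects_isomorphic:
  assumes "is_zero_object T Z" "is_zero_object T Z'" shows "isomorphic T Z Z'"
proof -
  have "is_iso T (Zero T Z Z')"
    using assms by (intro T.is_isoI[of _ Z Z' "Zero T Z' Z"]) (simp_all add: Hom_def is_zero_object_def)
  moreover have "Zero T Z Z' \<in> Hom T Z Z'" using assms by (simp add: Hom_def is_zero_object_def)
  ultimately show ?thesis by (auto simp: isomorphic_def)
qed

lemma triangulated_subcategoryI:
  assumes "D \<subseteq> Ob E" "Z \<in> D" "is_zero_object T Z"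
    and "\<And>X Y. X \<in> D \<Longrightarrow> isomorphic T X Y \<Longrightarrow> Y \<in> D"
    and "\<And>X. X \<in> Ob E \<Longrightarrow> X \<in> D \<longleftrightarrow> susp E X \<in> D"
    and tri: "\<And>f g h. (f, g, h) \<in> Triangles T \<Longrightarrow>
      (Dom T f \<in> D \<and> Dom T g \<in> D \<longrightarrow> Dom T h \<in> D) \<and>
      (Dom T g \<in> D \<and> Dom T h \<in> D \<longrightarrow> Dom T f \<in> D) \<and>
      (Dom T f \<in> D \<and> Dom T h \<in> D \<longrightarrow> Dom T g \<in> D)"
  shows "triangulated_subcategory T D"
  unfolding triangulated_subcategory_def Shift_T Ob_T
proof (intro conjI ballI impI)
  fix t assume t: "t \<in> Triangles T"
  obtain f g h where fgh: "t = (f, g, h)" by (cases t)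
  show "case t of (f, g, h) \<Rightarrow> (Dom T f \<in> D \<and> Dom T g \<in> D \<longrightarrow> Dom T h \<in> D) \<and>
      (Dom T g \<in> D \<and> Dom T h \<in> D \<longrightarrow> Dom T f \<in> D) \<and>
      (Dom T f \<in> D \<and> Dom T h \<in> D \<longrightarrow> Dom T g \<in> D)"
    unfolding fgh prod.case by (rule tri) (use t fgh in blast)
qed (use assms(1-5) in blast)+

text \<open>
  Vanishing of the arrows into an object of \<open>B\<close> passes along triangles by exactness. To conclude from the other two
  objects to the first one, exactness at \<open>X[1]\<close> is applied to shifted arrows; this is where
  the closure of \<open>B\<close> under the shift enters. Closure under the inverse shift makes the
  orthogonal class closed under the shift.
\<close>

lemma triangulated_subcategory_left_perp:
  assumes B: "B \<subseteq> Ob E" and susp_B: "\<And>Y. Y \<in> Ob E \<Longrightarrow> susp E Y \<in> B \<longleftrightarrow> Y \<in> B"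
    and iso_B: "\<And>Y Y'. Y \<in> B \<Longrightarrow> isomorphic T Y Y' \<Longrightarrow> Y' \<in> B"
  shows "triangulated_subcategory T {X \<in> Ob E. \<forall>Y \<in> B. vanishing X Y}" (is "triangulated_subcategory T ?D")
proof -
  have susp_D: "X \<in> ?D \<longleftrightarrow> susp E X \<in> ?D" if X: "X \<in> Ob E" for X
  proof
    assume D: "X \<in> ?D"
    have "vanishing (susp E X) Y" if Y: "Y \<in> B" for Y
    proof -
      have "Y \<in> Ob E" using B Y by blast
      then obtain Y' where Y': "Y' \<in> Ob E" "isomorphic T (susp E Y') Y" by (rule susp_surj)
      have "susp E Y' \<in> B" using iso_B[OF Y T.isomorphic_sym[OF Y'(2)]] .
      then have "vanishing X Y'" using D susp_B[OF Y'(1)] by blast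
      then have "vanishing (susp E X) (susp E Y')" using X Y'(1) by (simp add: vanishing_susp)
      moreover have "isomorphic T (susp E X) (susp E X)" using X by (simp add: T.isomorphic_refl)
      ultimately show ?thesis using Y'(2) by (rule vanishing_iso)
    qed
    then show "susp E X \<in> ?D" using X by simp
  next
    assume "susp E X \<in> ?D"
    then have "vanishing X Y" if "Y \<in> B" for Y using that susp_B[of Y] B X vanishing_susp[of X Y] by blast
    then show "X \<in> ?D" using X by simp
  qed
  have tri: "(Dom T f \<in> ?D \<and> Dom T g \<in> ?D \<longrightarrow> Dom T h \<in> ?D) \<and>
        (Dom T g \<in> ?D \<and> Dom T h \<in> ?D \<longrightarrow> Dom T f \<in> ?D) \<and>
        (Dom T f \<in> ?D \<and> Dom T h \<in> ?D \<longrightarrow> Dom T g \<in> ?D)" if t: "(f, g, h) \<in> Triangles T" for f g h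
  proof -
    note a = triangle_arr[OF t]
    note wc = distinguished(1-3)[OF t]
    have ob [simp]: "Dom T f \<in> Ob E" "Cod T f \<in> Ob E" "Cod T g \<in> Ob E"
      using T.dom_cod[OF a(1)] T.dom_cod[OF a(2)] by simp_all
    note [simp] = a
    have 1: "vanishing (Cod T g) Y" if Y: "Y \<in> Ob E" "vanishing (Cod T f) Y" "vanishing (susp E (Dom T f)) Y" for Y
    proof (rule vanishingI)
      fix \<phi> assume \<phi>: "\<phi> \<in> Arr T" "Dom T \<phi> = Cod T g" "Cod T \<phi> = Y"
      then have "\<phi> \<star> g = Zero T (Dom T g) (Cod T \<phi>)" using vanishingD[OF Y(2), of "\<phi> \<star> g"] by simp
      then obtain \<psi> where \<psi>: "\<psi> \<in> Arr T" "Dom T \<psi> = Cod T h" "Cod T \<psi> = Cod T \<phi>" "\<psi> \<star> h = \<phi>"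
        by (rule weak_cokernel_factor[OF wc(2) \<phi>(1,2)])
      have "\<psi> = Zero T (susp E (Dom T f)) Y" using vanishingD[OF Y(3), of \<psi>] \<psi>(1-3) \<phi>(3) by simp
      then show "\<phi> = Zero T (Cod T g) Y" using \<psi>(4) Y(1) by simp
    qed
    have 2: "vanishing (Dom T f) Y"
      if Y: "Y \<in> Ob E" "vanishing (Cod T g) (susp E Y)" "vanishing (susp E (Cod T f)) (susp E Y)" for Y
    proof (rule vanishingI)
      fix \<phi> assume \<phi>: "\<phi> \<in> Arr T" "Dom T \<phi> = Dom T f" "Cod T \<phi> = Y"
      then have "susp_arr E \<phi> \<star> h = Zero T (Dom T h) (Cod T (susp_arr E \<phi>))"
        using vanishingD[OF Y(2), of "susp_arr E \<phi> \<star> h"] by simp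
      moreover have "susp_arr E \<phi> \<in> Arr T" "Dom T (susp_arr E \<phi>) = Cod T h" using \<phi> by simp_all
      ultimately obtain \<psi> where \<psi>: "\<psi> \<in> Arr T" "Dom T \<psi> = Cod T (susp_arr E f)" "Cod T \<psi> = Cod T (susp_arr E \<phi>)"
        "\<psi> \<star> susp_arr E f = susp_arr E \<phi>"
        using weak_cokernel_factor[OF wc(3), of "susp_arr E \<phi>"] by metis
      have "\<psi> = Zero T (susp E (Cod T f)) (susp E Y)" using vanishingD[OF Y(3), of \<psi>] \<psi>(1-3) \<phi> by simp
      then have "susp_arr E \<phi> = Zero T (susp E (Dom T f)) (susp E Y)" using \<psi>(4) Y(1) by simp
      then show "\<phi> = Zero T (Dom T f) Y" using susp_faithful[OF \<phi>(1)] \<phi>(2,3) by simp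
    qed
    have 3: "vanishing (Cod T f) Y" if Y: "Y \<in> Ob E" "vanishing (Dom T f) Y" "vanishing (Cod T g) Y" for Y
    proof (rule vanishingI)
      fix \<phi> assume \<phi>: "\<phi> \<in> Arr T" "Dom T \<phi> = Cod T f" "Cod T \<phi> = Y"
      then have "\<phi> \<star> f = Zero T (Dom T f) (Cod T \<phi>)" using vanishingD[OF Y(2), of "\<phi> \<star> f"] by simp
      then obtain \<psi> where \<psi>: "\<psi> \<in> Arr T" "Dom T \<psi> = Cod T g" "Cod T \<psi> = Cod T \<phi>" "\<psi> \<star> g = \<phi>"
        by (rule weak_cokernel_factor[OF wc(1) \<phi>(1,2)])
      have "\<psi> = Zero T (Cod T g) Y" using vanishingD[OF Y(3), of \<psi>] \<psi>(1-3) \<phi>(3) by simp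
      then show "\<phi> = Zero T (Cod T f) Y" using \<psi>(4) Y(1) by simp
    qed
    have sB: "susp E Y \<in> B" "Y \<in> Ob E" if "Y \<in> B" for Y using that B susp_B[of Y] by blast+
    show ?thesis
    proof (intro conjI impI; elim conjE)
      assume D: "Dom T f \<in> ?D" "Dom T g \<in> ?D"
      then have "susp E (Dom T f) \<in> ?D" using susp_D[OF ob(1)] by simp
      then show "Dom T h \<in> ?D" using D 1 sB by simp
    next
      assume D: "Dom T g \<in> ?D" "Dom T h \<in> ?D"
      then have "susp E (Cod T f) \<in> ?D" using susp_D[OF ob(2)] by simp
      then show "Dom T f \<in> ?D" using D 2 sB by simp
    next
      assume "Dom T f \<in> ?D" "Dom T h \<in> ?D"
      then show "Dom T g \<in> ?D" using 3 sB by simp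
    qed
  qed
  obtain Z where Z: "is_zero_object T Z" by (rule zero_object_exists)
  have ZD: "Z \<in> ?D"
  proof -
    have [simp]: "Z \<in> Ob E" and id: "Ident T Z = Zero T Z Z" using Z by (simp_all add: is_zero_object_def)
    have "vanishing Z Y" if "Y \<in> B" for Y
    proof (rule vanishingI)
      fix \<phi> assume \<phi>: "\<phi> \<in> Arr T" "Dom T \<phi> = Z" "Cod T \<phi> = Y"
      have "\<phi> = \<phi> \<star> Ident T Z" using \<phi> by simp
      also have "\<dots> = Zero T Z Y" unfolding id using \<phi> by simp
      finally show "\<phi> = Zero T Z Y" .
    qed
    then show ?thesis by simp
  qed
  have iso: "X' \<in> ?D" if "X \<in> ?D" "isomorphic T X X'" for X X'
  proof -
    have "X' \<in> Ob E" using that(2) by (rule isomorphic_T_E)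
    moreover have "vanishing X' Y" if Y: "Y \<in> B" for Y
    proof (rule vanishing_iso)
      show "vanishing X Y" "isomorphic T X X'" using \<open>X \<in> ?D\<close> \<open>isomorphic T X X'\<close> Y by simp_all
      show "isomorphic T Y Y" using Y B by (intro T.isomorphic_refl) auto
    qed
    ultimately show ?thesis by simp
  qed
  show ?thesis
  proof (rule triangulated_subcategoryI)
    show "?D \<subseteq> Ob E" by blast
  qed (fact ZD Z iso susp_D tri)+
qed

lemma localizing_left_perp:
  fixes \<iota> :: "'i itself"
  assumes "B \<subseteq> Ob E" and "\<And>Y. Y \<in> Ob E \<Longrightarrow> susp E Y \<in> B \<longleftrightarrow> Y \<in> B"
    and "\<And>Y Y'. Y \<in> B \<Longrightarrow> isomorphic T Y Y' \<Longrightarrow> Y' \<in> B"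
  shows "localizing_subcategory \<iota> T {X \<in> Ob E. \<forall>Y \<in> B. vanishing X Y}"
  unfolding localizing_subcategory_def
proof (intro conjI allI impI)
  show "triangulated_subcategory T {X \<in> Ob E. \<forall>Y \<in> B. vanishing X Y}"
    using assms by (rule triangulated_subcategory_left_perp)
  fix I :: "'i set" and X Z u
  assume X: "\<forall>i\<in>I. X i \<in> {X \<in> Ob E. \<forall>Y \<in> B. vanishing X Y}" and cop: "is_coproduct T I X Z u"
  have Z: "Z \<in> Ob E" and u: "\<And>i. i \<in> I \<Longrightarrow> u i \<in> Arr T \<and> Dom T (u i) = X i \<and> Cod T (u i) = Z"
    using cop by (auto simp: is_coproduct_def Hom_def)
  have "vanishing Z Y" if Y: "Y \<in> B" for Y
  proof (rule vanishingI)
    have [simp]: "Y \<in> Ob E" using assms(1) Y by blast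
    fix \<phi> assume \<phi>: "\<phi> \<in> Arr T" "Dom T \<phi> = Z" "Cod T \<phi> = Y"
    have v: "\<phi> \<star> u i = Zero T (X i) Y" if "i \<in> I" for i
      using X Y u[OF that] \<phi> that by (intro vanishingD) auto
    have "\<forall>i\<in>I. Zero T (X i) Y \<in> Hom T (X i) Y" using X by (auto simp: Hom_def)
    then have "\<exists>!t. t \<in> Hom T Z Y \<and> (\<forall>i \<in> I. t \<star> u i = Zero T (X i) Y)"
      using cop unfolding is_coproduct_def by simp
    moreover have "\<phi> \<in> Hom T Z Y" "Zero T Z Y \<in> Hom T Z Y" using \<phi> Z by (simp_all add: Hom_def)
    moreover have "\<forall>i \<in> I. Zero T Z Y \<star> u i = Zero T (X i) Y" using u by simp
    ultimately show "\<phi> = Zero T Z Y" using v by blast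
  qed
  then show "Z \<in> {X \<in> Ob E. \<forall>Y \<in> B. vanishing X Y}" using Z by simp
qed

lemma localizing_Ob: "localizing_subcategory \<iota> T (Ob E)"
proof -
  obtain Z where Z: "is_zero_object T Z" by (rule zero_object_exists)
  have "triangulated_subcategory T (Ob E)"
  proof (rule triangulated_subcategoryI)
    show "Z \<in> Ob E" using Z by (simp add: is_zero_object_def)
    fix f g h assume "(f, g, h) \<in> Triangles T"
    then have "Dom T f \<in> Ob E \<and> Dom T g \<in> Ob E \<and> Dom T h \<in> Ob E"
      using triangle_arr T.dom_cod by auto
    then show "(Dom T f \<in> Ob E \<and> Dom T g \<in> Ob E \<longrightarrow> Dom T h \<in> Ob E) \<and>
        (Dom T g \<in> Ob E \<and> Dom T h \<in> Ob E \<longrightarrow> Dom T f \<in> Ob E) \<and>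
        (Dom T f \<in> Ob E \<and> Dom T h \<in> Ob E \<longrightarrow> Dom T g \<in> Ob E)" by blast
  next
    show "X \<in> Ob E \<longleftrightarrow> susp E X \<in> Ob E" if "X \<in> Ob E" for X using that by simp
  qed (use Z in \<open>auto elim: isomorphic_T_E\<close>)
  then show ?thesis by (auto simp: localizing_subcategory_def is_coproduct_def)
qed

lemma localizing_closure_triangulated:
  fixes \<iota> :: "'i itself"
  assumes "R \<subseteq> Ob E" shows "triangulated_subcategory T (localizing_closure \<iota> T R)"
proof -
  let ?L = "{D. localizing_subcategory \<iota> T D \<and> R \<subseteq> D}"
  have tri: "triangulated_subcategory T D" if "D \<in> ?L" for D
    using that by (simp add: localizing_subcategory_def)
  have Ob: "Ob E \<in> ?L" using localizing_Ob assms by simp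
  obtain Z where Z: "is_zero_object T Z" by (rule zero_object_exists)
  have "Z \<in> D" if D: "D \<in> ?L" for D
  proof -
    obtain Z' where "Z' \<in> D" "is_zero_object T Z'" using tri[OF D] by (auto simp: triangulated_subcategory_def)
    moreover have "isomorphic T Z' Z" using zero_objects_isomorphic calculation(2) Z by blast
    moreover have "Z \<in> Ob T" using Z by (simp add: is_zero_object_def)
    ultimately show ?thesis using tri[OF D] unfolding triangulated_subcategory_def by blast
  qed
  then have ZL: "Z \<in> \<Inter> ?L" by blast
  show ?thesis unfolding localizing_closure_def
  proof (rule triangulated_subcategoryI)
    show "\<Inter> ?L \<subseteq> Ob E" using Ob by blast
    show "Y \<in> \<Inter> ?L" if X: "X \<in> \<Inter> ?L" "isomorphic T X Y" for X Y
    proof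
      have "Y \<in> Ob T" using X(2) by (auto elim: isomorphic_T_E)
      fix D assume D: "D \<in> ?L"
      then have "X \<in> D" using X(1) by blast
      with tri[OF D] X(2) \<open>Y \<in> Ob T\<close> show "Y \<in> D" unfolding triangulated_subcategory_def by blast
    qed
    show "X \<in> \<Inter> ?L \<longleftrightarrow> susp E X \<in> \<Inter> ?L" if X: "X \<in> Ob E" for X
    proof -
      have "X \<in> D \<longleftrightarrow> susp E X \<in> D" if "D \<in> ?L" for D
        using tri[OF that] X by (simp add: triangulated_subcategory_def)
      then show ?thesis by blast
    qed
    fix f g h assume t: "(f, g, h) \<in> Triangles T"
    have "(Dom T f \<in> D \<and> Dom T g \<in> D \<longrightarrow> Dom T h \<in> D) \<and>
        (Dom T g \<in> D \<and> Dom T h \<in> D \<longrightarrow> Dom T f \<in> D) \<and>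
        (Dom T f \<in> D \<and> Dom T h \<in> D \<longrightarrow> Dom T g \<in> D)" if "D \<in> ?L" for D
      using tri[OF that] t unfolding triangulated_subcategory_def by fast
    then show "(Dom T f \<in> \<Inter> ?L \<and> Dom T g \<in> \<Inter> ?L \<longrightarrow> Dom T h \<in> \<Inter> ?L) \<and>
        (Dom T g \<in> \<Inter> ?L \<and> Dom T h \<in> \<Inter> ?L \<longrightarrow> Dom T f \<in> \<Inter> ?L) \<and>
        (Dom T f \<in> \<Inter> ?L \<and> Dom T h \<in> \<Inter> ?L \<longrightarrow> Dom T g \<in> \<Inter> ?L)" by fast
  qed (fact ZL Z)+
qed

lemma localizing_closure_least:
  assumes "localizing_subcategory \<iota> T D" "R \<subseteq> D" shows "localizing_closure \<iota> T R \<subseteq> D"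
  using assms by (auto simp: localizing_closure_def)

lemma cone_in_arr: "cone_in T D \<subseteq> Arr T"
  using triangle_arr(1) by (auto simp: cone_in_def)

text \<open>
  For a triangle \<open>Z' \<rightarrow> Z \<rightarrow> C \<rightarrow> Z'[1]\<close> with \<open>C\<close> in \<open>D\<close>, exactness of hom into \<open>Y\<close> at \<open>Z\<close> gives
  uniqueness of extensions from \<open>Z'\<close> to \<open>Z\<close>. For existence the arrow is shifted: \<open>f[1]\<close> vanishes
  on \<open>C\<close>, hence extends along \<open>s[1]\<close>, and the shift is fully faithful.
\<close>

lemma local_object_if_vanishing:
  assumes Y: "Y \<in> Ob E" and v: "\<And>X. X \<in> D \<Longrightarrow> vanishing X Y \<and> vanishing X (susp E Y)"
  shows "local_object T D Y"
  unfolding local_object_def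
proof (intro ballI)
  fix s f assume "s \<in> cone_in T D" "f \<in> Hom T (Dom T s) Y"
  then obtain g h where t: "(s, g, h) \<in> Triangles T" and D: "Cod T g \<in> D"
    and f: "f \<in> Arr T" "Dom T f = Dom T s" "Cod T f = Y" by (auto simp: cone_in_def Hom_def)
  note a = triangle_arr[OF t]
  note [simp] = a f(1)
  have ob [simp]: "Dom T s \<in> Ob E" "Cod T s \<in> Ob E" "Cod T g \<in> Ob E"
    using T.dom_cod[OF a(1)] T.dom_cod[OF a(2)] by simp_all
  show "\<exists>!k. k \<in> Hom T (Cod T s) Y \<and> k \<star> s = f"
  proof (rule ex_ex1I)
    have "susp_arr E f \<star> h = Zero T (Dom T h) (Cod T (susp_arr E f))"
      using vanishingD[OF conjunct2[OF v[OF D]], of "susp_arr E f \<star> h"] f by simp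
    moreover have "susp_arr E f \<in> Arr T" "Dom T (susp_arr E f) = Cod T h" using f by simp_all
    ultimately obtain \<psi> where \<psi>: "\<psi> \<in> Arr T" "Dom T \<psi> = Cod T (susp_arr E s)" "Cod T \<psi> = Cod T (susp_arr E f)"
      "\<psi> \<star> susp_arr E s = susp_arr E f"
      using weak_cokernel_factor[OF distinguished(3)[OF t], of "susp_arr E f"] by metis
    have "Dom T \<psi> = susp E (Cod T s)" "Cod T \<psi> = susp E Y" using \<psi> f by simp_all
    then obtain k where k: "k \<in> Arr T" "Dom T k = Cod T s" "Cod T k = Y" "susp_arr E k = \<psi>"
      by (rule susp_full[OF \<psi>(1) _ _ ob(2) Y])
    have "susp_arr E (k \<star> s) = susp_arr E f" using k \<psi>(4) by (simp add: susp_comp)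
    then have "k \<star> s = f" by (rule susp_inj[rotated 4]) (use k f in simp_all)
    then show "\<exists>k. k \<in> Hom T (Cod T s) Y \<and> k \<star> s = f" using k(1-3) by (auto simp: Hom_def)
  next
    fix k k' assume k: "k \<in> Hom T (Cod T s) Y \<and> k \<star> s = f" and k': "k' \<in> Hom T (Cod T s) Y \<and> k' \<star> s = f"
    have ka: "k \<in> Arr T" "k' \<in> Arr T" "Dom T k = Cod T s" "Cod T k = Y" "Dom T k' = Dom T k" "Cod T k' = Cod T k"
      using k k' by (simp_all add: Hom_def)
    obtain d where d: "d \<in> Arr T" "Dom T d = Dom T k" "Cod T d = Cod T k"
      "d = Zero T (Dom T k) (Cod T k) \<Longrightarrow> k = k'"
      "\<And>F. F \<in> Arr T \<Longrightarrow> Cod T F = Dom T k \<Longrightarrow> k \<star> F = k' \<star> F \<Longrightarrow> d \<star> F = Zero T (Dom T F) (Cod T k)"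
      by (rule difference_T[OF ka(1,2,5,6)]) blast
    have dY: "Dom T d = Cod T s" "Cod T d = Y" using d(2,3) ka by simp_all
    have "d \<star> s = Zero T (Dom T s) (Cod T d)" using d(5)[of s] k k' ka dY by simp
    then obtain \<psi> where \<psi>: "\<psi> \<in> Arr T" "Dom T \<psi> = Cod T g" "Cod T \<psi> = Cod T d" "\<psi> \<star> g = d"
      by (rule weak_cokernel_factor[OF distinguished(1)[OF t] d(1) dY(1)])
    have "\<psi> = Zero T (Cod T g) Y" using vanishingD[OF conjunct1[OF v[OF D]], of \<psi>] \<psi>(1-3) dY by simp
    then have "d = Zero T (Cod T s) Y" using \<psi>(4) Y by simp
    then show "k = k'" using d(4) unfolding ka(3,4) by blast
  qed
qed

end

section \<open>Precovers and approximations by localizing subcategories\<close>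

locale precovering_class = frobenius E
  for E :: "('o, 'a, 'm) frob_cat_scheme" (structure) +
  fixes R :: "'o set"
  assumes R_objects: "R \<subseteq> Ob E" and R_shifts: "shift_closed T R"
    and R_hulls: "X \<in> R \<Longrightarrow> hull E X \<in> R"
begin

lemma R_Ob [simp]: "X \<in> R \<Longrightarrow> X \<in> Ob E" using R_objects by blast

lemma shift_in_R: "X \<in> R \<Longrightarrow> \<exists>Y \<in> R. isomorphic T Y (susp E X)"
  and desuspend_in_R: "X \<in> R \<Longrightarrow> \<exists>Y \<in> R. isomorphic T (susp E Y) X"
  using R_shifts by (auto simp: shift_closed_def)

lemma precover_arr:
  assumes "precover E R X r" shows "r \<in> Arr E" "Dom E r \<in> R" "Cod E r = X"
  using assms by (simp_all add: precover_def)

lemma precover_lift: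
  assumes "precover E R X r" "g \<in> Arr E" "Dom E g \<in> R" "Cod E g = X"
  obtains h where "h \<in> Arr E" "Dom E h = Dom E g" "Cod E h = Dom E r" "r \<cdot> h = g"
proof -
  have "g \<in> Hom E (Dom E g) X" using assms by (simp add: Hom_def)
  then have "\<exists>h \<in> Hom E (Dom E g) (Dom E r). r \<cdot> h = g" using assms(1,3) unfolding precover_def by blast
  then show ?thesis using that by (auto simp: Hom_def)
qed

text \<open>
  \<open>Y[1]\<close> need not lie in the class; only some object \<open>Y'\<close> stably isomorphic to it does. But
  \<open>Y[1]\<close> is a retract of \<open>Y' \<oplus> I(Y)\<close>: a stable isomorphism \<open>g\<close> with inverse \<open>h\<close> satisfies
  \<open>g \<circ> h = 1 + prj \<circ> t\<close>, because null arrows into \<open>Y[1]\<close> lift along \<open>prj : I(Y) \<rightarrow> Y[1]\<close>. Arrows from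
  \<open>Y'\<close> and from \<open>I(Y)\<close> lift along precovers, so those from \<open>Y[1]\<close> do.
\<close>

lemma precover_lift_susp:
  assumes r: "precover E R X r" and Y: "Y \<in> R" and c: "c \<in> Arr E" "Dom E c = susp E Y" "Cod E c = X"
  obtains c' where "c' \<in> Arr E" "Dom E c' = susp E Y" "Cod E c' = Dom E r" "r \<cdot> c' = c"
proof -
  note [simp] = precover_arr[OF r] c R_Ob[OF Y]
  obtain Y' where Y': "Y' \<in> R" "isomorphic T Y' (susp E Y)" using shift_in_R[OF Y] by blast
  from Y'(2) obtain A B where "A \<in> Arr T" "Dom T A = Y'" "Cod T A = susp E Y" "B \<in> Arr T"
    "Dom T B = susp E Y" "Cod T B = Y'" "A \<star> B = Ident T (susp E Y)" by (rule isomorphic_T_E)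
  then obtain g h where gh [simp]: "g \<in> Arr E" "Dom E g = Y'" "Cod E g = susp E Y"
    "h \<in> Arr E" "Dom E h = susp E Y" "Cod E h = Y'" and "cl (g \<cdot> h) = cl (Ident E (susp E Y))"
    by (auto elim!: arr_T_E simp: Ident_T)
  then have n: "null ((g \<cdot> h) \<ominus> Ident E (susp E Y))" by (simp add: cl_eq_iff_null)
  obtain t where t [simp]: "t \<in> Arr E" "Dom E t = susp E Y" "Cod E t = hull E Y"
    and pt: "prj E Y \<cdot> t = (g \<cdot> h) \<ominus> Ident E (susp E Y)"
    using null_lift[OF n inc_prj_confl[of Y]] by auto
  obtain x where x [simp]: "x \<in> Arr E" "Dom E x = Y'" "Cod E x = Dom E r" and rx: "r \<cdot> x = c \<cdot> g"
    using precover_lift[OF r, of "c \<cdot> g"] Y'(1) by auto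
  obtain z where z [simp]: "z \<in> Arr E" "Dom E z = hull E Y" "Cod E z = Dom E r" and rz: "r \<cdot> z = c \<cdot> prj E Y"
    using precover_lift[OF r, of "c \<cdot> prj E Y"] R_hulls[OF Y] by auto
  have "r \<cdot> (z \<cdot> t) = (r \<cdot> z) \<cdot> t" by simp
  also have "\<dots> = c \<cdot> (prj E Y \<cdot> t)" unfolding rz by simp
  also have "\<dots> = (c \<cdot> (g \<cdot> h)) \<ominus> c" unfolding pt by (simp add: comp_diff)
  finally have rzt: "r \<cdot> (z \<cdot> t) = (c \<cdot> (g \<cdot> h)) \<ominus> c" .
  have "r \<cdot> (x \<cdot> h) = (r \<cdot> x) \<cdot> h" by simp
  also have "\<dots> = c \<cdot> (g \<cdot> h)" unfolding rx by simp
  finally have "r \<cdot> ((x \<cdot> h) \<ominus> (z \<cdot> t)) = (c \<cdot> (g \<cdot> h)) \<ominus> ((c \<cdot> (g \<cdot> h)) \<ominus> c)"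
    using rzt by (simp add: comp_diff)
  also have "\<dots> = c"
    using add_diff[of c "(c \<cdot> (g \<cdot> h)) \<ominus> c"] add_comm[of c "(c \<cdot> (g \<cdot> h)) \<ominus> c"] diff_add[of "c \<cdot> (g \<cdot> h)" c] by simp
  finally show ?thesis by (intro that[of "(x \<cdot> h) \<ominus> (z \<cdot> t)"]) simp_all
qed

lemma precover_surj_T:
  assumes r: "precover E R X r" and \<psi>: "\<psi> \<in> Arr T" "Dom T \<psi> \<in> R" "Cod T \<psi> = X"
  obtains \<phi> where "\<phi> \<in> Arr T" "Dom T \<phi> = Dom T \<psi>" "Cod T \<phi> = Dom E r" "cl r \<star> \<phi> = \<psi>"
proof -
  obtain f where f: "f \<in> Arr E" "\<psi> = cl f" "Dom T \<psi> = Dom E f" "Cod T \<psi> = Cod E f" using \<psi>(1) by (rule arr_T_E)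
  obtain h where h: "h \<in> Arr E" "Dom E h = Dom E f" "Cod E h = Dom E r" "r \<cdot> h = f"
    using precover_lift[OF r f(1)] f \<psi> by auto
  have "cl r \<star> cl h = \<psi>" using precover_arr[OF r] h f(2) by simp
  then show ?thesis using that[of "cl h"] h(1-3) f(3) by simp
qed

text \<open>
  If \<open>r \<circ> f\<close> is null, it factors through \<open>I(Y)\<close>, which lies in the class; the factor lifts along
  \<open>r\<close>, so subtracting a null arrow from \<open>f\<close> makes \<open>r \<circ> f\<close> zero.
\<close>

lemma precover_exact_T:
  assumes r: "precover E R X r" and k: "is_kernel E k r" and \<psi>: "\<psi> \<in> Arr T" "Dom T \<psi> \<in> R" "Cod T \<psi> = Dom E r"
    and 0: "cl r \<star> \<psi> = Zero T (Dom T \<psi>) X"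
  obtains \<chi> where "\<chi> \<in> Arr T" "Dom T \<chi> = Dom T \<psi>" "Cod T \<chi> = Dom E k" "cl k \<star> \<chi> = \<psi>"
proof -
  obtain f where f: "f \<in> Arr E" "\<psi> = cl f" "Dom T \<psi> = Dom E f" "Cod T \<psi> = Cod E f" using \<psi>(1) by (rule arr_T_E)
  have Y: "Dom E f \<in> R" using f \<psi> by simp
  note [simp] = precover_arr[OF r] kernel_arr(1,3)[OF k] f(1) R_Ob[OF Y]
  have [simp]: "Cod E f = Dom E r" using f \<psi> by simp
  have "null (r \<cdot> f)" using 0 cl_eq_zero_iff[of "r \<cdot> f"] unfolding f(2) by simp
  then obtain b where b [simp]: "b \<in> Arr E" "Dom E b = hull E (Dom E f)" "Cod E b = X"
    and bi: "b \<cdot> inc E (Dom E f) = r \<cdot> f" using null_factor[of "r \<cdot> f"] by auto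
  obtain e where e [simp]: "e \<in> Arr E" "Dom E e = hull E (Dom E f)" "Cod E e = Dom E r" and re: "r \<cdot> e = b"
    using precover_lift[OF r, of b] R_hulls[OF Y] by auto
  have "(r \<cdot> e) \<cdot> inc E (Dom E f) = r \<cdot> f" unfolding re by (rule bi)
  then have "r \<cdot> (f \<ominus> (e \<cdot> inc E (Dom E f))) = Zero E (Dom E f) X"
    by (simp add: comp_diff diff_self)
  then obtain g where g [simp]: "g \<in> Arr E" "Dom E g = Dom E f" "Cod E g = Dom E k"
    and kg: "k \<cdot> g = f \<ominus> (e \<cdot> inc E (Dom E f))"
    using kernel_factor[OF k, of "f \<ominus> (e \<cdot> inc E (Dom E f))"] by auto
  have "null (e \<cdot> inc E (Dom E f))" by (rule null_through_injective[OF hull_injective[of "Dom E f"]]) simp_all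
  then have "stable_eq E (k \<cdot> g) f" unfolding kg by (intro stable_eq_diff) simp_all
  then have "cl k \<star> cl g = \<psi>" unfolding f(2) by (simp add: cl_eq_iff)
  then show ?thesis using that[of "cl g"] f(3) by simp
qed

text \<open>
  This is where closure under shifts enters. The sequence \<open>K \<rightarrow> R \<rightarrow> X\<close> need not be a conflation, but hom
  from \<open>Y\<close> and from \<open>I(Y)\<close> turns it into short exact sequences, and the snake lemma gives a connecting
  homomorphism from the arrows \<open>Y[1] \<rightarrow> X\<close> to the stable arrows \<open>Y \<rightarrow> K\<close>. It vanishes, since all arrows
  \<open>Y[1] \<rightarrow> X\<close> lift to \<open>R\<close>.
\<close>

lemma kernel_of_precover_mono_T:
  assumes r: "precover E R X r" and k: "is_kernel E k r" and \<chi>: "\<chi> \<in> Arr T" "Dom T \<chi> \<in> R" "Cod T \<chi> = Dom E k"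
    and 0: "cl k \<star> \<chi> = Zero T (Dom T \<chi>) (Dom E r)"
  shows "\<chi> = Zero T (Dom T \<chi>) (Dom E k)"
proof -
  obtain f where f: "f \<in> Arr E" "\<chi> = cl f" "Dom T \<chi> = Dom E f" "Cod T \<chi> = Cod E f" using \<chi>(1) by (rule arr_T_E)
  define Y where "Y = Dom E f"
  have Y: "Y \<in> R" using f \<chi> by (simp add: Y_def)
  note [simp] = precover_arr[OF r] kernel_arr(1,3)[OF k] f(1) R_Ob[OF Y] Y_def[symmetric]
  have [simp]: "Cod E f = Dom E k" using f \<chi> by simp
  have [simp]: "X \<in> Ob E" using dom_cod(2)[OF precover_arr(1)[OF r]] by simp
  note c = inc_prj_confl[OF R_Ob[OF Y]]
  have "null (k \<cdot> f)" using 0 cl_eq_zero_iff[of "k \<cdot> f"] unfolding f(2) by simp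
  then obtain b where b [simp]: "b \<in> Arr E" "Dom E b = hull E Y" "Cod E b = Dom E r"
    and bi: "b \<cdot> inc E Y = k \<cdot> f" using null_factor[of "k \<cdot> f"] by auto
  have "r \<cdot> (k \<cdot> f) = (r \<cdot> k) \<cdot> f" by simp
  then have "(r \<cdot> b) \<cdot> inc E Y = Zero E Y X" using kernel_arr(4)[OF k] by (simp add: bi)
  then obtain d where d [simp]: "d \<in> Arr E" "Dom E d = susp E Y" "Cod E d = X" and dp: "d \<cdot> prj E Y = r \<cdot> b"
    using cokernel_factor[OF confl_cokernel[OF c], of "r \<cdot> b"] by auto
  obtain d' where d' [simp]: "d' \<in> Arr E" "Dom E d' = susp E Y" "Cod E d' = Dom E r" and rd': "r \<cdot> d' = d"
    by (rule precover_lift_susp[OF r Y d])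
  have "r \<cdot> (d' \<cdot> prj E Y) = (r \<cdot> d') \<cdot> prj E Y" by simp
  then have "r \<cdot> (b \<ominus> (d' \<cdot> prj E Y)) = Zero E (hull E Y) X"
    unfolding rd' dp by (simp add: comp_diff diff_self)
  then obtain e where e [simp]: "e \<in> Arr E" "Dom E e = hull E Y" "Cod E e = Dom E k" and ke: "k \<cdot> e = b \<ominus> (d' \<cdot> prj E Y)"
    using kernel_factor[OF k, of "b \<ominus> (d' \<cdot> prj E Y)"] by auto
  have "k \<cdot> (e \<cdot> inc E Y) = (k \<cdot> e) \<cdot> inc E Y" by simp
  also have "\<dots> = k \<cdot> f" unfolding ke using confl(4)[OF c] by (simp add: diff_comp bi)
  finally have ef: "e \<cdot> inc E Y = f" by - (rule kernel_mono[OF k], simp_all)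
  have "null f" unfolding ef[symmetric] by (rule null_through_injective[OF hull_injective[of Y]]) simp_all
  then have "cl f = Zero T (Dom E f) (Cod E f)" using cl_eq_zero_iff[OF f(1)] by blast
  then show ?thesis unfolding f(2) by simp
qed

text \<open>
  An arrow is tested by its effect on stable hom groups from objects of the class. An arrow
  that is both \<open>R_mono\<close> and \<open>R_epi\<close> is an approximation, whose cone is right orthogonal to the class.
\<close>

definition R_mono :: "'a set \<Rightarrow> bool" where
  "R_mono A \<longleftrightarrow> A \<in> Arr T \<and> (\<forall>Y \<in> R. \<forall>\<phi> \<in> Hom T Y (Dom T A).
     A \<star> \<phi> = Zero T Y (Cod T A) \<longrightarrow> \<phi> = Zero T Y (Dom T A))"

definition R_epi :: "'a set \<Rightarrow> bool" where
  "R_epi A \<longleftrightarrow> A \<in> Arr T \<and> (\<forall>Y \<in> R. \<forall>\<psi> \<in> Hom T Y (Cod T A). \<exists>\<phi> \<in> Hom T Y (Dom T A). A \<star> \<phi> = \<psi>)"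

lemma R_monoD:
  assumes "R_mono A" "\<phi> \<in> Arr T" "Dom T \<phi> \<in> R" "Cod T \<phi> = Dom T A" "A \<star> \<phi> = Zero T (Dom T \<phi>) (Cod T A)"
  shows "\<phi> = Zero T (Dom T \<phi>) (Dom T A)"
proof -
  have "\<phi> \<in> Hom T (Dom T \<phi>) (Dom T A)" using assms by (simp add: Hom_def)
  then show ?thesis using assms(1,3,5) unfolding R_mono_def by blast
qed

lemma R_epiE:
  assumes "R_epi A" "\<psi> \<in> Arr T" "Dom T \<psi> \<in> R" "Cod T \<psi> = Cod T A"
  obtains \<phi> where "\<phi> \<in> Arr T" "Dom T \<phi> = Dom T \<psi>" "Cod T \<phi> = Dom T A" "A \<star> \<phi> = \<psi>"
proof -
  have "\<psi> \<in> Hom T (Dom T \<psi>) (Cod T A)" using assms by (simp add: Hom_def)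
  then have "\<exists>\<phi> \<in> Hom T (Dom T \<psi>) (Dom T A). A \<star> \<phi> = \<psi>" using assms(1,3) unfolding R_epi_def by blast
  then show ?thesis using that by (auto simp: Hom_def)
qed

text \<open>
  Every object of the class is stably a shift of another one, so the test also applies to
  \<open>A[1]\<close>.
\<close>

lemma R_mono_susp:
  assumes A: "R_mono A" and \<phi>: "\<phi> \<in> Arr T" "Dom T \<phi> \<in> R" "Cod T \<phi> = susp E (Dom T A)"
    and 0: "susp_arr E A \<star> \<phi> = Zero T (Dom T \<phi>) (susp E (Cod T A))"
  shows "\<phi> = Zero T (Dom T \<phi>) (susp E (Dom T A))"
proof -
  have A1 [simp]: "A \<in> Arr T" using A by (simp add: R_mono_def)
  have [simp]: "Dom T A \<in> Ob E" "Cod T A \<in> Ob E" using T.dom_cod[OF A1] by simp_all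
  obtain Y where Y: "Y \<in> R" "isomorphic T (susp E Y) (Dom T \<phi>)" using desuspend_in_R[OF \<phi>(2)] by blast
  note [simp] = \<phi>(1,3) R_Ob[OF Y(1)] R_Ob[OF \<phi>(2)]
  from Y(2) obtain a b where ab [simp]: "a \<in> Arr T" "Dom T a = susp E Y" "Cod T a = Dom T \<phi>"
    "b \<in> Arr T" "Dom T b = Dom T \<phi>" "Cod T b = susp E Y" and ab_id: "a \<star> b = Ident T (Dom T \<phi>)"
    by (rule isomorphic_T_E)
  obtain \<chi> where \<chi>: "\<chi> \<in> Arr T" "Dom T \<chi> = Y" "Cod T \<chi> = Dom T A" "susp_arr E \<chi> = \<phi> \<star> a"
    by (rule susp_full[of "\<phi> \<star> a" Y "Dom T A"]) simp_all
  note [simp] = \<chi>(1-3)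
  have "susp_arr E (A \<star> \<chi>) = (susp_arr E A \<star> \<phi>) \<star> a" by (simp add: susp_comp \<chi>(4))
  also have "\<dots> = Zero T (susp E Y) (susp E (Cod T A))" by (simp add: 0)
  finally have "A \<star> \<chi> = Zero T Y (Cod T A)" using susp_faithful[of "A \<star> \<chi>"] by simp
  then have "\<chi> = Zero T Y (Dom T A)" using R_monoD[OF A, of \<chi>] Y(1) by simp
  then have \<phi>a: "\<phi> \<star> a = Zero T (susp E Y) (susp E (Dom T A))" using \<chi>(4) by (simp add: susp_zero)
  have "\<phi> = (\<phi> \<star> a) \<star> b" by (simp add: ab_id)
  also have "\<dots> = Zero T (Dom T \<phi>) (susp E (Dom T A))" unfolding \<phi>a by simp
  finally show ?thesis .
qed

text \<open>
  Let \<open>K \<rightarrow> R \<rightarrow> X\<close> be a precover with its kernel and \<open>\<sigma> : s \<rightarrow> K\<close> an approximation. Let \<open>C\<close> be the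
  cone of \<open>s \<rightarrow> K \<rightarrow> R\<close>. Since \<open>s \<rightarrow> R\<close> is injective on hom from the class and its shifts, hom
  into \<open>C\<close> is the quotient of hom into \<open>R\<close> by hom into \<open>s\<close>, that is, by hom into \<open>K\<close>; so it is
  hom into \<open>X\<close>. Any factorization \<open>\<gamma>\<close> of \<open>R \<rightarrow> X\<close> through \<open>C\<close> realizes this isomorphism. It does not
  matter which one, so \<open>\<gamma>\<close> need not be compatible with further triangles.
\<close>

lemma resolution_step:
  assumes r: "precover E R X r" and k: "is_kernel E k r"
    and \<sigma>: "R_mono \<sigma>" "R_epi \<sigma>" "Cod T \<sigma> = Dom E k"
    and S: "triangulated_subcategory T S" "R \<subseteq> S" "Dom T \<sigma> \<in> S"
  obtains \<gamma> where "R_mono \<gamma>" "R_epi \<gamma>" "Cod T \<gamma> = X" "Dom T \<gamma> \<in> S"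
proof -
  have \<sigma>1 [simp]: "\<sigma> \<in> Arr T" using \<sigma> by (simp add: R_mono_def)
  note [simp] = precover_arr[OF r] kernel_arr(1,3)[OF k] \<sigma>(3)
  have [simp]: "X \<in> Ob E" "Dom E r \<in> Ob E" "Dom E k \<in> Ob E" "Dom T \<sigma> \<in> Ob E"
    using dom_cod(2)[OF precover_arr(1)[OF r]] precover_arr(3)[OF r] T.dom_cod[OF \<sigma>1]
      dom_cod(1)[OF kernel_arr(1)[OF k]] by simp_all
  define \<alpha> where "\<alpha> = cl k \<star> \<sigma>"
  have \<alpha> [simp]: "\<alpha> \<in> Arr T" "Dom T \<alpha> = Dom T \<sigma>" "Cod T \<alpha> = Dom E r" by (simp_all add: \<alpha>_def)
  obtain a where a: "a \<in> Arr E" "\<alpha> = cl a" "Dom T \<alpha> = Dom E a" "Cod T \<alpha> = Cod E a" using \<alpha>(1) by (rule arr_T_E)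
  have [simp]: "Dom E a = Dom T \<sigma>" "Cod E a = Dom E r" using a(3,4)[unfolded \<alpha>(2,3)] by simp_all
  obtain v w q where st: "std_triangle a v w q" using a(1) by (rule standard_exists)
  note s = std_triangle[OF st]
  note tri = distinguished(1,3)[OF standard_in_Triangles[OF st], folded a(2)]
  note [simp] = s(3-5,8,9)
  have C [simp]: "Cod E v \<in> Ob E" by simp
  have \<alpha>_mono: "R_mono \<alpha>"
    unfolding R_mono_def
  proof (intro conjI ballI impI)
    fix Y \<phi> assume Y: "Y \<in> R" and "\<phi> \<in> Hom T Y (Dom T \<alpha>)" and 0: "\<alpha> \<star> \<phi> = Zero T Y (Cod T \<alpha>)"
    then have \<phi> [simp]: "\<phi> \<in> Arr T" "Dom T \<phi> = Y" "Cod T \<phi> = Dom T \<sigma>" by (simp_all add: Hom_def)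
    have "cl k \<star> (\<sigma> \<star> \<phi>) = Zero T Y (Dom E r)" using 0 by (simp add: \<alpha>_def)
    then have "\<sigma> \<star> \<phi> = Zero T Y (Dom E k)"
      using kernel_of_precover_mono_T[OF r k, of "\<sigma> \<star> \<phi>"] Y by simp
    then show "\<phi> = Zero T Y (Dom T \<alpha>)" using R_monoD[OF \<sigma>(1), of \<phi>] Y by simp
  qed simp
  have "cl r \<star> \<alpha> = (cl r \<star> cl k) \<star> \<sigma>" unfolding \<alpha>_def by (rule T.assoc[symmetric]) simp_all
  moreover have "cl r \<star> cl k = Zero T (Dom E k) X" using kernel_arr(4)[OF k] by (simp add: Zero_T)
  ultimately have "cl r \<star> \<alpha> = Zero T (Dom T \<alpha>) (Cod T (cl r))" by simp
  then obtain \<gamma> where "\<gamma> \<in> Arr T" "Dom T \<gamma> = Cod T (cl v)" "Cod T \<gamma> = Cod T (cl r)" and \<gamma>v: "\<gamma> \<star> cl v = cl r"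
    by (rule weak_cokernel_factor[OF tri(1), rotated 2]) simp_all
  then have \<gamma> [simp]: "\<gamma> \<in> Arr T" "Dom T \<gamma> = Cod E v" "Cod T \<gamma> = X" by simp_all
  have "R_epi \<gamma>"
    unfolding R_epi_def
  proof (intro conjI ballI)
    fix Y \<psi> assume Y: "Y \<in> R" "\<psi> \<in> Hom T Y (Cod T \<gamma>)"
    then have "\<psi> \<in> Arr T" "Dom T \<psi> = Y" "Cod T \<psi> = X" by (simp_all add: Hom_def)
    then obtain \<phi> where \<phi>: "\<phi> \<in> Arr T" "Dom T \<phi> = Y" "Cod T \<phi> = Dom E r" "cl r \<star> \<phi> = \<psi>"
      using precover_surj_T[OF r, of \<psi>] Y(1) by auto
    have "(\<gamma> \<star> cl v) \<star> \<phi> = \<psi>" unfolding \<gamma>v by (rule \<phi>(4))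
    then have "\<gamma> \<star> (cl v \<star> \<phi>) = \<psi>" using \<phi>(1-3) by simp
    then show "\<exists>\<phi> \<in> Hom T Y (Dom T \<gamma>). \<gamma> \<star> \<phi> = \<psi>"
      using \<phi>(1-3) by (intro bexI[of _ "cl v \<star> \<phi>"]) (simp_all add: Hom_def)
  qed simp
  moreover have "R_mono \<gamma>"
    unfolding R_mono_def
  proof (intro conjI ballI impI)
    fix Y \<phi> assume Y: "Y \<in> R" and "\<phi> \<in> Hom T Y (Dom T \<gamma>)" and 0: "\<gamma> \<star> \<phi> = Zero T Y (Cod T \<gamma>)"
    then have \<phi> [simp]: "\<phi> \<in> Arr T" "Dom T \<phi> = Y" "Cod T \<phi> = Cod E v" by (simp_all add: Hom_def)
    note [simp] = R_Ob[OF Y]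
    have "susp_arr E \<alpha> \<star> cl w = Zero T (Cod E v) (susp E (Dom E r))"
      using tri(2) by (simp add: weak_cokernel_def)
    then have "(susp_arr E \<alpha> \<star> cl w) \<star> \<phi> = Zero T Y (susp E (Dom E r))" by simp
    then have "susp_arr E \<alpha> \<star> (cl w \<star> \<phi>) = Zero T Y (susp E (Cod T \<alpha>))" by simp
    then have "cl w \<star> \<phi> = Zero T Y (susp E (Dom T \<sigma>))"
      using R_mono_susp[OF \<alpha>_mono, of "cl w \<star> \<phi>"] Y by simp
    then obtain \<psi> where "\<psi> \<in> Arr T" "Dom T \<psi> = Dom T \<phi>" "Cod T \<psi> = Dom E v" and v\<psi>: "cl v \<star> \<psi> = \<phi>"
      using confl_lift_T[OF standard_confl[OF st], of \<phi>] by auto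
    then have \<psi> [simp]: "\<psi> \<in> Arr T" "Dom T \<psi> = Y" "Cod T \<psi> = Dom E r" by simp_all
    have "cl r \<star> \<psi> = (\<gamma> \<star> cl v) \<star> \<psi>" unfolding \<gamma>v ..
    also have "\<dots> = \<gamma> \<star> (cl v \<star> \<psi>)" by simp
    also have "\<dots> = Zero T (Dom T \<psi>) X" unfolding v\<psi> 0 by simp
    finally obtain \<chi> where "\<chi> \<in> Arr T" "Dom T \<chi> = Dom T \<psi>" "Cod T \<chi> = Dom E k" and k\<chi>: "cl k \<star> \<chi> = \<psi>"
      using precover_exact_T[OF r k, of \<psi>] Y by auto
    then have \<chi> [simp]: "\<chi> \<in> Arr T" "Dom T \<chi> = Y" "Cod T \<chi> = Dom E k" by simp_all
    obtain \<xi> where "\<xi> \<in> Arr T" "Dom T \<xi> = Dom T \<chi>" "Cod T \<xi> = Dom T \<sigma>" and \<sigma>\<xi>: "\<sigma> \<star> \<xi> = \<chi>"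
      using R_epiE[OF \<sigma>(2), of \<chi>] Y by auto
    then have \<xi> [simp]: "\<xi> \<in> Arr T" "Dom T \<xi> = Y" "Cod T \<xi> = Dom T \<sigma>" by simp_all
    have "\<phi> = cl v \<star> (cl k \<star> (\<sigma> \<star> \<xi>))" unfolding \<sigma>\<xi> k\<chi> v\<psi> ..
    also have "\<dots> = (cl v \<star> \<alpha>) \<star> \<xi>" by (simp add: \<alpha>_def)
    also have "cl v \<star> \<alpha> = Zero T (Dom T \<sigma>) (Cod E v)" using tri(1) by (simp add: weak_cokernel_def)
    finally show "\<phi> = Zero T Y (Dom T \<gamma>)" by simp
  qed simp
  moreover have "Dom T \<gamma> \<in> S"
  proof -
    have "Dom T (cl a) \<in> S \<and> Dom T (cl v) \<in> S \<longrightarrow> Dom T (cl w) \<in> S"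
      using S(1) standard_in_Triangles[OF st] unfolding triangulated_subcategory_def by blast
    moreover have "Dom T (cl a) \<in> S" using S(3) a(1) by simp
    moreover have "Dom T (cl v) \<in> S" using S(2) precover_arr(2)[OF r] by auto
    ultimately show ?thesis by simp
  qed
  ultimately show ?thesis using \<gamma>(3) that by blast
qed

text \<open>
  Climbing a finite resolution from its last term, where the identity is an approximation.
\<close>

lemma R_approximation:
  assumes X: "finite_dimension E R X" and S: "triangulated_subcategory T S" "R \<subseteq> S"
  obtains \<gamma> where "R_mono \<gamma>" "R_epi \<gamma>" "Cod T \<gamma> = X" "Dom T \<gamma> \<in> S"
proof -
  obtain K r k d where res: "is_resolution E R X K r k" and d: "K d \<in> R"
    using X by (auto simp: finite_dimension_def)
  have K: "K 0 = X" "precover E R (K n) (r n)" "is_kernel E (k n) (r n)" "Dom E (k n) = K (Suc n)" for n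
    using res by (simp_all add: is_resolution_def)
  have "\<exists>\<gamma>. R_mono \<gamma> \<and> R_epi \<gamma> \<and> Cod T \<gamma> = K n \<and> Dom T \<gamma> \<in> S" if "n \<le> d" for n
    using that
  proof (induction n rule: inc_induct)
    case base
    note [simp] = R_Ob[OF d]
    have "R_mono (Ident T (K d))" "R_epi (Ident T (K d))"
      unfolding R_mono_def R_epi_def by (auto simp: Hom_def)
    then show ?case using d S(2) by (intro exI[of _ "Ident T (K d)"]) auto
  next
    case (step n)
    then obtain \<sigma> where "R_mono \<sigma>" "R_epi \<sigma>" "Cod T \<sigma> = K (Suc n)" "Dom T \<sigma> \<in> S" by blast
    then show ?case using resolution_step[OF K(2,3), of \<sigma> n S] K(4) S by metis
  qed
  from this[of 0] show ?thesis using that K(1) by auto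
qed

definition R_perp :: "'o set" where
  "R_perp = {Y \<in> Ob E. \<forall>X \<in> R. vanishing X Y}"

lemma R_perp_iso: "Y \<in> R_perp \<Longrightarrow> isomorphic T Y Y' \<Longrightarrow> Y' \<in> R_perp"
  unfolding R_perp_def using vanishing_iso T.isomorphic_refl by (auto elim: isomorphic_T_E)

lemma R_perp_susp:
  assumes Y: "Y \<in> Ob E" shows "susp E Y \<in> R_perp \<longleftrightarrow> Y \<in> R_perp"
proof
  assume P: "susp E Y \<in> R_perp"
  have "vanishing X Y" if X: "X \<in> R" for X
  proof -
    obtain X' where X': "X' \<in> R" "isomorphic T X' (susp E X)" using shift_in_R[OF X] by blast
    then have "vanishing X' (susp E Y)" using P by (simp add: R_perp_def)
    then have "vanishing (susp E X) (susp E Y)" by (rule vanishing_iso[OF _ X'(2) T.isomorphic_refl]) (simp add: Y)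
    then show ?thesis using X Y by (simp add: vanishing_susp)
  qed
  then show "Y \<in> R_perp" using Y by (simp add: R_perp_def)
next
  assume P: "Y \<in> R_perp"
  have "vanishing X (susp E Y)" if X: "X \<in> R" for X
  proof -
    obtain X' where X': "X' \<in> R" "isomorphic T (susp E X') X" using desuspend_in_R[OF X] by blast
    then have "vanishing (susp E X') (susp E Y)" using P Y by (simp add: R_perp_def vanishing_susp)
    then show ?thesis by (rule vanishing_iso[OF _ X'(2) T.isomorphic_refl]) (simp add: Y)
  qed
  then show "susp E Y \<in> R_perp" using Y by (simp add: R_perp_def)
qed

lemma cone_in_R_perp:
  assumes \<gamma>: "R_mono (cl u)" "R_epi (cl u)" and st: "std_triangle u v w q"
  shows "Cod E v \<in> R_perp"
proof -
  note s = std_triangle[OF st]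
  note [simp] = s(1,3-5,8,9)
  have ob [simp]: "Dom E u \<in> Ob E" "Cod E u \<in> Ob E" "Cod E v \<in> Ob E" by simp_all
  note wc = distinguished(1,3)[OF standard_in_Triangles[OF st]]
  have "vanishing Y (Cod E v)" if Y: "Y \<in> R" for Y
  proof (rule vanishingI)
    fix \<phi> assume \<phi> [simp]: "\<phi> \<in> Arr T" "Dom T \<phi> = Y" "Cod T \<phi> = Cod E v"
    note [simp] = R_Ob[OF Y]
    have "susp_arr E (cl u) \<star> cl w = Zero T (Cod E v) (susp E (Cod E u))"
      using wc(2) by (simp add: weak_cokernel_def)
    then have "(susp_arr E (cl u) \<star> cl w) \<star> \<phi> = Zero T Y (susp E (Cod E u))" by simp
    then have "susp_arr E (cl u) \<star> (cl w \<star> \<phi>) = Zero T Y (susp E (Cod E u))" by simp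
    then have "cl w \<star> \<phi> = Zero T Y (susp E (Dom E u))"
      using R_mono_susp[OF \<gamma>(1), of "cl w \<star> \<phi>"] Y by simp
    then obtain \<psi> where "\<psi> \<in> Arr T" "Dom T \<psi> = Dom T \<phi>" "Cod T \<psi> = Dom E v" and v\<psi>: "cl v \<star> \<psi> = \<phi>"
      using confl_lift_T[OF standard_confl[OF st], of \<phi>] by auto
    then have \<psi> [simp]: "\<psi> \<in> Arr T" "Dom T \<psi> = Y" "Cod T \<psi> = Cod E u" by simp_all
    obtain \<xi> where "\<xi> \<in> Arr T" "Dom T \<xi> = Dom T \<psi>" "Cod T \<xi> = Dom T (cl u)" and u\<xi>: "cl u \<star> \<xi> = \<psi>"
      using R_epiE[OF \<gamma>(2), of \<psi>] Y by auto
    then have \<xi> [simp]: "\<xi> \<in> Arr T" "Dom T \<xi> = Y" "Cod T \<xi> = Dom E u" by simp_all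
    have "\<phi> = cl v \<star> (cl u \<star> \<xi>)" unfolding u\<xi> v\<psi> ..
    also have "\<dots> = (cl v \<star> cl u) \<star> \<xi>" by (rule T.assoc[symmetric]) simp_all
    also have "cl v \<star> cl u = Zero T (Dom E u) (Cod E v)" using wc(1) unfolding weak_cokernel_def by (simp del: comp_cl)
    finally show "\<phi> = Zero T Y (Cod E v)" by simp
  qed
  then show ?thesis by (simp add: R_perp_def)
qed

text \<open>
  The reflection is the cone inclusion \<open>X \<rightarrow> C\<close> of an approximation \<open>s \<rightarrow> X\<close>. Its own cone is
  \<open>s[1]\<close>. The objects left orthogonal to all of \<open>R_perp\<close> form a localizing subcategory containing
  the class, hence contain its localizing closure; so \<open>C\<close> is local.
\<close>

theorem reflection:
  fixes \<iota> :: "'i itself"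
  assumes X: "X \<in> Ob E" "finite_dimension E R X"
  defines "S \<equiv> localizing_closure \<iota> T R"
  shows "\<exists>\<eta> \<in> cone_in T S. Dom T \<eta> = X \<and> local_object T S (Cod T \<eta>)"
proof -
  have S: "triangulated_subcategory T S" unfolding S_def by (rule localizing_closure_triangulated[OF R_objects])
  have RS: "R \<subseteq> S" by (auto simp: S_def localizing_closure_def)
  obtain \<gamma> where \<gamma>: "R_mono \<gamma>" "R_epi \<gamma>" "Cod T \<gamma> = X" "Dom T \<gamma> \<in> S"
    using X(2) S RS by (rule R_approximation)
  have "\<gamma> \<in> Arr T" using \<gamma>(1) by (simp add: R_mono_def)
  then obtain u where u: "u \<in> Arr E" "\<gamma> = cl u" "Dom T \<gamma> = Dom E u" "Cod T \<gamma> = Cod E u" by (rule arr_T_E)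
  obtain v w q where st: "std_triangle u v w q" using u(1) by (rule standard_exists)
  obtain v' w' q' where st': "std_triangle v v' w' q'" using std_triangle(9)[OF st] by (rule standard_exists)
  note s = std_triangle[OF st] note s' = std_triangle[OF st']
  have Du: "Dom E u \<in> S" "Dom E u \<in> Ob E" using \<gamma>(4) u by simp_all
  have "susp E (Dom E u) \<in> S" using S Du unfolding triangulated_subcategory_def by simp
  moreover have "isomorphic T (susp E (Dom E u)) (Cod E v')"
    by (rule T.isomorphic_sym[OF standard_cone[OF st st']])
  moreover have "Cod E v' \<in> Ob T" using s'(9) by simp
  ultimately have "Cod E v' \<in> S" using S unfolding triangulated_subcategory_def by blast
  then have cone: "cl v \<in> cone_in T S"
    using standard_in_Triangles[OF st'] s'(9) unfolding cone_in_def by force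
  have perp: "Cod E v \<in> R_perp" using \<gamma>(1,2) st unfolding u(2) by (rule cone_in_R_perp)
  have Ob: "R_perp \<subseteq> Ob E" by (auto simp: R_perp_def)
  have "localizing_subcategory \<iota> T {X \<in> Ob E. \<forall>Y \<in> R_perp. vanishing X Y}"
    by (rule localizing_left_perp[OF Ob R_perp_susp]) (assumption, rule R_perp_iso)
  moreover have "R \<subseteq> {X \<in> Ob E. \<forall>Y \<in> R_perp. vanishing X Y}" by (auto simp: R_perp_def)
  ultimately have SD: "S \<subseteq> {X \<in> Ob E. \<forall>Y \<in> R_perp. vanishing X Y}"
    unfolding S_def by (rule localizing_closure_least)
  have C: "Cod E v \<in> Ob E" using s(9) by simp
  have "local_object T S (Cod E v)"
    using SD perp R_perp_susp[OF C] by (intro local_object_if_vanishing[OF C]) blast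
  then show ?thesis using cone s(8,9) u(4) \<gamma>(3) by (intro bexI[of _ "cl v"]) simp_all
qed

end

theorem corollary3p2:
  fixes E :: "('o, 'a) frob_cat"
    and R :: "'o set"
    and T :: "('o, 'a set) tri_cat"
    and S :: "'o set"
    and Q :: "('p, 'b) cat"
    and jO :: "'o \<Rightarrow> 'p"
    and jA :: "'a set \<Rightarrow> 'b"
  assumes frobenius: "frobenius_category E"
    and stable: "T = stable_cat E"
    and objects: "R \<subseteq> Ob E"
    and precovering: "precovering E R"
    and kernels: "\<And>X f. precover E R X f \<Longrightarrow> \<exists>k. is_kernel E k f"
    and shifts: "shift_closed T R"
    and hulls: "\<And>X. X \<in> R \<Longrightarrow> hull E X \<in> R"
    and finite_dim: "\<And>X. X \<in> Ob T \<Longrightarrow> finite_dimension E R X"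
    and localizing: "S = localizing_closure TYPE('i) T R"
    and quotient: "verdier_quotient T S Q jO jA"
  shows "has_right_adjoint T Q jO jA"
proof -
  interpret precovering_class E R
    using frobenius objects shifts hulls unfolding stable by unfold_locales
  show ?thesis
  proof (rule verdier_quotient_right_adjoint[OF quotient])
    show "cone_in T S \<subseteq> Arr T" unfolding stable by (rule cone_in_arr)
    fix X assume "X \<in> Ob T"
    then show "\<exists>\<eta>\<in>cone_in T S. Dom T \<eta> = X \<and> local_object T S (Cod T \<eta>)"
      using reflection[OF _ finite_dim] unfolding localizing stable by simp
  qed
qed

end
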